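(* Let $\Omega\subset\mathbb{R}^n$ ($n\ge3$) be a smooth bounded domain, ${\bf a}=(a_1,\dots,a_n):\bar\Omega\to\mathbb{R}^n$ a smooth vector field with ${\rm div}\,{\bf a}\ge0$ on $\Omega$, $f\in L^2(\Omega)$ and $1<p\le\frac{2n}{n-2}$. On $H^1_0(\Omega)$ define $$\Psi(u)=\frac12\int_\Omega|\nabla u|^2dx+\frac1p\int_\Omega|u|^pdx+\int_\Omega fu\,dx+\frac14\int_\Omega{\rm div}({\bf a})|u|^2dx,$$ let $\Psi^*$ be its Legendre transform on $H^{-1}(\Omega)$, and set $I(u)=\Psi(u)+\Psi^*\big({\bf a}\cdot\nabla u+\tfrac12{\rm div}({\bf a})u\big)$. Then there exists $\bar u\in H^1_0(\Omega)$ with $I(\bar u)=\inf\{I(u):u\in H^1_0(\Omega)\}=0$, and $\bar u$ solves $$\Delta u+\sum_{i=1}^na_i\frac{\partial u}{\partial x_i}=|u|^{p-2}u+f\ \text{in }\Omega,\qquad u=0\ \text{on }\partial\Omega.$$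
   Context: The Legendre transform is taken with respect to the duality between $H^1_0(\Omega)$ and $H^{-1}(\Omega)$: $\Psi^*(v)=\sup_{u\in H^1_0}\{\langle v,u\rangle-\Psi(u)\}$. *)

theory Defs
  imports "HOL-Analysis.Analysis"
begin

definition partial :: "'n::finite \<Rightarrow> (real^'n \<Rightarrow> real) \<Rightarrow> real^'n \<Rightarrow> real" where
  "partial i f x = deriv (\<lambda>t. f (x + t *\<^sub>R axis i 1)) 0"

definition grad :: "(real^'n::finite \<Rightarrow> real) \<Rightarrow> real^'n \<Rightarrow> real^'n" where
  "grad f x = (\<chi> i. partial i f x)"

fun Ck_on :: "nat \<Rightarrow> (real^'n::finite) set \<Rightarrow> (real^'n \<Rightarrow> real) \<Rightarrow> bool" where
  "Ck_on 0 S f = continuous_on S f"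
| "Ck_on (Suc k) S f = (continuous_on S f \<and>
     (\<forall>i. (\<forall>x\<in>S. (\<lambda>t. f (x + t *\<^sub>R axis i 1)) field_differentiable (at 0))
          \<and> Ck_on k S (partial i f)))"

definition smooth_on :: "(real^'n::finite) set \<Rightarrow> (real^'n \<Rightarrow> real) \<Rightarrow> bool" where
  "smooth_on S f \<longleftrightarrow> (\<forall>k. Ck_on k S f)"

definition smooth_bounded_domain :: "(real^'n::finite) set \<Rightarrow> bool" where
  "smooth_bounded_domain \<Omega> \<longleftrightarrow> open \<Omega> \<and> connected \<Omega> \<and> bounded \<Omega> \<and> \<Omega> \<noteq> {} \<and>
     (\<exists>\<rho>. smooth_on UNIV \<rho> \<and> \<Omega> = {x. \<rho> x < 0} \<and> frontier \<Omega> = {x. \<rho> x = 0} \<and>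
          (\<forall>x\<in>frontier \<Omega>. grad \<rho> x \<noteq> 0))"

definition smooth_on_closure :: "(real^'n::finite) set \<Rightarrow> (real^'n \<Rightarrow> real) \<Rightarrow> bool" where
  "smooth_on_closure \<Omega> g \<longleftrightarrow> (\<exists>U. open U \<and> closure \<Omega> \<subseteq> U \<and> smooth_on U g)"

definition div_field :: "('n::finite \<Rightarrow> real^'n \<Rightarrow> real) \<Rightarrow> real^'n \<Rightarrow> real" where
  "div_field a x = (\<Sum>i\<in>UNIV. partial i (a i) x)"

definition test_fun :: "(real^'n::finite) set \<Rightarrow> (real^'n \<Rightarrow> real) \<Rightarrow> bool" where
  "test_fun \<Omega> \<phi> \<longleftrightarrow> smooth_on UNIV \<phi> \<and> compact (closure {x. \<phi> x \<noteq> 0}) \<and>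
     closure {x. \<phi> x \<noteq> 0} \<subseteq> \<Omega>"

definition L2 :: "(real^'n::finite) set \<Rightarrow> (real^'n \<Rightarrow> real) \<Rightarrow> bool" where
  "L2 \<Omega> u \<longleftrightarrow> u \<in> borel_measurable (lebesgue_on \<Omega>) \<and>
     integrable (lebesgue_on \<Omega>) (\<lambda>x. (u x)\<^sup>2)"

definition L2v :: "(real^'n::finite) set \<Rightarrow> (real^'n \<Rightarrow> real^'n) \<Rightarrow> bool" where
  "L2v \<Omega> G \<longleftrightarrow> G \<in> borel_measurable (lebesgue_on \<Omega>) \<and>
     integrable (lebesgue_on \<Omega>) (\<lambda>x. (norm (G x))\<^sup>2)"

definition H10_with_grad :: "(real^'n::finite) set \<Rightarrow> (real^'n \<Rightarrow> real) \<Rightarrow> (real^'n \<Rightarrow> real^'n) \<Rightarrow> bool" where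
  "H10_with_grad \<Omega> u G \<longleftrightarrow> L2 \<Omega> u \<and> L2v \<Omega> G \<and>
     (\<exists>\<phi>::nat \<Rightarrow> real^'n \<Rightarrow> real. (\<forall>k. test_fun \<Omega> (\<phi> k)) \<and>
        (\<lambda>k. integral\<^sup>L (lebesgue_on \<Omega>) (\<lambda>x. (\<phi> k x - u x)\<^sup>2)) \<longlonglongrightarrow> 0 \<and>
        (\<lambda>k. integral\<^sup>L (lebesgue_on \<Omega>) (\<lambda>x. (norm (grad (\<phi> k) x - G x))\<^sup>2)) \<longlonglongrightarrow> 0)"

definition H10 :: "(real^'n::finite) set \<Rightarrow> (real^'n \<Rightarrow> real) \<Rightarrow> bool" where
  "H10 \<Omega> u \<longleftrightarrow> (\<exists>G. H10_with_grad \<Omega> u G)"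

definition wgrad :: "(real^'n::finite) set \<Rightarrow> (real^'n \<Rightarrow> real) \<Rightarrow> real^'n \<Rightarrow> real^'n" where
  "wgrad \<Omega> u = (SOME G. H10_with_grad \<Omega> u G)"

definition Psi :: "(real^'n::finite) set \<Rightarrow> ('n \<Rightarrow> real^'n \<Rightarrow> real) \<Rightarrow> (real^'n \<Rightarrow> real) \<Rightarrow> real
                    \<Rightarrow> (real^'n \<Rightarrow> real) \<Rightarrow> real" where
  "Psi \<Omega> a f p u =
     (1/2) * integral\<^sup>L (lebesgue_on \<Omega>) (\<lambda>x. (norm (wgrad \<Omega> u x))\<^sup>2)
   + (1/p) * integral\<^sup>L (lebesgue_on \<Omega>) (\<lambda>x. \<bar>u x\<bar> powr p)
   + integral\<^sup>L (lebesgue_on \<Omega>) (\<lambda>x. f x * u x)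
   + (1/4) * integral\<^sup>L (lebesgue_on \<Omega>) (\<lambda>x. div_field a x * (u x)\<^sup>2)"

text \<open>Legendre transform of Psi w.r.t. the H^{-1}/H^1_0 duality, evaluated at the
  element of H^{-1} induced by an L^2 function v (pairing = integral of v*w).\<close>
definition Psi_star :: "(real^'n::finite) set \<Rightarrow> ('n \<Rightarrow> real^'n \<Rightarrow> real) \<Rightarrow> (real^'n \<Rightarrow> real) \<Rightarrow> real
                    \<Rightarrow> (real^'n \<Rightarrow> real) \<Rightarrow> ereal" where
  "Psi_star \<Omega> a f p v = (SUP w\<in>{w. H10 \<Omega> w}.
      ereal (integral\<^sup>L (lebesgue_on \<Omega>) (\<lambda>x. v x * w x) - Psi \<Omega> a f p w))"

definition I_fun :: "(real^'n::finite) set \<Rightarrow> ('n \<Rightarrow> real^'n \<Rightarrow> real) \<Rightarrow> (real^'n \<Rightarrow> real) \<Rightarrow> real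
                    \<Rightarrow> (real^'n \<Rightarrow> real) \<Rightarrow> ereal" where
  "I_fun \<Omega> a f p u = ereal (Psi \<Omega> a f p u) +
     Psi_star \<Omega> a f p (\<lambda>x. (\<Sum>i\<in>UNIV. a i x * wgrad \<Omega> u x $ i) + (1/2) * div_field a x * u x)"

definition weak_solution :: "(real^'n::finite) set \<Rightarrow> ('n \<Rightarrow> real^'n \<Rightarrow> real) \<Rightarrow> (real^'n \<Rightarrow> real) \<Rightarrow> real
                    \<Rightarrow> (real^'n \<Rightarrow> real) \<Rightarrow> bool" where
  "weak_solution \<Omega> a f p u \<longleftrightarrow> H10 \<Omega> u \<and>
     (\<forall>\<phi>. test_fun \<Omega> \<phi> \<longrightarrow>
        - integral\<^sup>L (lebesgue_on \<Omega>) (\<lambda>x. wgrad \<Omega> u x \<bullet> grad \<phi> x)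
        + integral\<^sup>L (lebesgue_on \<Omega>) (\<lambda>x. (\<Sum>i\<in>UNIV. a i x * wgrad \<Omega> u x $ i) * \<phi> x)
        = integral\<^sup>L (lebesgue_on \<Omega>) (\<lambda>x. (\<bar>u x\<bar> powr (p - 2) * u x + f x) * \<phi> x))"

end

(* The equation reads Gamma u = d Psi(u) with Gamma u = a . grad u + (1/2) div(a) u. Since Gamma is
   skew-adjoint on H^1_0, Fenchel-Young gives I >= <Gamma u, u> = 0, with equality exactly when
   Psi(u) + <Gamma u, w - u> <= Psi(w) for all w. Psi is 1-strongly convex and lower semicontinuous for
   the energy norm, so minimizing sequences of Psi minus a bounded functional are Cauchy; hence the
   inequality with t Gamma in place of Gamma is solvable for t = 0, with a nonexpansive solution map. As
   skewness keeps that map nonexpansive for every t, a contraction argument raises t from 0 to 1 in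
   finitely many steps. No compactness is used; the Sobolev embedding enters only through the
   integrability of |u|^p for u in H^1_0, and is obtained from the Loomis-Whitney inequality. *)

theory Submission
  imports Defs
begin

section \<open>Square-integrable functions\<close>

text \<open>At the critical exponent p = 2n/(n-2) the embedding of H^1_0 into L^p is not compact, so
  every limit is taken in norm: Cauchy sequences come from the strong convexity that the Dirichlet
  term supplies, while the sign of div a makes the divergence term of Psi convex. The power term
  only has to be lower semicontinuous, which Fatou's lemma gives along an a.e. convergent
  subsequence. Integrability of |u|^p is still essential: the Bochner integral of a non-integrable
  function is 0, so the power term would drop out of Psi and its convexity could not be argued. The
  two divergence terms are matched: (1/4) div(a)|u|^2 has derivative (1/2) div(a) u, which cancels
  the correction that makes Gamma skew, and a . grad u is left. The steps in t have a fixed length,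
  below the reciprocal of the bound of the bilinear form of Gamma, as the stability estimate is the
  same for every t. Elements of H^1_0 are functions rather than classes and \<open>wgrad\<close> is
  a choice, so all norms are seminorms and identities between gradients hold almost everywhere
  only.\<close>

lemma fatou_real:
  fixes f :: "nat \<Rightarrow> 'a \<Rightarrow> real"
  assumes int: "\<And>k. integrable M (f k)" and nonneg: "\<And>k x. 0 \<le> f k x"
    and [measurable]: "g \<in> borel_measurable M"
    and lim: "AE x in M. (\<lambda>k. f k x) \<longlonglongrightarrow> g x"
    and bound: "\<forall>\<^sub>F k in sequentially. integral\<^sup>L M (f k) \<le> c"
  shows "integrable M g" "integral\<^sup>L M g \<le> c"
proof -
  have [measurable]: "f k \<in> borel_measurable M" for k using int by auto
  have g0: "AE x in M. 0 \<le> g x"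
    using lim by eventually_elim (rule LIMSEQ_le_const, auto simp: nonneg)
  \<comment> \<open>Since \<open>ennreal\<close> truncates negative reals to 0, reading the final
    bound back as a real one needs 0 \<le> c.\<close>
  have "integral\<^sup>L M (f k) \<ge> 0" for k by (simp add: nonneg)
  then have c0: "0 \<le> c"
    using bound unfolding eventually_sequentially by (meson order_trans le_refl)
  have "(\<integral>\<^sup>+x. ennreal (g x) \<partial>M) = (\<integral>\<^sup>+x. liminf (\<lambda>k. ennreal (f k x)) \<partial>M)"
  proof (intro nn_integral_cong_AE)
    show "AE x in M. ennreal (g x) = liminf (\<lambda>k. ennreal (f k x))"
      using lim by eventually_elim (intro lim_imp_Liminf[symmetric] tendsto_ennrealI, auto)
  qed
  also have "\<dots> \<le> liminf (\<lambda>k. \<integral>\<^sup>+x. ennreal (f k x) \<partial>M)" by (rule nn_integral_liminf) auto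
  also have "\<dots> = liminf (\<lambda>k. ennreal (integral\<^sup>L M (f k)))"
    by (simp add: nn_integral_eq_integral int nonneg)
  also have "\<dots> \<le> ennreal c"
    using bound by (intro Liminf_le) (auto elim!: eventually_mono simp: ennreal_leI)
  finally have le: "(\<integral>\<^sup>+x. ennreal (g x) \<partial>M) \<le> ennreal c" .
  show *: "integrable M g"
    by (rule integrableI_nonneg) (use g0 le in \<open>auto simp: less_top[symmetric] top_unique\<close>)
  show "integral\<^sup>L M g \<le> c"
    using le nn_integral_eq_integral[OF * g0] c0 by simp
qed

text \<open>Scalar functions and vector fields are treated at once: over
  \<open>lebesgue_on \<Omega>\<close> the instances are \<open>L2\<close> and \<open>L2v\<close>.
  Working with functions rather than classes stays close to \<open>H10_with_grad\<close>, at the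
  price that \<open>l2n\<close> is only a seminorm.\<close>

definition sqint :: "'a measure \<Rightarrow> ('a \<Rightarrow> 'b::euclidean_space) \<Rightarrow> bool" where
  "sqint M F \<longleftrightarrow> F \<in> borel_measurable M \<and> integrable M (\<lambda>x. (norm (F x))\<^sup>2)"

definition l2n :: "'a measure \<Rightarrow> ('a \<Rightarrow> 'b::euclidean_space) \<Rightarrow> real" where
  "l2n M F = sqrt (integral\<^sup>L M (\<lambda>x. (norm (F x))\<^sup>2))"

lemma sqint_measurable [measurable_dest]: "sqint M F \<Longrightarrow> F \<in> borel_measurable M"
  by (simp add: sqint_def)

lemma sqint_integrable: "sqint M F \<Longrightarrow> integrable M (\<lambda>x. (norm (F x))\<^sup>2)"
  by (simp add: sqint_def)

lemma l2n_nonneg [simp]: "0 \<le> l2n M F"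
  by (simp add: l2n_def)

lemma l2n_power2: "(l2n M F)\<^sup>2 = integral\<^sup>L M (\<lambda>x. (norm (F x))\<^sup>2)"
  by (simp add: l2n_def)

text \<open>Two majorants serve both uses: linear combinations, and with b = 0 products with a
  bounded coefficient.\<close>

lemma sqint_dominated:
  assumes "sqint M F" "sqint M G" and [measurable]: "K \<in> borel_measurable M"
    and le: "\<And>x. x \<in> space M \<Longrightarrow> norm (K x) \<le> a * norm (F x) + b * norm (G x)"
  shows "sqint M K"
proof -
  note [measurable] = assms(1,2)[THEN sqint_measurable]
  have "integrable M (\<lambda>x. (norm (K x))\<^sup>2)"
  proof (rule Bochner_Integration.integrable_bound)
    show "integrable M (\<lambda>x. 2 * a\<^sup>2 * (norm (F x))\<^sup>2 + 2 * b\<^sup>2 * (norm (G x))\<^sup>2)"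
      using assms(1,2)[THEN sqint_integrable]
      by (intro Bochner_Integration.integrable_add integrable_mult_right)
    show "AE x in M. norm ((norm (K x))\<^sup>2) \<le> norm (2 * a\<^sup>2 * (norm (F x))\<^sup>2 + 2 * b\<^sup>2 * (norm (G x))\<^sup>2)"
    proof (rule AE_I2)
      fix x assume "x \<in> space M"
      have "(norm (K x))\<^sup>2 \<le> (a * norm (F x) + b * norm (G x))\<^sup>2"
        using le[OF \<open>x \<in> space M\<close>] by (intro power_mono) auto
      also have "\<dots> \<le> 2 * a\<^sup>2 * (norm (F x))\<^sup>2 + 2 * b\<^sup>2 * (norm (G x))\<^sup>2"
        using zero_le_power2[of "a * norm (F x) - b * norm (G x)"]
        by (simp add: power2_eq_square algebra_simps)
      finally show "norm ((norm (K x))\<^sup>2) \<le> norm (2 * a\<^sup>2 * (norm (F x))\<^sup>2 + 2 * b\<^sup>2 * (norm (G x))\<^sup>2)"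
        by simp
    qed
  qed measurable
  then show ?thesis by (simp add: sqint_def)
qed

lemma sqint_lincomb:
  assumes "sqint M F" "sqint M G"
  shows "sqint M (\<lambda>x. s *\<^sub>R F x + t *\<^sub>R G x)"
proof (rule sqint_dominated[OF assms])
  note [measurable] = assms[THEN sqint_measurable]
  show "(\<lambda>x. s *\<^sub>R F x + t *\<^sub>R G x) \<in> borel_measurable M" by measurable
  show "norm (s *\<^sub>R F x + t *\<^sub>R G x) \<le> \<bar>s\<bar> * norm (F x) + \<bar>t\<bar> * norm (G x)" for x
    using norm_triangle_ineq[of "s *\<^sub>R F x" "t *\<^sub>R G x"] by simp
qed

lemma sqint_diff: "sqint M F \<Longrightarrow> sqint M G \<Longrightarrow> sqint M (\<lambda>x. F x - G x)"
  using sqint_lincomb[of M F G 1 "-1"] by simp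

lemma sqint_inner_integrable:
  assumes "sqint M F" "sqint M G"
  shows "integrable M (\<lambda>x. F x \<bullet> G x)"
proof (rule Bochner_Integration.integrable_bound)
  note [measurable] = assms[THEN sqint_measurable]
  show "integrable M (\<lambda>x. (norm (F x))\<^sup>2 + (norm (G x))\<^sup>2)"
    using assms[THEN sqint_integrable] by (rule Bochner_Integration.integrable_add)
  show "(\<lambda>x. F x \<bullet> G x) \<in> borel_measurable M" by measurable
  show "AE x in M. norm (F x \<bullet> G x) \<le> norm ((norm (F x))\<^sup>2 + (norm (G x))\<^sup>2)"
  proof (rule AE_I2)
    fix x
    have "\<bar>F x \<bullet> G x\<bar> \<le> norm (F x) * norm (G x)" by (rule Cauchy_Schwarz_ineq2)
    also have "\<dots> \<le> (norm (F x))\<^sup>2 + (norm (G x))\<^sup>2"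
      using sum_squares_bound[of "norm (F x)" "norm (G x)"]
        mult_nonneg_nonneg[OF norm_ge_zero[of "F x"] norm_ge_zero[of "G x"]]
      unfolding mult.assoc by linarith
    finally show "norm (F x \<bullet> G x) \<le> norm ((norm (F x))\<^sup>2 + (norm (G x))\<^sup>2)" by simp
  qed
qed

lemma integral_norm_lincomb_power2:
  assumes F: "sqint M F" and G: "sqint M G"
  shows "integral\<^sup>L M (\<lambda>x. (norm (s *\<^sub>R F x + t *\<^sub>R G x))\<^sup>2) =
    s\<^sup>2 * (l2n M F)\<^sup>2 + 2 * s * t * integral\<^sup>L M (\<lambda>x. F x \<bullet> G x) + t\<^sup>2 * (l2n M G)\<^sup>2"
proof -
  have "(norm (s *\<^sub>R F x + t *\<^sub>R G x))\<^sup>2 =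
      s\<^sup>2 * (norm (F x))\<^sup>2 + 2 * s * t * (F x \<bullet> G x) + t\<^sup>2 * (norm (G x))\<^sup>2" for x
    unfolding power2_norm_eq_inner
    by (simp add: inner_add_left inner_add_right inner_commute power2_eq_square algebra_simps)
  then show ?thesis
    using F[THEN sqint_integrable] G[THEN sqint_integrable] sqint_inner_integrable[OF F G]
    by (simp add: l2n_power2)
qed

text \<open>The form s^2 A + 2 s t c + t^2 B is the integral of a square, hence nonnegative, and
  this forces c^2 \<le> A B. The case B = 0 is separate because the general argument divides by
  B.\<close>

lemma l2_Cauchy_Schwarz:
  assumes F: "sqint M F" and G: "sqint M G"
  shows "\<bar>integral\<^sup>L M (\<lambda>x. F x \<bullet> G x)\<bar> \<le> l2n M F * l2n M G"
proof -
  define c where "c = integral\<^sup>L M (\<lambda>x. F x \<bullet> G x)"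
  define A where "A = (l2n M F)\<^sup>2"
  define B where "B = (l2n M G)\<^sup>2"
  have *: "0 \<le> s\<^sup>2 * A + 2 * s * t * c + t\<^sup>2 * B" for s t
    using integral_norm_lincomb_power2[OF F G, of s t]
      integral_nonneg_AE[of "\<lambda>x. (norm (s *\<^sub>R F x + t *\<^sub>R G x))\<^sup>2" M]
    by (simp add: A_def B_def c_def)
  have "c\<^sup>2 \<le> A * B"
  proof (cases "B = 0")
    case True
    have "c = 0"
    proof (rule ccontr)
      assume "c \<noteq> 0"
      \<comment> \<open>This t turns the form at s = 1 into A - (A + 1) < 0.\<close>
      then have "2 * 1 * (- (A + 1) / (2 * c)) * c = - (A + 1)" by simp
      then show False using *[of 1 "- (A + 1) / (2 * c)"] True by simp
    qed
    then show ?thesis using True by simp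
  next
    case False
    then have "B > 0" by (simp add: B_def)
    \<comment> \<open>At s = B, t = -c the form is exactly B (A B - c^2).\<close>
    have "0 \<le> B * (A * B - c\<^sup>2)"
      using *[of B "-c"] by (simp add: power2_eq_square algebra_simps)
    then show ?thesis using \<open>B > 0\<close> by (simp add: zero_le_mult_iff)
  qed
  then have "sqrt (c\<^sup>2) \<le> sqrt (A * B)" by (rule real_sqrt_le_mono)
  then show ?thesis by (simp add: c_def A_def B_def real_sqrt_mult)
qed

lemma l2n_lincomb:
  assumes F: "sqint M F" and G: "sqint M G"
  shows "l2n M (\<lambda>x. s *\<^sub>R F x + t *\<^sub>R G x) \<le> \<bar>s\<bar> * l2n M F + \<bar>t\<bar> * l2n M G"
proof (rule power2_le_imp_le)
  have "s * t * integral\<^sup>L M (\<lambda>x. F x \<bullet> G x) \<le> \<bar>s * t * integral\<^sup>L M (\<lambda>x. F x \<bullet> G x)\<bar>" by simp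
  also have "\<dots> \<le> (\<bar>s\<bar> * \<bar>t\<bar>) * (l2n M F * l2n M G)"
    unfolding abs_mult by (intro mult_left_mono l2_Cauchy_Schwarz F G) auto
  finally show "(l2n M (\<lambda>x. s *\<^sub>R F x + t *\<^sub>R G x))\<^sup>2 \<le> (\<bar>s\<bar> * l2n M F + \<bar>t\<bar> * l2n M G)\<^sup>2"
    unfolding l2n_power2[of M "\<lambda>x. s *\<^sub>R F x + t *\<^sub>R G x"] integral_norm_lincomb_power2[OF F G]
    by (simp add: power2_eq_square algebra_simps abs_mult_self_eq)
qed simp

lemma l2n_diff_commute: "l2n M (\<lambda>x. F x - G x) = l2n M (\<lambda>x. G x - F x)"
  by (simp add: l2n_def norm_minus_commute)

lemma l2n_triangle:
  assumes "sqint M F" "sqint M G" "sqint M K"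
  shows "l2n M (\<lambda>x. F x - K x) \<le> l2n M (\<lambda>x. F x - G x) + l2n M (\<lambda>x. G x - K x)"
  using l2n_lincomb[OF sqint_diff[of M F G] sqint_diff[of M G K], of 1 1] assms by simp

lemma l2n_le_add:
  assumes "sqint M F" "sqint M G"
  shows "l2n M F \<le> l2n M G + l2n M (\<lambda>x. F x - G x)"
  using l2n_lincomb[OF assms(2) sqint_diff[OF assms], of 1 1] by simp

lemma l2n_mono:
  assumes "sqint M F" "sqint M G" "\<And>x. x \<in> space M \<Longrightarrow> norm (F x) \<le> c * norm (G x)" "0 \<le> c"
  shows "l2n M F \<le> c * l2n M G"
proof -
  have "integral\<^sup>L M (\<lambda>x. (norm (F x))\<^sup>2) \<le> integral\<^sup>L M (\<lambda>x. c\<^sup>2 * (norm (G x))\<^sup>2)"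
    using assms(3)
    by (intro integral_mono integrable_mult_right sqint_integrable assms)
      (auto simp flip: power_mult_distrib intro!: power_mono)
  then have "(l2n M F)\<^sup>2 \<le> (c * l2n M G)\<^sup>2" by (simp add: l2n_power2 power_mult_distrib)
  then show ?thesis using assms(4) by (auto intro: power2_le_imp_le)
qed

lemma l2n_eq_0_AE: "sqint M F \<Longrightarrow> l2n M F = 0 \<Longrightarrow> AE x in M. F x = 0"
  using integral_nonneg_eq_0_iff_AE[of M "\<lambda>x. (norm (F x))\<^sup>2"]
  by (simp add: l2n_def sqint_def)

lemma l2n_cong_AE:
  assumes "sqint M F" "sqint M G" "AE x in M. F x = G x"
  shows "l2n M F = l2n M G"
proof -
  note [measurable] = assms(1,2)[THEN sqint_measurable]
  have "integral\<^sup>L M (\<lambda>x. (norm (F x))\<^sup>2) = integral\<^sup>L M (\<lambda>x. (norm (G x))\<^sup>2)"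
    by (rule integral_cong_AE) (use assms(3) in auto)
  then show ?thesis by (simp add: l2n_def)
qed

text \<open>The squared distances tend to 0 in L1, so a subsequence of them tends to 0 almost
  everywhere. It feeds Fatou's lemma, which needs pointwise limits.\<close>

lemma l2_AE_subseq:
  assumes F: "\<And>k. sqint M (F k)" and G: "sqint M G" and lim: "(\<lambda>k. l2n M (\<lambda>x. F k x - G x)) \<longlonglongrightarrow> 0"
  obtains r :: "nat \<Rightarrow> nat" where "strict_mono r" "AE x in M. (\<lambda>k. F (r k) x) \<longlonglongrightarrow> G x"
proof -
  have "(\<lambda>k. integral\<^sup>L M (\<lambda>x. norm ((norm (F k x - G x))\<^sup>2))) \<longlonglongrightarrow> 0"
    using tendsto_power[OF lim, of 2] by (simp add: l2n_power2)
  from tendsto_L1_AE_subseq[OF sqint_integrable[OF sqint_diff[OF F G]] this]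
  obtain r where r: "strict_mono r" "AE x in M. (\<lambda>k. (norm (F (r k) x - G x))\<^sup>2) \<longlonglongrightarrow> 0" by blast
  have "AE x in M. (\<lambda>k. F (r k) x) \<longlonglongrightarrow> G x"
    using r(2)
  proof eventually_elim
    case (elim x)
    then have "(\<lambda>k. norm (F (r k) x - G x)) \<longlonglongrightarrow> 0"
      using tendsto_real_sqrt by fastforce
    then show ?case by (rule LIM_zero_cancel[OF tendsto_norm_zero_cancel])
  qed
  with r(1) show thesis by (rule that)
qed

text \<open>Identities for test functions pass to \<open>H10\<close> through this lemma: norm
  convergence of both factors is enough for convergence of the pairing.\<close>

lemma l2_inner_tendsto:
  assumes F: "\<And>k. sqint M (F k)" "sqint M F0" "(\<lambda>k. l2n M (\<lambda>x. F k x - F0 x)) \<longlonglongrightarrow> 0"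
    and G: "\<And>k. sqint M (G k)" "sqint M G0" "(\<lambda>k. l2n M (\<lambda>x. G k x - G0 x)) \<longlonglongrightarrow> 0"
  shows "(\<lambda>k. integral\<^sup>L M (\<lambda>x. F k x \<bullet> G k x)) \<longlonglongrightarrow> integral\<^sup>L M (\<lambda>x. F0 x \<bullet> G0 x)"
proof -
  have eq: "integral\<^sup>L M (\<lambda>x. F k x \<bullet> G k x) - integral\<^sup>L M (\<lambda>x. F0 x \<bullet> G0 x) =
      integral\<^sup>L M (\<lambda>x. (F k x - F0 x) \<bullet> (G k x - G0 x)) +
      integral\<^sup>L M (\<lambda>x. (F k x - F0 x) \<bullet> G0 x) + integral\<^sup>L M (\<lambda>x. F0 x \<bullet> (G k x - G0 x))" for k
    using F G by (simp add: inner_diff_left inner_diff_right sqint_inner_integrable)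
  have "(\<lambda>k. integral\<^sup>L M (\<lambda>x. F k x \<bullet> G k x) - integral\<^sup>L M (\<lambda>x. F0 x \<bullet> G0 x)) \<longlonglongrightarrow> 0"
  proof (rule Lim_null_comparison)
    let ?f = "\<lambda>k. l2n M (\<lambda>x. F k x - F0 x)" and ?g = "\<lambda>k. l2n M (\<lambda>x. G k x - G0 x)"
    have "norm (integral\<^sup>L M (\<lambda>x. F k x \<bullet> G k x) - integral\<^sup>L M (\<lambda>x. F0 x \<bullet> G0 x))
        \<le> ?f k * ?g k + ?f k * l2n M G0 + l2n M F0 * ?g k" for k
      unfolding eq real_norm_def
      using l2_Cauchy_Schwarz[OF sqint_diff[OF F(1)[of k] F(2)] sqint_diff[OF G(1)[of k] G(2)]]
        l2_Cauchy_Schwarz[OF sqint_diff[OF F(1)[of k] F(2)] G(2)]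
        l2_Cauchy_Schwarz[OF F(2) sqint_diff[OF G(1)[of k] G(2)]]
      by (intro abs_triangle_ineq[THEN order_trans] add_mono)
    then show "\<forall>\<^sub>F k in sequentially. norm (integral\<^sup>L M (\<lambda>x. F k x \<bullet> G k x) - integral\<^sup>L M (\<lambda>x. F0 x \<bullet> G0 x))
        \<le> ?f k * ?g k + ?f k * l2n M G0 + l2n M F0 * ?g k" by simp
    have "(\<lambda>k. ?f k * ?g k + ?f k * l2n M G0 + l2n M F0 * ?g k) \<longlonglongrightarrow> 0 * 0 + 0 * l2n M G0 + l2n M F0 * 0"
      by (intro tendsto_intros F G)
    then show "(\<lambda>k. ?f k * ?g k + ?f k * l2n M G0 + l2n M F0 * ?g k) \<longlonglongrightarrow> 0" by simp
  qed
  then show ?thesis by (rule LIM_zero_cancel)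
qed

lemma l2n_tendsto:
  assumes "\<And>k. sqint M (F k)" "sqint M F0" "(\<lambda>k. l2n M (\<lambda>x. F k x - F0 x)) \<longlonglongrightarrow> 0"
  shows "(\<lambda>k. l2n M (F k)) \<longlonglongrightarrow> l2n M F0"
proof (rule LIM_zero_cancel, rule Lim_null_comparison[OF _ assms(3)])
  have "\<bar>l2n M (F k) - l2n M F0\<bar> \<le> l2n M (\<lambda>x. F k x - F0 x)" for k
    using l2n_le_add[OF assms(1)[of k] assms(2)] l2n_le_add[OF assms(2) assms(1)[of k]]
      l2n_diff_commute[of M "F k" F0] by linarith
  then show "\<forall>\<^sub>F k in sequentially. norm (l2n M (F k) - l2n M F0) \<le> l2n M (\<lambda>x. F k x - F0 x)" by simp
qed

text \<open>Riesz-Fischer: a rapidly converging subsequence converges almost everywhere, and Fatou's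
  lemma turns the pointwise limit into the norm limit of the whole sequence.\<close>

lemma l2_complete:
  fixes F :: "nat \<Rightarrow> 'a \<Rightarrow> 'b::euclidean_space"
  assumes F: "\<And>k. sqint M (F k)"
    and cauchy: "\<And>e. e > 0 \<Longrightarrow> \<exists>K. \<forall>j\<ge>K. \<forall>k\<ge>K. l2n M (\<lambda>x. F j x - F k x) < e"
  obtains G where "sqint M G" "(\<lambda>k. l2n M (\<lambda>x. F k x - G x)) \<longlonglongrightarrow> 0"
proof -
  note [measurable] = F[THEN sqint_measurable]
  have "\<exists>K. \<forall>j\<ge>K. \<forall>k\<ge>K. l2n M (\<lambda>x. F j x - F k x) < (1/2) ^ n" for n :: nat
    by (rule cauchy) simp
  then obtain K where K: "\<And>n j k. j \<ge> K n \<Longrightarrow> k \<ge> K n \<Longrightarrow> l2n M (\<lambda>x. F j x - F k x) < (1/2) ^ n"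
    by metis
  \<comment> \<open>A sum dominates each of its terms \<open>K i\<close> with i \<le> k, so
    \<open>r\<close> works without asking that \<open>K\<close> be monotone.\<close>
  define r where "r k = (\<Sum>i\<le>k. K i)" for k :: nat
  have r: "K i \<le> r k" if "i \<le> k" for i k
    unfolding r_def using that by (intro member_le_sum) auto
  define d where "d k x = F (r (Suc k)) x - F (r k) x" for k x
  have d: "sqint M (d k)" for k unfolding d_def by (intro sqint_diff F)
  note [measurable] = d[THEN sqint_measurable]
  have d_le: "integral\<^sup>L M (\<lambda>x. (norm (d k x))\<^sup>2) \<le> (1/4) ^ k" for k
  proof -
    have "l2n M (d k) \<le> (1/2) ^ k"
      unfolding d_def using K[OF r r, of k "Suc k" k] by simp
    then have "(l2n M (d k))\<^sup>2 \<le> ((1/2) ^ k)\<^sup>2" by (intro power_mono) auto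
    also have "((1/2::real) ^ k)\<^sup>2 = (1/4) ^ k"
      by (simp add: power2_eq_square flip: power_mult_distrib)
    finally show ?thesis by (simp add: l2n_power2)
  qed
  \<comment> \<open>The weight 2^k leaves the series summable, as 2^k (1/4)^k = (1/2)^k, and a
    finite weighted sum at x bounds \<open>norm (d k x)\<close> by a geometric sequence of ratio
    sqrt(1/2).\<close>
  have "(\<integral>\<^sup>+x. (\<Sum>k. ennreal (2 ^ k * (norm (d k x))\<^sup>2)) \<partial>M) = (\<Sum>k. \<integral>\<^sup>+x. ennreal (2 ^ k * (norm (d k x))\<^sup>2) \<partial>M)"
    by (intro nn_integral_suminf) measurable
  also have "\<dots> \<le> (\<Sum>k. ennreal ((1/2) ^ k))"
  proof (intro suminf_le summableI)
    fix k
    have "(\<integral>\<^sup>+x. ennreal (2 ^ k * (norm (d k x))\<^sup>2) \<partial>M) = ennreal (2 ^ k * integral\<^sup>L M (\<lambda>x. (norm (d k x))\<^sup>2))"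
      using sqint_integrable[OF d] by (subst nn_integral_eq_integral) auto
    also have "\<dots> \<le> ennreal (2 ^ k * (1/4) ^ k)"
      using d_le by (intro ennreal_leI mult_left_mono) auto
    also have "(2::real) ^ k * (1/4) ^ k = (1/2) ^ k" by (simp flip: power_mult_distrib)
    finally show "(\<integral>\<^sup>+x. ennreal (2 ^ k * (norm (d k x))\<^sup>2) \<partial>M) \<le> ennreal ((1/2) ^ k)" .
  qed
  also have "\<dots> < \<infinity>"
    by (subst suminf_ennreal2) (auto intro!: summable_geometric)
  finally have "AE x in M. (\<Sum>k. ennreal (2 ^ k * (norm (d k x))\<^sup>2)) \<noteq> \<infinity>"
    by (intro nn_integral_PInf_AE) auto
  then have conv: "AE x in M. (\<lambda>k. F (r k) x) \<longlonglongrightarrow> lim (\<lambda>k. F (r k) x)"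
  proof eventually_elim
    case (elim x)
    define C where "C = enn2real (\<Sum>k. ennreal (2 ^ k * (norm (d k x))\<^sup>2))"
    have C: "(\<Sum>k. ennreal (2 ^ k * (norm (d k x))\<^sup>2)) = ennreal C"
      using elim unfolding C_def infinity_ennreal_def by (rule ennreal_enn2real_if[THEN trans, symmetric, OF if_not_P])
    have C0: "0 \<le> C" unfolding C_def by simp
    have "norm (d k x) \<le> sqrt C * (sqrt (1/2)) ^ k" for k
    proof -
      have "(\<Sum>k\<in>{k}. ennreal (2 ^ k * (norm (d k x))\<^sup>2)) \<le> (\<Sum>k. ennreal (2 ^ k * (norm (d k x))\<^sup>2))"
        by (rule sum_le_suminf) (rule summableI, simp_all)
      then have "ennreal (2 ^ k * (norm (d k x))\<^sup>2) \<le> ennreal C"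
        unfolding C by simp
      then have "2 ^ k * (norm (d k x))\<^sup>2 \<le> C" using C0 by simp
      then have "(norm (d k x))\<^sup>2 \<le> C * (1/2) ^ k"
        by (simp add: power_one_over pos_le_divide_eq mult.commute)
      then have "sqrt ((norm (d k x))\<^sup>2) \<le> sqrt (C * (1/2) ^ k)" by (rule real_sqrt_le_mono)
      then show ?thesis by (simp add: real_sqrt_mult real_sqrt_power)
    qed
    moreover have "summable (\<lambda>k. sqrt C * (sqrt (1/2)) ^ k)"
      by (intro summable_mult summable_geometric) (simp add: real_sqrt_divide)
    ultimately have "summable (\<lambda>k. d k x)" by (intro summable_comparison_test'[where N = 0 and f = "\<lambda>k. d k x"])
    then have "(\<lambda>n. \<Sum>k<n. d k x) \<longlonglongrightarrow> suminf (\<lambda>k. d k x)" by (rule summable_LIMSEQ)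
    moreover have "(\<Sum>k<n. d k x) = F (r n) x - F (r 0) x" for n
      unfolding d_def by (rule sum_lessThan_telescope)
    ultimately have "(\<lambda>n. (F (r n) x - F (r 0) x) + F (r 0) x) \<longlonglongrightarrow> suminf (\<lambda>k. d k x) + F (r 0) x"
      by (intro tendsto_add) auto
    then have "convergent (\<lambda>n. F (r n) x)" unfolding convergent_def by auto
    then show ?case by (simp add: convergent_LIMSEQ_iff)
  qed
  define G where "G x = lim (\<lambda>k. F (r k) x)" for x
  have [measurable]: "G \<in> borel_measurable M" unfolding G_def by measurable
  \<comment> \<open>Only the second index runs to infinity along \<open>r\<close>; the first is an
    arbitrary j \<ge> \<open>K n\<close>, so the estimate covers the full sequence.\<close>
  have fatou: "integrable M (\<lambda>x. (norm (F j x - G x))\<^sup>2)" "integral\<^sup>L M (\<lambda>x. (norm (F j x - G x))\<^sup>2) \<le> ((1/2) ^ n)\<^sup>2"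
    if "j \<ge> K n" for n j
  proof -
    have lim: "AE x in M. (\<lambda>k. (norm (F j x - F (r k) x))\<^sup>2) \<longlonglongrightarrow> (norm (F j x - G x))\<^sup>2"
      using conv by eventually_elim (auto simp: G_def intro!: tendsto_intros)
    have bd: "\<forall>\<^sub>F k in sequentially. integral\<^sup>L M (\<lambda>x. (norm (F j x - F (r k) x))\<^sup>2) \<le> ((1/2) ^ n)\<^sup>2"
      using eventually_ge_at_top[of n]
    proof eventually_elim
      case (elim k)
      have "(l2n M (\<lambda>x. F j x - F (r k) x))\<^sup>2 \<le> ((1/2) ^ n)\<^sup>2"
        using K[OF that r[OF elim]] by (intro power_mono) auto
      then show ?case by (simp add: l2n_power2)
    qed
    show "integrable M (\<lambda>x. (norm (F j x - G x))\<^sup>2)" "integral\<^sup>L M (\<lambda>x. (norm (F j x - G x))\<^sup>2) \<le> ((1/2) ^ n)\<^sup>2"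
      using fatou_real[OF sqint_integrable[OF sqint_diff[OF F F]] _ _ lim bd] by auto
  qed
  \<comment> \<open>\<open>G\<close> is \<open>F (K 0)\<close> minus a square-integrable difference,
    hence square-integrable itself.\<close>
  have "sqint M (\<lambda>x. F (K 0) x - G x)" using fatou(1)[of 0] by (simp add: sqint_def)
  from sqint_diff[OF F this, of "K 0"] have G: "sqint M G" by simp
  have "(\<lambda>k. l2n M (\<lambda>x. F k x - G x)) \<longlonglongrightarrow> 0"
  proof (rule LIMSEQ_I)
    fix e :: real assume "e > 0"
    then obtain n where n: "(1/2) ^ n < e" using real_arch_pow_inv[of e "1/2"] by auto
    have "l2n M (\<lambda>x. F j x - G x) \<le> (1/2) ^ n" if "j \<ge> K n" for j
      using fatou(2)[OF that] by (simp add: l2n_def real_le_lsqrt)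
    then show "\<exists>no. \<forall>k\<ge>no. norm (l2n M (\<lambda>x. F k x - G x) - 0) < e" using n by fastforce
  qed
  with G show thesis by (rule that)
qed

section \<open>Test functions and integration by parts\<close>

lemma integrable_continuous_compact_support:
  fixes f :: "'a::euclidean_space \<Rightarrow> real"
  assumes "continuous_on UNIV f" "compact K" "\<And>x. x \<notin> K \<Longrightarrow> f x = 0"
  shows "integrable lborel f"
proof -
  have "integrable lborel (\<lambda>x. indicator K x *\<^sub>R f x)"
    by (rule borel_integrable_compact[OF assms(2) continuous_on_subset[OF assms(1)]]) simp
  moreover have "(\<lambda>x. indicator K x *\<^sub>R f x) = f"
    using assms(3) by (auto simp: indicator_def fun_eq_iff)
  ultimately show ?thesis by simp
qed

text \<open>Translation invariance replaces Fubini and the fundamental theorem of calculus: each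
  difference quotient of \<open>h\<close> in direction \<open>v\<close> integrates to 0, and the
  quotients converge to \<open>h'\<close> under a majorant that is constant on a large ball.\<close>

lemma integral_directional_derivative_lborel:
  fixes h h' :: "'a::euclidean_space \<Rightarrow> real"
  assumes cont: "continuous_on UNIV h" "continuous_on UNIV h'"
    and der: "\<And>x. ((\<lambda>t. h (x + t *\<^sub>R v)) has_real_derivative h' x) (at 0)"
    and K: "compact K" and supp: "\<And>x. x \<notin> K \<Longrightarrow> h x = 0"
  shows "integral\<^sup>L lborel h' = 0"
proof -
  have [measurable]: "h \<in> borel_measurable borel" "h' \<in> borel_measurable borel"
    using cont by (auto intro: borel_measurable_continuous_onI)
  have bigDER: "((\<lambda>t. h (x + t *\<^sub>R v)) has_real_derivative h' (x + s *\<^sub>R v)) (at s)" for x s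
  proof -
    have "(\<lambda>t. h ((x + s *\<^sub>R v) + t *\<^sub>R v)) = (\<lambda>t. h (x + (t + s) *\<^sub>R v))"
      by (simp add: algebra_simps)
    then have "((\<lambda>t. h (x + (t + s) *\<^sub>R v)) has_real_derivative h' (x + s *\<^sub>R v)) (at 0)"
      using der[of "x + s *\<^sub>R v"] by simp
    then show ?thesis
      using DERIV_shift[of "\<lambda>t. h (x + t *\<^sub>R v)" "h' (x + s *\<^sub>R v)" 0 s] by simp
  qed
  \<comment> \<open>The complement of \<open>K\<close> is open, so \<open>h\<close> vanishes near
    such x and not just at x. With compactness of \<open>K\<close> this bounds \<open>h'\<close>
    everywhere.\<close>
  have h'0: "h' x = 0" if "x \<notin> K" for x
  proof -
    have "((\<lambda>t. x + t *\<^sub>R v) \<longlongrightarrow> x + 0 *\<^sub>R v) (nhds (0::real))"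
      by (intro tendsto_intros filterlim_ident)
    then have "\<forall>\<^sub>F t in nhds (0::real). x + t *\<^sub>R v \<in> - K"
      using that compact_imp_closed[OF K] by (intro topological_tendstoD) (auto simp: open_Compl)
    then have ev: "\<forall>\<^sub>F t in nhds (0::real). h (x + t *\<^sub>R v) = 0"
      by eventually_elim (simp add: supp)
    have "((\<lambda>t. h (x + t *\<^sub>R v)) has_real_derivative 0) (at 0)"
      using DERIV_cong_ev[OF refl ev refl] by simp
    then show ?thesis using der DERIV_unique by blast
  qed
  obtain C where C: "\<And>x. x \<in> K \<Longrightarrow> norm (h' x) \<le> C"
    using compact_imp_bounded[OF compact_continuous_image[OF continuous_on_subset[OF cont(2)] K]]
    by (auto simp: bounded_iff)
  define C' where "C' = max C 0"
  have C': "norm (h' x) \<le> C'" for x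
    using C[of x] h'0[of x] by (cases "x \<in> K") (auto simp: C'_def)
  obtain R where R: "\<And>x. x \<in> K \<Longrightarrow> norm x \<le> R" using compact_imp_bounded[OF K] by (auto simp: bounded_iff)
  \<comment> \<open>Shifts of length at most \<open>norm v\<close> can carry points outside
    \<open>K\<close> into it, so the majorant lives on a ball enlarged by that length.\<close>
  define B where "B = cball (0::'a) (R + norm v)"
  have B: "x \<in> B" if "x \<in> K" for x using R[OF that] by (simp add: B_def norm_ge_zero add_increasing2)
  have lip: "\<bar>h (x + s *\<^sub>R v) - h x\<bar> \<le> C' * s" if "0 \<le> s" for x s
  proof (cases "s = 0")
    case False
    with that have "0 < s" by simp
    then obtain z where "h (x + s *\<^sub>R v) - h (x + 0 *\<^sub>R v) = (s - 0) * h' (x + z *\<^sub>R v)"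
      using MVT2[of 0 s "\<lambda>t. h (x + t *\<^sub>R v)" "\<lambda>t. h' (x + t *\<^sub>R v)"] bigDER by auto
    then have "\<bar>h (x + s *\<^sub>R v) - h x\<bar> = \<bar>h' (x + z *\<^sub>R v)\<bar> * s"
      using that by (simp add: abs_mult)
    also have "\<dots> \<le> C' * s" using C'[of "x + z *\<^sub>R v"] that by (intro mult_right_mono) auto
    finally show ?thesis .
  qed simp
  define q where "q k x = real (Suc k) * (h (x + (1 / real (Suc k)) *\<^sub>R v) - h x)" for k x
  have [measurable]: "q k \<in> borel_measurable borel" for k unfolding q_def by measurable
  have q_lim: "(\<lambda>k. q k x) \<longlonglongrightarrow> h' x" for x
  proof -
    have "((\<lambda>t. (h (x + t *\<^sub>R v) - h x) / t) \<longlongrightarrow> h' x) (at 0)"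
      using der[of x] by (simp add: DERIV_def)
    moreover have "filterlim (\<lambda>k. 1 / real (Suc k)) (at 0) sequentially"
      using LIMSEQ_inverse_real_of_nat by (auto simp: filterlim_at inverse_eq_divide)
    ultimately have "(\<lambda>k. (h (x + (1 / real (Suc k)) *\<^sub>R v) - h x) / (1 / real (Suc k))) \<longlonglongrightarrow> h' x"
      by (rule filterlim_compose)
    then show ?thesis by (simp add: q_def mult.commute)
  qed
  have q_bound: "norm (q k x) \<le> C' * indicator B x" for k x
  proof (cases "x \<in> B")
    case True
    have "\<bar>q k x\<bar> = real (Suc k) * \<bar>h (x + (1 / real (Suc k)) *\<^sub>R v) - h x\<bar>"
      by (simp add: q_def abs_mult)
    also have "\<dots> \<le> real (Suc k) * (C' * (1 / real (Suc k)))"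
      by (intro mult_left_mono lip) auto
    finally show ?thesis using True by simp
  next
    case False
    have "x + (1 / real (Suc k)) *\<^sub>R v \<notin> K"
    proof
      assume "x + (1 / real (Suc k)) *\<^sub>R v \<in> K"
      then have "norm (x + (1 / real (Suc k)) *\<^sub>R v) \<le> R" by (rule R)
      moreover have "norm ((1 / real (Suc k)) *\<^sub>R v) \<le> norm v"
        by (simp add: divide_le_eq mult_left_mono algebra_simps)
      ultimately have "norm x \<le> R + norm v"
        using norm_triangle_ineq4[of "x + (1 / real (Suc k)) *\<^sub>R v" "(1 / real (Suc k)) *\<^sub>R v"] by simp
      then show False using False by (simp add: B_def)
    qed
    then show ?thesis using False B[of x] supp by (auto simp: q_def C'_def)
  qed
  have hint: "integrable lborel h"
    by (rule integrable_continuous_compact_support[OF cont(1) K supp])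
  have shift: "integrable lborel (\<lambda>x. h (x + c))" "(\<integral>x. h (x + c) \<partial>lborel) = integral\<^sup>L lborel h" for c
  proof -
    have d: "distr lborel borel (\<lambda>x. x + c) = (lborel :: 'a measure)"
    proof -
      have "(\<lambda>x. x + c) = (+) c" by (auto simp: add.commute)
      then show ?thesis by (simp only: lborel_distr_plus)
    qed
    show "integrable lborel (\<lambda>x. h (x + c))"
      using hint integrable_distr_eq[of "\<lambda>x. x + c" lborel borel h] by (simp add: d)
    show "(\<integral>x. h (x + c) \<partial>lborel) = integral\<^sup>L lborel h"
      using integral_distr[of "\<lambda>x. x + c" lborel borel h] by (simp add: d)
  qed
  have qint: "integral\<^sup>L lborel (q k) = 0" for k
    unfolding q_def using shift hint by simp
  have bint: "integrable lborel (\<lambda>x. C' * indicator B x)"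
    unfolding B_def using emeasure_bounded_finite[OF bounded_cball]
    by (intro integrable_mult_right integrable_real_indicator) auto
  have "(\<lambda>k. integral\<^sup>L lborel (q k)) \<longlonglongrightarrow> integral\<^sup>L lborel h'"
    by (rule integral_dominated_convergence[where w = "\<lambda>x. C' * indicator B x"])
      (use q_lim q_bound bint in auto)
  then show "integral\<^sup>L lborel h' = 0" by (simp add: qint LIMSEQ_const_iff)
qed

lemma integral_lebesgue_on_eq_lborel:
  fixes h :: "'a::euclidean_space \<Rightarrow> real"
  assumes "open \<Omega>" and [measurable]: "h \<in> borel_measurable borel" and h0: "\<And>x. x \<notin> \<Omega> \<Longrightarrow> h x = 0"
  shows "integrable (lebesgue_on \<Omega>) h \<longleftrightarrow> integrable lborel h"
    "integral\<^sup>L (lebesgue_on \<Omega>) h = integral\<^sup>L lborel h"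
proof -
  have \<Omega>: "\<Omega> \<inter> space lebesgue \<in> sets lebesgue" using \<open>open \<Omega>\<close> by auto
  have eq: "(\<lambda>x. indicator \<Omega> x *\<^sub>R h x) = h" using h0 by (auto simp: indicator_def fun_eq_iff)
  show "integrable (lebesgue_on \<Omega>) h \<longleftrightarrow> integrable lborel h"
    unfolding integrable_restrict_space[OF \<Omega>] eq by (simp add: integrable_completion)
  show "integral\<^sup>L (lebesgue_on \<Omega>) h = integral\<^sup>L lborel h"
    unfolding integral_restrict_space[OF \<Omega>] eq by (simp add: integral_completion)
qed

text \<open>The version for data controlled on \<open>\<Omega>\<close> only, such as products with
  the coefficients a_i. Extension by 0 keeps both functions continuous because
  \<open>\<Omega>\<close> and the complement of \<open>K\<close> are open and cover the
  space.\<close>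

lemma integral_directional_derivative:
  fixes h h' :: "'a::euclidean_space \<Rightarrow> real"
  assumes \<Omega>: "open \<Omega>" and K: "compact K" "K \<subseteq> \<Omega>"
    and cont: "continuous_on \<Omega> h" "continuous_on \<Omega> h'"
    and der: "\<And>x. x \<in> \<Omega> \<Longrightarrow> ((\<lambda>t. h (x + t *\<^sub>R v)) has_real_derivative h' x) (at 0)"
    and supp: "\<And>x. x \<in> \<Omega> \<Longrightarrow> x \<notin> K \<Longrightarrow> h x = 0 \<and> h' x = 0"
  shows "integral\<^sup>L (lebesgue_on \<Omega>) h' = 0"
proof -
  define H where "H x = (if x \<in> \<Omega> then h x else 0)" for x
  define H' where "H' x = (if x \<in> \<Omega> then h' x else 0)" for x
  have oK: "open (- K)" using compact_imp_closed[OF K(1)] by auto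
  have U: "\<Omega> \<union> - K = UNIV" using K by auto
  have zero: "H x = 0 \<and> H' x = 0" if "x \<notin> K" for x using supp that by (auto simp: H_def H'_def)
  have "continuous_on \<Omega> H" "continuous_on \<Omega> H'"
    using cont by (auto simp: H_def H'_def cong: continuous_on_cong_simp)
  moreover have "continuous_on (- K) H" "continuous_on (- K) H'"
    using zero by (auto intro: continuous_on_eq[OF continuous_on_const[of _ 0]])
  ultimately have contH: "continuous_on UNIV H" "continuous_on UNIV H'"
    using continuous_on_open_Un[OF \<Omega> oK] U by metis+
  have derH: "((\<lambda>t. H (x + t *\<^sub>R v)) has_real_derivative H' x) (at 0)" for x
  proof (cases "x \<in> \<Omega>")
    case True
    have "((\<lambda>t. x + t *\<^sub>R v) \<longlongrightarrow> x + 0 *\<^sub>R v) (nhds (0::real))"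
      by (intro tendsto_intros filterlim_ident)
    then have "\<forall>\<^sub>F t in nhds (0::real). x + t *\<^sub>R v \<in> \<Omega>"
      using True \<Omega> by (intro topological_tendstoD) auto
    then have "\<forall>\<^sub>F t in nhds (0::real). H (x + t *\<^sub>R v) = h (x + t *\<^sub>R v)"
      by eventually_elim (simp add: H_def)
    from DERIV_cong_ev[OF refl this refl] der[OF True] show ?thesis using True by (simp add: H'_def)
  next
    case False
    then have "x \<notin> K" using K by auto
    have "((\<lambda>t. x + t *\<^sub>R v) \<longlongrightarrow> x + 0 *\<^sub>R v) (nhds (0::real))"
      by (intro tendsto_intros filterlim_ident)
    then have "\<forall>\<^sub>F t in nhds (0::real). x + t *\<^sub>R v \<in> - K"
      using \<open>x \<notin> K\<close> oK by (intro topological_tendstoD) auto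
    then have "\<forall>\<^sub>F t in nhds (0::real). H (x + t *\<^sub>R v) = 0"
      by eventually_elim (simp add: zero)
    from DERIV_cong_ev[OF refl this refl] False show ?thesis by (simp add: H'_def)
  qed
  have "integral\<^sup>L (lebesgue_on \<Omega>) h' = integral\<^sup>L (lebesgue_on \<Omega>) H'"
    by (intro Bochner_Integration.integral_cong) (auto simp: H'_def)
  also have "\<dots> = integral\<^sup>L lborel H'"
    using contH by (intro integral_lebesgue_on_eq_lborel \<Omega> borel_measurable_continuous_onI) (auto simp: H'_def)
  also have "\<dots> = 0"
    using zero by (intro integral_directional_derivative_lborel[OF contH derH K(1)]) auto
  finally show ?thesis .
qed

section \<open>Smooth functions and test functions\<close>

lemma smooth_on_continuous: "smooth_on S f \<Longrightarrow> continuous_on S f"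
  unfolding smooth_on_def by (metis Ck_on.simps(1))

lemma smooth_on_partial:
  assumes "smooth_on S f" shows "smooth_on S (partial i f)"
  unfolding smooth_on_def
proof
  fix k
  have "Ck_on (Suc k) S f" using assms by (simp add: smooth_on_def)
  then show "Ck_on k S (partial i f)" by simp
qed

lemma smooth_on_has_derivative:
  assumes "smooth_on S f" "x \<in> S"
  shows "((\<lambda>t. f (x + t *\<^sub>R axis i 1)) has_real_derivative partial i f x) (at 0)"
proof -
  have "Ck_on (Suc 0) S f" using assms by (simp add: smooth_on_def)
  then show ?thesis using assms(2) unfolding partial_def
    by (auto simp: DERIV_deriv_iff_field_differentiable)
qed

text \<open>\<open>Ck_on\<close> recurses through partial derivatives, so the induction on k runs
  over all pairs of functions, and the formula for \<open>partial\<close> has to be available for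
  every pair beforehand.\<close>

lemma smooth_on_UNIV_lincomb:
  assumes "smooth_on UNIV f" "smooth_on UNIV g"
  shows "smooth_on UNIV (\<lambda>x. s * f x + t * g x)"
    "partial i (\<lambda>x. s * f x + t * g x) = (\<lambda>x. s * partial i f x + t * partial i g x)"
proof -
  have der: "((\<lambda>r. s * f (x + r *\<^sub>R axis i 1) + t * g (x + r *\<^sub>R axis i 1)) has_real_derivative
      s * partial i f x + t * partial i g x) (at 0)"
    if "smooth_on UNIV f" "smooth_on UNIV g" for f g x i
    by (intro DERIV_add DERIV_cmult smooth_on_has_derivative[where S = UNIV] that) auto
  have part: "partial i (\<lambda>x. s * f x + t * g x) = (\<lambda>x. s * partial i f x + t * partial i g x)"
    if "smooth_on UNIV f" "smooth_on UNIV g" for f g i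
    unfolding partial_def[of i "\<lambda>x. s * f x + t * g x"] using der[OF that, THEN DERIV_imp_deriv] by (rule ext)
  show "partial i (\<lambda>x. s * f x + t * g x) = (\<lambda>x. s * partial i f x + t * partial i g x)"
    by (rule part[OF assms])
  have "Ck_on k UNIV (\<lambda>x. s * f x + t * g x)" for k
    using assms
  proof (induction k arbitrary: f g)
    case 0
    then show ?case unfolding Ck_on.simps by (intro continuous_intros smooth_on_continuous)
  next
    case (Suc k)
    have "(\<lambda>r. s * f (x + r *\<^sub>R axis i 1) + t * g (x + r *\<^sub>R axis i 1)) field_differentiable at 0" for x i
      using der[OF Suc.prems] unfolding field_differentiable_def by blast
    moreover have "Ck_on k UNIV (partial i (\<lambda>x. s * f x + t * g x))" for i
      unfolding part[OF Suc.prems] by (intro Suc.IH smooth_on_partial Suc.prems)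
    moreover have "continuous_on UNIV (\<lambda>x. s * f x + t * g x)"
      using Suc.prems by (intro continuous_intros smooth_on_continuous)
    ultimately show ?case by simp
  qed
  then show "smooth_on UNIV (\<lambda>x. s * f x + t * g x)" by (simp add: smooth_on_def)
qed

lemma grad_nth [simp]: "grad f x $ i = partial i f x"
  by (simp add: grad_def)

lemma test_fun_smooth: "test_fun \<Omega> \<phi> \<Longrightarrow> smooth_on UNIV \<phi>"
  by (simp add: test_fun_def)

lemma test_fun_continuous: "test_fun \<Omega> \<phi> \<Longrightarrow> continuous_on S \<phi>"
  using smooth_on_continuous[OF test_fun_smooth] continuous_on_subset by blast

lemma partial_eq_0_outside:
  fixes \<phi> :: "real^'n::finite \<Rightarrow> real"
  assumes "x \<notin> closure {x. \<phi> x \<noteq> 0}"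
  shows "partial i \<phi> x = 0"
proof -
  have "((\<lambda>t. x + t *\<^sub>R axis i 1) \<longlongrightarrow> x + 0 *\<^sub>R axis i 1) (nhds (0::real))"
    by (intro tendsto_intros filterlim_ident)
  then have "\<forall>\<^sub>F t in nhds (0::real). x + t *\<^sub>R axis i 1 \<in> - closure {x. \<phi> x \<noteq> 0}"
    using assms by (intro topological_tendstoD) auto
  then have "\<forall>\<^sub>F t in nhds (0::real). \<phi> (x + t *\<^sub>R axis i 1) = 0"
    by eventually_elim (use closure_subset[of "{x. \<phi> x \<noteq> 0}"] in auto)
  from DERIV_cong_ev[OF refl this refl] have "((\<lambda>t. \<phi> (x + t *\<^sub>R axis i 1)) has_real_derivative 0) (at 0)"
    by simp
  then show ?thesis unfolding partial_def by (rule DERIV_imp_deriv)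
qed

text \<open>Makes second derivatives of test functions available, on which uniqueness of the weak
  gradient relies.\<close>

lemma test_fun_partial:
  assumes "test_fun \<Omega> \<phi>" shows "test_fun \<Omega> (partial i \<phi>)"
proof -
  have sub: "closure {x. partial i \<phi> x \<noteq> 0} \<subseteq> closure {x. \<phi> x \<noteq> 0}"
    by (rule closure_minimal) (use partial_eq_0_outside in auto)
  moreover have "compact (closure {x. partial i \<phi> x \<noteq> 0})"
    using assms sub unfolding test_fun_def
    by (meson bounded_subset closed_closure compact_eq_bounded_closed)
  ultimately show ?thesis using assms smooth_on_partial unfolding test_fun_def by blast
qed

lemma test_fun_support_add:
  assumes "test_fun \<Omega> \<phi>" "test_fun \<Omega> \<psi>" and z: "\<And>x. \<phi> x = 0 \<Longrightarrow> \<psi> x = 0 \<Longrightarrow> \<zeta> x = 0"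
  shows "compact (closure {x. \<zeta> x \<noteq> 0})" "closure {x. \<zeta> x \<noteq> 0} \<subseteq> \<Omega>"
proof -
  let ?K = "closure {x. \<phi> x \<noteq> 0} \<union> closure {x. \<psi> x \<noteq> 0}"
  have K: "compact ?K" "?K \<subseteq> \<Omega>" using assms by (auto simp: test_fun_def)
  have sub: "closure {x. \<zeta> x \<noteq> 0} \<subseteq> ?K"
  proof (rule closure_minimal)
    show "{x. \<zeta> x \<noteq> 0} \<subseteq> ?K"
      using z closure_subset[of "{x. \<phi> x \<noteq> 0}"] closure_subset[of "{x. \<psi> x \<noteq> 0}"] by auto
  qed auto
  show "compact (closure {x. \<zeta> x \<noteq> 0})"
    using K(1) sub by (meson bounded_subset closed_closure compact_eq_bounded_closed)
  show "closure {x. \<zeta> x \<noteq> 0} \<subseteq> \<Omega>" using sub K(2) by blast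
qed

lemma test_fun_lincomb:
  assumes "test_fun \<Omega> \<phi>" "test_fun \<Omega> \<psi>"
  shows "test_fun \<Omega> (\<lambda>x. s * \<phi> x + t * \<psi> x)"
    "grad (\<lambda>x. s * \<phi> x + t * \<psi> x) x = s *\<^sub>R grad \<phi> x + t *\<^sub>R grad \<psi> x"
  using smooth_on_UNIV_lincomb[OF assms[THEN test_fun_smooth]]
    test_fun_support_add[OF assms, of "\<lambda>x. s * \<phi> x + t * \<psi> x"]
  by (auto simp: test_fun_def vec_eq_iff)

lemma test_fun_bounded:
  assumes "test_fun \<Omega> \<phi>"
  obtains C where "0 \<le> C" "\<And>x. \<bar>\<phi> x\<bar> \<le> C"
proof -
  let ?K = "closure {x. \<phi> x \<noteq> 0}"
  have "compact ?K" using assms by (simp add: test_fun_def)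
  then have "bounded (\<phi> ` ?K)"
    by (intro compact_imp_bounded compact_continuous_image test_fun_continuous[OF assms])
  then obtain C where C: "\<And>x. x \<in> ?K \<Longrightarrow> \<bar>\<phi> x\<bar> \<le> C" by (auto simp: bounded_iff)
  have "\<bar>\<phi> x\<bar> \<le> max C 0" for x
    using C[of x] closure_subset[of "{x. \<phi> x \<noteq> 0}"] by (cases "\<phi> x = 0") force+
  then show thesis by (intro that[of "max C 0"]) auto
qed

lemma test_fun_borel: "test_fun \<Omega> \<phi> \<Longrightarrow> \<phi> \<in> borel_measurable borel"
  by (intro borel_measurable_continuous_onI test_fun_continuous)

lemma borel_measurable_lebesgue_on:
  "f \<in> borel_measurable borel \<Longrightarrow> f \<in> borel_measurable (lebesgue_on \<Omega>)"
  by (intro measurable_restrict_space1 measurable_completion) simp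

lemma test_fun_measurable: "test_fun \<Omega> \<phi> \<Longrightarrow> \<phi> \<in> borel_measurable (lebesgue_on S)"
  by (intro borel_measurable_lebesgue_on test_fun_borel)

lemma grad_test_fun_measurable:
  assumes "test_fun \<Omega> (\<phi> :: real^'n::finite \<Rightarrow> real)"
  shows "grad \<phi> \<in> borel_measurable borel"
proof (rule borel_measurable_continuous_onI)
  show "continuous_on UNIV (grad \<phi>)"
    unfolding grad_def[abs_def]
    by (intro continuous_on_vec_lambda test_fun_continuous[OF test_fun_partial[OF assms]])
qed

lemma sqint_test_fun:
  assumes "bounded \<Omega>" "open \<Omega>" "test_fun \<Omega> (\<phi> :: real^'n::finite \<Rightarrow> real)"
  shows "sqint (lebesgue_on \<Omega>) \<phi>"
proof -
  note [measurable] = test_fun_measurable[OF assms(3), of \<Omega>]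
  obtain C where C: "0 \<le> C" "\<And>x. \<bar>\<phi> x\<bar> \<le> C" using test_fun_bounded[OF assms(3)] by blast
  have fin: "finite_measure (lebesgue_on \<Omega>)"
    using assms by (intro finite_measure_lebesgue_on) (auto intro: bounded_set_imp_lmeasurable)
  have "integrable (lebesgue_on \<Omega>) (\<lambda>x. (norm (\<phi> x))\<^sup>2)"
  proof (rule finite_measure.integrable_const_bound[OF fin])
    show "AE x in lebesgue_on \<Omega>. norm ((norm (\<phi> x))\<^sup>2) \<le> C\<^sup>2"
    proof (rule AE_I2)
      fix x
      have "\<bar>\<phi> x\<bar>\<^sup>2 \<le> C\<^sup>2" using C by (intro power_mono) auto
      then show "norm ((norm (\<phi> x))\<^sup>2) \<le> C\<^sup>2" by simp
    qed
  qed measurable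
  then show ?thesis by (simp add: sqint_def)
qed

lemma sqint_vec:
  fixes F :: "'a \<Rightarrow> real^'n::finite"
  assumes [measurable]: "F \<in> borel_measurable M" and F: "\<And>i. sqint M (\<lambda>x. F x $ i)"
  shows "sqint M F"
proof -
  have "(\<lambda>x. (norm (F x))\<^sup>2) = (\<lambda>x. \<Sum>i\<in>UNIV. (norm (F x $ i))\<^sup>2)"
    by (simp add: norm_vec_def L2_set_def sum_nonneg fun_eq_iff)
  then show ?thesis using sqint_integrable[OF F] by (simp add: sqint_def)
qed

lemma sqint_grad_test_fun:
  assumes "bounded \<Omega>" "open \<Omega>" "test_fun \<Omega> (\<phi> :: real^'n::finite \<Rightarrow> real)"
  shows "sqint (lebesgue_on \<Omega>) (grad \<phi>)"
  by (rule sqint_vec[OF borel_measurable_lebesgue_on[OF grad_test_fun_measurable[OF assms(3)]]])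
    (simp add: sqint_test_fun assms test_fun_partial)

lemma test_fun_by_parts:
  assumes \<Omega>: "bounded \<Omega>" "open \<Omega>" and \<phi>: "test_fun \<Omega> \<phi>" and \<psi>: "test_fun \<Omega> \<psi>"
  shows "integral\<^sup>L (lebesgue_on \<Omega>) (\<lambda>x. partial i \<phi> x * \<psi> x) =
    - integral\<^sup>L (lebesgue_on \<Omega>) (\<lambda>x. \<phi> x * partial i \<psi> x)"
proof -
  have "integral\<^sup>L (lebesgue_on \<Omega>) (\<lambda>x. partial i \<phi> x * \<psi> x + partial i \<psi> x * \<phi> x) = 0"
  proof (rule integral_directional_derivative[where h = "\<lambda>x. \<phi> x * \<psi> x" and v = "axis i 1"])
    show "compact (closure {x. \<phi> x \<noteq> 0})" "closure {x. \<phi> x \<noteq> 0} \<subseteq> \<Omega>"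
      using \<phi> by (auto simp: test_fun_def)
    show "((\<lambda>t. \<phi> (x + t *\<^sub>R axis i 1) * \<psi> (x + t *\<^sub>R axis i 1)) has_real_derivative
        partial i \<phi> x * \<psi> x + partial i \<psi> x * \<phi> x) (at 0)" for x
      using DERIV_mult[OF smooth_on_has_derivative[OF test_fun_smooth[OF \<phi>]] smooth_on_has_derivative[OF test_fun_smooth[OF \<psi>]], of x x i i]
      by simp
    show "\<phi> x * \<psi> x = 0 \<and> partial i \<phi> x * \<psi> x + partial i \<psi> x * \<phi> x = 0"
      if "x \<notin> closure {x. \<phi> x \<noteq> 0}" for x
      using partial_eq_0_outside[OF that] that closure_subset[of "{x. \<phi> x \<noteq> 0}"] by auto
  qed (intro \<Omega> continuous_intros test_fun_continuous[OF \<phi>] test_fun_continuous[OF \<psi>]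
      test_fun_continuous[OF test_fun_partial[OF \<phi>]] test_fun_continuous[OF test_fun_partial[OF \<psi>]])+
  moreover have "integrable (lebesgue_on \<Omega>) (\<lambda>x. partial i \<phi> x * \<psi> x)"
    "integrable (lebesgue_on \<Omega>) (\<lambda>x. \<phi> x * partial i \<psi> x)"
    using sqint_inner_integrable[OF sqint_test_fun[OF \<Omega> test_fun_partial[OF \<phi>]] sqint_test_fun[OF \<Omega> \<psi>]]
      sqint_inner_integrable[OF sqint_test_fun[OF \<Omega> \<phi>] sqint_test_fun[OF \<Omega> test_fun_partial[OF \<psi>]]] by auto
  ultimately show ?thesis by (simp add: mult.commute)
qed

text \<open>One coordinate is enough: integrating the i-th derivative of x_i \<phi>^2 shows that the
  squared norm of \<phi> is -2 times the integral of \<phi> x_i (partial i \<phi>), and |x_i| \<le>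
  R on the domain. Cauchy-Schwarz then gives the constant 2R.\<close>

lemma test_fun_Poincare:
  fixes \<phi> :: "real^'n::finite \<Rightarrow> real"
  assumes \<Omega>: "bounded \<Omega>" "open \<Omega>" and R: "\<And>x. x \<in> \<Omega> \<Longrightarrow> norm x \<le> R" and R0: "0 \<le> R"
    and \<phi>: "test_fun \<Omega> \<phi>"
  shows "l2n (lebesgue_on \<Omega>) \<phi> \<le> 2 * R * l2n (lebesgue_on \<Omega>) (grad \<phi>)"
proof -
  let ?M = "lebesgue_on \<Omega>"
  fix i :: 'n
  let ?G = "\<lambda>x. x $ i * partial i \<phi> x"
  note sq = sqint_test_fun[OF \<Omega> \<phi>] sqint_grad_test_fun[OF \<Omega> \<phi>]
  have le: "norm (?G x) \<le> R * norm (grad \<phi> x)" if "x \<in> \<Omega>" for x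
  proof -
    have "\<bar>x $ i\<bar> * \<bar>partial i \<phi> x\<bar> \<le> R * norm (grad \<phi> x)"
      using R[OF that] component_le_norm_cart[of x i] component_le_norm_cart[of "grad \<phi> x" i]
      by (intro mult_mono) auto
    then show ?thesis by (simp add: abs_mult)
  qed
  have [measurable]: "?G \<in> borel_measurable ?M"
    by (intro borel_measurable_lebesgue_on borel_measurable_times test_fun_borel[OF test_fun_partial[OF \<phi>]])
      measurable
  have sqG: "sqint ?M ?G"
    by (rule sqint_dominated[OF sq(2) sq(2), of _ R 0]) (use le in auto)
  have "integral\<^sup>L ?M (\<lambda>x. (\<phi> x)\<^sup>2 + 2 * (\<phi> x * ?G x)) = 0"
  proof (rule integral_directional_derivative[where h = "\<lambda>x. x $ i * (\<phi> x)\<^sup>2" and v = "axis i 1"])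
    show "compact (closure {x. \<phi> x \<noteq> 0})" "closure {x. \<phi> x \<noteq> 0} \<subseteq> \<Omega>"
      using \<phi> by (auto simp: test_fun_def)
    show "((\<lambda>t. (x + t *\<^sub>R axis i 1) $ i * (\<phi> (x + t *\<^sub>R axis i 1))\<^sup>2) has_real_derivative
        (\<phi> x)\<^sup>2 + 2 * (\<phi> x * ?G x)) (at 0)" for x
      by (rule derivative_eq_intros smooth_on_has_derivative[OF test_fun_smooth[OF \<phi>]] refl | simp)+
    show "x $ i * (\<phi> x)\<^sup>2 = 0 \<and> (\<phi> x)\<^sup>2 + 2 * (\<phi> x * ?G x) = 0"
      if "x \<notin> closure {x. \<phi> x \<noteq> 0}" for x
    proof -
      have "\<phi> x = 0" using that closure_subset[of "{x. \<phi> x \<noteq> 0}"] by blast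
      then show ?thesis by simp
    qed
  qed (intro \<Omega> continuous_intros test_fun_continuous[OF \<phi>] test_fun_continuous[OF test_fun_partial[OF \<phi>]])+
  then have "(l2n ?M \<phi>)\<^sup>2 = - 2 * integral\<^sup>L ?M (\<lambda>x. \<phi> x \<bullet> ?G x)"
    using sqint_integrable[OF sq(1)] sqint_inner_integrable[OF sq(1) sqG] by (simp add: l2n_power2)
  also have "\<dots> \<le> 2 * (l2n ?M \<phi> * l2n ?M ?G)"
    using l2_Cauchy_Schwarz[OF sq(1) sqG] by linarith
  also have "\<dots> \<le> 2 * (l2n ?M \<phi> * (R * l2n ?M (grad \<phi>)))"
    using l2n_mono[OF sqG sq(2) _ R0] le by (intro mult_left_mono) auto
  finally have "l2n ?M \<phi> * l2n ?M \<phi> \<le> l2n ?M \<phi> * (2 * R * l2n ?M (grad \<phi>))"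
    by (simp add: power2_eq_square algebra_simps)
  then show ?thesis using R0 l2n_nonneg[of ?M \<phi>] l2n_nonneg[of ?M "grad \<phi>"]
    by (cases "l2n ?M \<phi> = 0") (auto simp: mult_le_cancel_left simp del: l2n_nonneg)
qed

section \<open>The space of functions vanishing on the boundary\<close>

locale bounded_open_set =
  fixes \<Omega> :: "(real^'n::finite) set"
  assumes bounded_\<Omega>: "bounded \<Omega>" and open_\<Omega>: "open \<Omega>"
begin

abbreviation M where "M \<equiv> lebesgue_on \<Omega>"

lemma finite_M: "finite_measure M"
  using bounded_\<Omega> open_\<Omega> by (intro finite_measure_lebesgue_on) (auto intro: bounded_set_imp_lmeasurable)

lemmas sqint_test = sqint_test_fun[OF bounded_\<Omega> open_\<Omega>]
lemmas sqint_grad_test = sqint_grad_test_fun[OF bounded_\<Omega> open_\<Omega>]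

lemma H10_with_grad_iff:
  "H10_with_grad \<Omega> u G \<longleftrightarrow> sqint M u \<and> sqint M G \<and> (\<exists>\<phi>. (\<forall>k. test_fun \<Omega> (\<phi> k)) \<and>
    (\<lambda>k. l2n M (\<lambda>x. \<phi> k x - u x)) \<longlonglongrightarrow> 0 \<and> (\<lambda>k. l2n M (\<lambda>x. grad (\<phi> k) x - G x)) \<longlonglongrightarrow> 0)"
proof -
  have eq: "(\<lambda>k. integral\<^sup>L M (\<lambda>x. (norm (F k x))\<^sup>2)) \<longlonglongrightarrow> 0 \<longleftrightarrow> (\<lambda>k. l2n M (F k)) \<longlonglongrightarrow> 0"
    for F :: "nat \<Rightarrow> real^'n \<Rightarrow> 'b::euclidean_space"
  proof
    assume "(\<lambda>k. integral\<^sup>L M (\<lambda>x. (norm (F k x))\<^sup>2)) \<longlonglongrightarrow> 0"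
    from tendsto_real_sqrt[OF this] show "(\<lambda>k. l2n M (F k)) \<longlonglongrightarrow> 0" by (simp add: l2n_def)
  next
    assume "(\<lambda>k. l2n M (F k)) \<longlonglongrightarrow> 0"
    from tendsto_power[OF this, of 2] show "(\<lambda>k. integral\<^sup>L M (\<lambda>x. (norm (F k x))\<^sup>2)) \<longlonglongrightarrow> 0"
      by (simp add: l2n_power2)
  qed
  show ?thesis
    unfolding H10_with_grad_def eq[symmetric] by (simp add: L2_def L2v_def sqint_def)
qed

lemma H10_with_gradE:
  assumes "H10_with_grad \<Omega> u G"
  obtains \<phi> where "\<And>k::nat. test_fun \<Omega> (\<phi> k)" "(\<lambda>k. l2n M (\<lambda>x. \<phi> k x - u x)) \<longlonglongrightarrow> 0"
    "(\<lambda>k. l2n M (\<lambda>x. grad (\<phi> k) x - G x)) \<longlonglongrightarrow> 0"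
  using assms unfolding H10_with_grad_iff by blast

lemma H10_with_grad_sqint:
  assumes "H10_with_grad \<Omega> u G" shows "sqint M u" "sqint M G"
  using assms by (simp_all add: H10_with_grad_iff)

lemma test_fun_H10: "test_fun \<Omega> \<phi> \<Longrightarrow> H10_with_grad \<Omega> \<phi> (grad \<phi>)"
  unfolding H10_with_grad_iff
  by (intro conjI sqint_test sqint_grad_test exI[of _ "\<lambda>_. \<phi>"]) (simp_all add: l2n_def)

lemma H10_with_grad_lincomb:
  assumes "H10_with_grad \<Omega> u G" "H10_with_grad \<Omega> w K"
  shows "H10_with_grad \<Omega> (\<lambda>x. s * u x + t * w x) (\<lambda>x. s *\<^sub>R G x + t *\<^sub>R K x)"
proof -
  from assms(1) obtain \<phi> where \<phi>: "\<And>k::nat. test_fun \<Omega> (\<phi> k)" "(\<lambda>k. l2n M (\<lambda>x. \<phi> k x - u x)) \<longlonglongrightarrow> 0"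
    "(\<lambda>k. l2n M (\<lambda>x. grad (\<phi> k) x - G x)) \<longlonglongrightarrow> 0" by (rule H10_with_gradE) blast
  from assms(2) obtain \<psi> where \<psi>: "\<And>k::nat. test_fun \<Omega> (\<psi> k)" "(\<lambda>k. l2n M (\<lambda>x. \<psi> k x - w x)) \<longlonglongrightarrow> 0"
    "(\<lambda>k. l2n M (\<lambda>x. grad (\<psi> k) x - K x)) \<longlonglongrightarrow> 0" by (rule H10_with_gradE) blast
  note sq = assms[THEN H10_with_grad_sqint(1)] assms[THEN H10_with_grad_sqint(2)]
  have lim: "(\<lambda>k. l2n M (\<lambda>x. (s *\<^sub>R F k x + t *\<^sub>R F' k x) - (s *\<^sub>R F0 x + t *\<^sub>R F0' x))) \<longlonglongrightarrow> 0"
    if "\<And>k. sqint M (F k)" "\<And>k. sqint M (F' k)" "sqint M F0" "sqint M F0'"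
      "(\<lambda>k. l2n M (\<lambda>x. F k x - F0 x)) \<longlonglongrightarrow> 0" "(\<lambda>k. l2n M (\<lambda>x. F' k x - F0' x)) \<longlonglongrightarrow> 0"
    for F F' :: "nat \<Rightarrow> real^'n \<Rightarrow> 'b::euclidean_space" and F0 F0'
  proof (rule Lim_null_comparison)
    have "l2n M (\<lambda>x. (s *\<^sub>R F k x + t *\<^sub>R F' k x) - (s *\<^sub>R F0 x + t *\<^sub>R F0' x))
        \<le> \<bar>s\<bar> * l2n M (\<lambda>x. F k x - F0 x) + \<bar>t\<bar> * l2n M (\<lambda>x. F' k x - F0' x)" for k
      using l2n_lincomb[OF sqint_diff[OF that(1)[of k] that(3)] sqint_diff[OF that(2)[of k] that(4)], of s t]
      by (simp add: scaleR_right_diff_distrib add_diff_add)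
    then show "\<forall>\<^sub>F k in sequentially. norm (l2n M (\<lambda>x. (s *\<^sub>R F k x + t *\<^sub>R F' k x) - (s *\<^sub>R F0 x + t *\<^sub>R F0' x)))
        \<le> \<bar>s\<bar> * l2n M (\<lambda>x. F k x - F0 x) + \<bar>t\<bar> * l2n M (\<lambda>x. F' k x - F0' x)" by simp
    show "(\<lambda>k. \<bar>s\<bar> * l2n M (\<lambda>x. F k x - F0 x) + \<bar>t\<bar> * l2n M (\<lambda>x. F' k x - F0' x)) \<longlonglongrightarrow> 0"
      using tendsto_add[OF tendsto_mult_right_zero[OF that(5)] tendsto_mult_right_zero[OF that(6)]] by simp
  qed
  show ?thesis
    unfolding H10_with_grad_iff
  proof (intro conjI exI allI)
    show "sqint M (\<lambda>x. s * u x + t * w x)" using sqint_lincomb[OF sq(1,2), of s t] by simp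
    show "sqint M (\<lambda>x. s *\<^sub>R G x + t *\<^sub>R K x)" by (rule sqint_lincomb[OF sq(3,4)])
    show "test_fun \<Omega> (\<lambda>x. s * \<phi> k x + t * \<psi> k x)" for k by (rule test_fun_lincomb(1)[OF \<phi>(1) \<psi>(1)])
    show "(\<lambda>k. l2n M (\<lambda>x. s * \<phi> k x + t * \<psi> k x - (s * u x + t * w x))) \<longlonglongrightarrow> 0"
      using lim[OF sqint_test[OF \<phi>(1)] sqint_test[OF \<psi>(1)] sq(1,2) \<phi>(2) \<psi>(2)] by simp
    show "(\<lambda>k. l2n M (\<lambda>x. grad (\<lambda>x. s * \<phi> k x + t * \<psi> k x) x - (s *\<^sub>R G x + t *\<^sub>R K x))) \<longlonglongrightarrow> 0"
      unfolding test_fun_lincomb(2)[OF \<phi>(1) \<psi>(1)]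
      by (rule lim[OF sqint_grad_test[OF \<phi>(1)] sqint_grad_test[OF \<psi>(1)] sq(3,4) \<phi>(3) \<psi>(3)])
  qed
qed

lemma Poincare:
  obtains P where "0 < P" "\<And>u G. H10_with_grad \<Omega> u G \<Longrightarrow> l2n M u \<le> P * l2n M G"
proof -
  obtain R where R: "0 < R" "\<And>x. x \<in> \<Omega> \<Longrightarrow> norm x \<le> R"
    using bounded_\<Omega> unfolding bounded_pos by blast
  have "l2n M u \<le> 2 * R * l2n M G" if u: "H10_with_grad \<Omega> u G" for u G
  proof -
    from u obtain \<phi> where \<phi>: "\<And>k::nat. test_fun \<Omega> (\<phi> k)" "(\<lambda>k. l2n M (\<lambda>x. \<phi> k x - u x)) \<longlonglongrightarrow> 0"
      "(\<lambda>k. l2n M (\<lambda>x. grad (\<phi> k) x - G x)) \<longlonglongrightarrow> 0" by (rule H10_with_gradE) blast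
    note sq = H10_with_grad_sqint[OF u]
    show ?thesis
    proof (rule LIMSEQ_le)
      show "(\<lambda>k. l2n M (\<phi> k)) \<longlonglongrightarrow> l2n M u" by (rule l2n_tendsto[OF sqint_test[OF \<phi>(1)] sq(1) \<phi>(2)])
      show "(\<lambda>k. 2 * R * l2n M (grad (\<phi> k))) \<longlonglongrightarrow> 2 * R * l2n M G"
        by (intro tendsto_mult_left l2n_tendsto[OF sqint_grad_test[OF \<phi>(1)] sq(2) \<phi>(3)])
      show "\<exists>N. \<forall>n\<ge>N. l2n M (\<phi> n) \<le> 2 * R * l2n M (grad (\<phi> n))"
        using test_fun_Poincare[OF bounded_\<Omega> open_\<Omega> R(2) _ \<phi>(1)] R(1) by auto
    qed
  qed
  then show thesis using R(1) by (intro that[of "2 * R"]) auto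
qed

text \<open>If test functions \<open>\<phi>\<^sub>k\<close> tend to \<open>0\<close> while their gradients tend to \<open>G\<close>, then \<open>G\<close> is orthogonal to
  every \<open>grad \<phi>\<^sub>j\<close> and hence to its own limit.\<close>

lemma H10_grad_zero:
  assumes "H10_with_grad \<Omega> (\<lambda>_. 0) G"
  shows "l2n M G = 0"
proof -
  from assms obtain \<phi> where \<phi>: "\<And>k::nat. test_fun \<Omega> (\<phi> k)" "(\<lambda>k. l2n M (\<lambda>x. \<phi> k x - 0)) \<longlonglongrightarrow> 0"
    "(\<lambda>k. l2n M (\<lambda>x. grad (\<phi> k) x - G x)) \<longlonglongrightarrow> 0" by (rule H10_with_gradE) blast
  note sq = H10_with_grad_sqint[OF assms]
  have orth: "integral\<^sup>L M (\<lambda>x. G x \<bullet> grad (\<phi> j) x) = 0" for j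
  proof (rule LIMSEQ_unique)
    show "(\<lambda>k. integral\<^sup>L M (\<lambda>x. grad (\<phi> k) x \<bullet> grad (\<phi> j) x)) \<longlonglongrightarrow> integral\<^sup>L M (\<lambda>x. G x \<bullet> grad (\<phi> j) x)"
      by (rule l2_inner_tendsto[OF sqint_grad_test[OF \<phi>(1)] sq(2) \<phi>(3)
            sqint_grad_test[OF \<phi>(1)] sqint_grad_test[OF \<phi>(1)]]) (simp add: l2n_def)
    have "integral\<^sup>L M (\<lambda>x. grad (\<phi> k) x \<bullet> grad (\<phi> j) x)
        = (\<Sum>i\<in>UNIV. integral\<^sup>L M (\<lambda>x. partial i (\<phi> k) x * partial i (\<phi> j) x))" for k
      unfolding inner_vec_def grad_nth inner_real_def
      using sqint_inner_integrable[OF sqint_test[OF test_fun_partial[OF \<phi>(1)]] sqint_test[OF test_fun_partial[OF \<phi>(1)]]]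
      by (intro Bochner_Integration.integral_sum) simp
    \<comment> \<open>\<open>\<phi> k\<close> tends to 0 but its gradient need not, so the
      derivative is moved off \<open>\<phi> k\<close> onto the fixed smooth function
      \<open>\<phi> j\<close>.\<close>
    also have "\<dots> k = (\<Sum>i\<in>UNIV. - integral\<^sup>L M (\<lambda>x. \<phi> k x \<bullet> partial i (partial i (\<phi> j)) x))" for k
      by (intro sum.cong refl) (simp add: test_fun_by_parts[OF bounded_\<Omega> open_\<Omega> \<phi>(1) test_fun_partial[OF \<phi>(1)]])
    finally have eq: "integral\<^sup>L M (\<lambda>x. grad (\<phi> k) x \<bullet> grad (\<phi> j) x)
        = (\<Sum>i\<in>UNIV. - integral\<^sup>L M (\<lambda>x. \<phi> k x \<bullet> partial i (partial i (\<phi> j)) x))" for k .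
    have "(\<lambda>k. integral\<^sup>L M (\<lambda>x. \<phi> k x \<bullet> partial i (partial i (\<phi> j)) x))
        \<longlonglongrightarrow> integral\<^sup>L M (\<lambda>x. 0 \<bullet> partial i (partial i (\<phi> j)) x)" for i
      by (rule l2_inner_tendsto[OF sqint_test[OF \<phi>(1)] sq(1) \<phi>(2)
            sqint_test[OF test_fun_partial[OF test_fun_partial[OF \<phi>(1)]]]
            sqint_test[OF test_fun_partial[OF test_fun_partial[OF \<phi>(1)]]]]) (simp add: l2n_def)
    then have "(\<lambda>k. \<Sum>i\<in>UNIV. - integral\<^sup>L M (\<lambda>x. \<phi> k x \<bullet> partial i (partial i (\<phi> j)) x)) \<longlonglongrightarrow> (\<Sum>i\<in>(UNIV::'n set). - 0)"
      by (intro tendsto_sum tendsto_minus) simp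
    then show "(\<lambda>k. integral\<^sup>L M (\<lambda>x. grad (\<phi> k) x \<bullet> grad (\<phi> j) x)) \<longlonglongrightarrow> 0"
      unfolding eq by simp
  qed
  have "(\<lambda>j. integral\<^sup>L M (\<lambda>x. G x \<bullet> grad (\<phi> j) x)) \<longlonglongrightarrow> integral\<^sup>L M (\<lambda>x. G x \<bullet> G x)"
    by (rule l2_inner_tendsto[OF sq(2) sq(2) _ sqint_grad_test[OF \<phi>(1)] sq(2) \<phi>(3)]) (simp add: l2n_def)
  then have "integral\<^sup>L M (\<lambda>x. G x \<bullet> G x) = 0" unfolding orth by (simp add: LIMSEQ_const_iff)
  then show ?thesis by (simp add: l2n_def power2_norm_eq_inner)
qed

section \<open>The chosen weak gradient and the energy norm\<close>

lemma wgrad_H10: "H10 \<Omega> u \<Longrightarrow> H10_with_grad \<Omega> u (wgrad \<Omega> u)"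
  unfolding H10_def wgrad_def by (erule someI_ex)

lemma wgrad_sqint: "H10 \<Omega> u \<Longrightarrow> sqint M (wgrad \<Omega> u)" and H10_sqint: "H10 \<Omega> u \<Longrightarrow> sqint M u"
  using wgrad_H10 H10_with_grad_sqint by blast+

text \<open>\<open>wgrad\<close> is picked by choice and becomes usable only once two admissible
  gradients are known to agree almost everywhere: their difference is a weak gradient of the zero
  function.\<close>

lemma wgrad_unique:
  assumes "H10_with_grad \<Omega> u G"
  shows "AE x in M. wgrad \<Omega> u x = G x"
proof -
  have u: "H10_with_grad \<Omega> u (wgrad \<Omega> u)" using assms by (intro wgrad_H10) (auto simp: H10_def)
  have "H10_with_grad \<Omega> (\<lambda>_. 0) (\<lambda>x. wgrad \<Omega> u x - G x)"
    using H10_with_grad_lincomb[OF u assms, of 1 "-1"] by simp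
  from l2n_eq_0_AE[OF H10_with_grad_sqint(2)[OF this] H10_grad_zero[OF this]] show ?thesis by simp
qed

lemma H10_lincomb: "H10 \<Omega> u \<Longrightarrow> H10 \<Omega> w \<Longrightarrow> H10 \<Omega> (\<lambda>x. s * u x + t * w x)"
  using H10_with_grad_lincomb unfolding H10_def by blast

lemma wgrad_lincomb:
  assumes "H10 \<Omega> u" "H10 \<Omega> w"
  shows "AE x in M. wgrad \<Omega> (\<lambda>x. s * u x + t * w x) x = s *\<^sub>R wgrad \<Omega> u x + t *\<^sub>R wgrad \<Omega> w x"
  by (intro wgrad_unique H10_with_grad_lincomb wgrad_H10 assms)

lemma wgrad_diff:
  assumes "H10 \<Omega> u" "H10 \<Omega> w"
  shows "AE x in M. wgrad \<Omega> (\<lambda>x. u x - w x) x = wgrad \<Omega> u x - wgrad \<Omega> w x"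
  using wgrad_lincomb[OF assms, of 1 "-1"] by simp

lemma H10_diff: "H10 \<Omega> u \<Longrightarrow> H10 \<Omega> w \<Longrightarrow> H10 \<Omega> (\<lambda>x. u x - w x)"
  using H10_lincomb[of u w 1 "-1"] by simp

text \<open>By the Poincare inequality this seminorm also controls the L2 norm, so it can serve as
  the only norm on \<open>H10\<close>.\<close>

definition energy_norm :: "(real^'n \<Rightarrow> real) \<Rightarrow> real" where
  "energy_norm u = l2n M (wgrad \<Omega> u)"

lemma energy_norm_diff:
  assumes "H10 \<Omega> u" "H10 \<Omega> w"
  shows "energy_norm (\<lambda>x. u x - w x) = l2n M (\<lambda>x. wgrad \<Omega> u x - wgrad \<Omega> w x)"
  unfolding energy_norm_def
  by (intro l2n_cong_AE wgrad_sqint H10_diff sqint_diff wgrad_diff assms)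

lemma energy_norm_lincomb:
  assumes "H10 \<Omega> u" "H10 \<Omega> w"
  shows "energy_norm (\<lambda>x. s * u x + t * w x) \<le> \<bar>s\<bar> * energy_norm u + \<bar>t\<bar> * energy_norm w"
proof -
  have "energy_norm (\<lambda>x. s * u x + t * w x) = l2n M (\<lambda>x. s *\<^sub>R wgrad \<Omega> u x + t *\<^sub>R wgrad \<Omega> w x)"
    unfolding energy_norm_def
    by (intro l2n_cong_AE wgrad_sqint H10_lincomb sqint_lincomb wgrad_lincomb assms)
  also have "\<dots> \<le> \<bar>s\<bar> * energy_norm u + \<bar>t\<bar> * energy_norm w"
    unfolding energy_norm_def by (intro l2n_lincomb wgrad_sqint assms)
  finally show ?thesis .
qed

text \<open>Gradients converge by completeness of L2, the functions themselves with the help of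
  Poincare. The test functions approximating the limit are taken diagonally, the k-th one within
  1/(k+1) of \<open>U k\<close>.\<close>

lemma H10_complete:
  assumes U: "\<And>k. H10 \<Omega> (U k)"
    and cauchy: "\<And>e. e > 0 \<Longrightarrow> \<exists>K::nat. \<forall>j\<ge>K. \<forall>k\<ge>K. energy_norm (\<lambda>x. U j x - U k x) < e"
  shows "\<exists>u. H10 \<Omega> u \<and> (\<lambda>k. energy_norm (\<lambda>x. U k x - u x)) \<longlonglongrightarrow> 0"
proof -
  obtain P where P: "0 < P" "\<And>u G. H10_with_grad \<Omega> u G \<Longrightarrow> l2n M u \<le> P * l2n M G"
    by (rule Poincare) blast
  have l2: "l2n M (\<lambda>x. U j x - U k x) \<le> P * energy_norm (\<lambda>x. U j x - U k x)" for j k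
    unfolding energy_norm_def by (intro P(2) wgrad_H10 H10_diff U)
  obtain G where G: "sqint M G" "(\<lambda>k. l2n M (\<lambda>x. wgrad \<Omega> (U k) x - G x)) \<longlonglongrightarrow> 0"
  proof (rule l2_complete[OF wgrad_sqint[OF U]])
    show "\<exists>K. \<forall>j\<ge>K. \<forall>k\<ge>K. l2n M (\<lambda>x. wgrad \<Omega> (U j) x - wgrad \<Omega> (U k) x) < e" if "e > 0" for e
      using cauchy[OF that] by (simp add: energy_norm_diff U)
  qed blast
  obtain u where u: "sqint M u" "(\<lambda>k. l2n M (\<lambda>x. U k x - u x)) \<longlonglongrightarrow> 0"
  proof (rule l2_complete[OF H10_sqint[OF U]])
    fix e :: real assume "e > 0"
    then obtain K where "\<forall>j\<ge>K. \<forall>k\<ge>K. energy_norm (\<lambda>x. U j x - U k x) < e / P"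
      using cauchy[of "e / P"] P(1) by auto
    then have "\<forall>j\<ge>K. \<forall>k\<ge>K. P * energy_norm (\<lambda>x. U j x - U k x) < e"
      using P(1) by (simp add: pos_less_divide_eq mult.commute)
    then show "\<exists>K. \<forall>j\<ge>K. \<forall>k\<ge>K. l2n M (\<lambda>x. U j x - U k x) < e"
      using l2 by (meson le_less_trans)
  qed blast
  have "\<exists>\<psi>. test_fun \<Omega> \<psi> \<and> l2n M (\<lambda>x. \<psi> x - U k x) < 1 / real (Suc k) \<and>
      l2n M (\<lambda>x. grad \<psi> x - wgrad \<Omega> (U k) x) < 1 / real (Suc k)" for k
  proof -
    from wgrad_H10[OF U[of k]] obtain \<phi> where \<phi>: "\<And>j::nat. test_fun \<Omega> (\<phi> j)"
      "(\<lambda>j. l2n M (\<lambda>x. \<phi> j x - U k x)) \<longlonglongrightarrow> 0"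
      "(\<lambda>j. l2n M (\<lambda>x. grad (\<phi> j) x - wgrad \<Omega> (U k) x)) \<longlonglongrightarrow> 0" by (rule H10_with_gradE) blast
    have "\<forall>\<^sub>F j in sequentially. l2n M (\<lambda>x. \<phi> j x - U k x) < 1 / real (Suc k) \<and>
        l2n M (\<lambda>x. grad (\<phi> j) x - wgrad \<Omega> (U k) x) < 1 / real (Suc k)"
      by (intro eventually_conj order_tendstoD(2)[OF \<phi>(2)] order_tendstoD(2)[OF \<phi>(3)]) auto
    then show ?thesis using \<phi>(1) by (auto simp: eventually_sequentially)
  qed
  then have "\<exists>\<psi>. \<forall>k. test_fun \<Omega> (\<psi> k) \<and> l2n M (\<lambda>x. \<psi> k x - U k x) < 1 / real (Suc k) \<and>
      l2n M (\<lambda>x. grad (\<psi> k) x - wgrad \<Omega> (U k) x) < 1 / real (Suc k)"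
    by (intro choice allI)
  then obtain \<psi> where \<psi>': "\<forall>k. test_fun \<Omega> (\<psi> k) \<and> l2n M (\<lambda>x. \<psi> k x - U k x) < 1 / real (Suc k) \<and>
      l2n M (\<lambda>x. grad (\<psi> k) x - wgrad \<Omega> (U k) x) < 1 / real (Suc k)" by (rule exE)
  have \<psi>: "test_fun \<Omega> (\<psi> k)" "l2n M (\<lambda>x. \<psi> k x - U k x) < 1 / real (Suc k)"
    "l2n M (\<lambda>x. grad (\<psi> k) x - wgrad \<Omega> (U k) x) < 1 / real (Suc k)" for k
    using spec[OF \<psi>', of k] by simp_all
  have lim: "(\<lambda>k. l2n M (\<lambda>x. A k x - C x)) \<longlonglongrightarrow> 0"
    if "\<And>k. sqint M (A k)" "\<And>k. sqint M (B k)" "sqint M C"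
      "\<And>k. l2n M (\<lambda>x. A k x - B k x) < 1 / real (Suc k)" "(\<lambda>k. l2n M (\<lambda>x. B k x - C x)) \<longlonglongrightarrow> 0"
    for A B :: "nat \<Rightarrow> real^'n \<Rightarrow> 'b::euclidean_space" and C
  proof (rule Lim_null_comparison)
    have "l2n M (\<lambda>x. A k x - C x) \<le> 1 / real (Suc k) + l2n M (\<lambda>x. B k x - C x)" for k
      using l2n_triangle[OF that(1,2,3), of k k] that(4)[of k] by linarith
    then show "\<forall>\<^sub>F k in sequentially. norm (l2n M (\<lambda>x. A k x - C x)) \<le> 1 / real (Suc k) + l2n M (\<lambda>x. B k x - C x)"
      by simp
    show "(\<lambda>k. 1 / real (Suc k) + l2n M (\<lambda>x. B k x - C x)) \<longlonglongrightarrow> 0"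
      using tendsto_add[OF LIMSEQ_inverse_real_of_nat that(5)] by (simp add: inverse_eq_divide)
  qed
  have "H10_with_grad \<Omega> u G"
    unfolding H10_with_grad_iff
    by (intro conjI exI[of _ \<psi>] allI u G \<psi> lim[OF sqint_test[OF \<psi>(1)] H10_sqint[OF U] u(1) \<psi>(2) u(2)]
        lim[OF sqint_grad_test[OF \<psi>(1)] wgrad_sqint[OF U] G(1) \<psi>(3) G(2)])
  then have uH: "H10 \<Omega> u" and AE: "AE x in M. wgrad \<Omega> u x = G x"
    by (auto simp: H10_def intro: wgrad_unique)
  have "energy_norm (\<lambda>x. U k x - u x) = l2n M (\<lambda>x. wgrad \<Omega> (U k) x - G x)" for k
    unfolding energy_norm_diff[OF U uH]
    by (intro l2n_cong_AE sqint_diff wgrad_sqint U uH G) (use AE in auto)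
  then show ?thesis using uH G(2) by auto
qed

end

section \<open>The Loomis-Whitney inequality\<close>

definition eroot :: "nat \<Rightarrow> ennreal \<Rightarrow> ennreal" where
  "eroot m x = (if x = top then top else ennreal (root m (enn2real x)))"

lemma eroot_measurable [measurable]: "eroot m \<in> borel_measurable borel"
  unfolding eroot_def[abs_def] by measurable

lemma eroot_power: "0 < m \<Longrightarrow> eroot m x ^ m = x"
  by (cases x rule: ennreal_cases) (auto simp: eroot_def ennreal_power)

lemma power_mono_iff_ennreal:
  fixes x y :: ennreal
  assumes "0 < m"
  shows "x ^ m \<le> y ^ m \<longleftrightarrow> x \<le> y"
proof
  assume *: "x ^ m \<le> y ^ m"
  show "x \<le> y"
    using * assms
    by (cases x rule: ennreal_cases; cases y rule: ennreal_cases)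
      (auto simp: ennreal_power top_unique)
qed (simp add: power_mono)

lemma eroot_power': "0 < m \<Longrightarrow> eroot m (x ^ m) = x"
  using eroot_power[of m "x ^ m"] power_mono_iff_ennreal[of m]
  by (metis order.antisym order.refl)

lemma eroot_mono: "0 < m \<Longrightarrow> x \<le> y \<Longrightarrow> eroot m x \<le> eroot m y"
  by (metis eroot_power power_mono_iff_ennreal)

lemma prod_le_sum_powers:
  fixes h :: "'i \<Rightarrow> real"
  assumes J: "finite J" "card J = m" "0 < m" and h: "\<And>j. j \<in> J \<Longrightarrow> 0 \<le> h j"
  shows "(\<Prod>j\<in>J. h j) \<le> (\<Sum>j\<in>J. h j ^ m) / m"
proof -
  have "(\<Prod>j\<in>J. h j) = ((\<Prod>j\<in>J. h j) powr m) powr (1 / m)"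
    using J h by (simp add: powr_powr prod_nonneg)
  also have "(\<Prod>j\<in>J. h j) powr m = (\<Prod>j\<in>J. h j) ^ m"
    using J h by (intro powr_realpow') (auto intro: prod_nonneg)
  also have "\<dots> = (\<Prod>j\<in>J. h j ^ m)" by (simp add: prod_power_distrib)
  also have "(\<Prod>j\<in>J. h j ^ m) powr (1 / m) \<le> (\<Sum>j\<in>J. h j ^ m / m)"
    using arith_geom_mean[of J "\<lambda>j. h j ^ m"] J h by fastforce
  finally show ?thesis by (simp add: sum_divide_distrib)
qed

lemma prod_le_sum_powers_ennreal:
  fixes h :: "'i \<Rightarrow> ennreal"
  assumes J: "finite J" "card J = m" "0 < m"
  shows "(\<Prod>j\<in>J. h j) \<le> ennreal (1 / m) * (\<Sum>j\<in>J. h j ^ m)"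
proof (cases "\<exists>j\<in>J. h j = top")
  case True
  then have eq: "(\<Sum>j\<in>J. h j ^ m) = top" using J by (auto simp: power_eq_top_ennreal)
  show ?thesis unfolding eq using J by (simp add: ennreal_mult_top)
next
  case False
  define r where "r j = enn2real (h j)" for j
  have r: "h j = ennreal (r j)" "0 \<le> r j" if "j \<in> J" for j
    using False that by (auto simp: r_def less_top)
  have "(\<Prod>j\<in>J. h j) = ennreal (\<Prod>j\<in>J. r j)"
    using r by (simp add: prod_ennreal)
  also have "\<dots> \<le> ennreal ((\<Sum>j\<in>J. r j ^ m) / m)"
    using r J by (intro ennreal_leI prod_le_sum_powers) auto
  also have "\<dots> = ennreal (1 / m) * ennreal (\<Sum>j\<in>J. r j ^ m)"
    by (subst ennreal_mult[symmetric]) (auto intro!: sum_nonneg simp: r)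
  also have "ennreal (\<Sum>j\<in>J. r j ^ m) = (\<Sum>j\<in>J. h j ^ m)"
    using r by (simp add: ennreal_power flip: sum_ennreal)
  finally show ?thesis .
qed

text \<open>Hoelder's inequality for m factors with equal exponents m, raised to the power m so that
  no roots appear. Each factor is normalised so that its m-th power has integral 1; then the
  arithmetic-geometric mean inequality is applied pointwise.\<close>

lemma nn_integral_prod_Holder:
  fixes h :: "'i \<Rightarrow> 'a \<Rightarrow> ennreal"
  assumes J: "finite J" "card J = m" "0 < m"
    and [measurable]: "\<And>j. j \<in> J \<Longrightarrow> h j \<in> borel_measurable M"
  shows "(\<integral>\<^sup>+x. (\<Prod>j\<in>J. h j x) \<partial>M) ^ m \<le> (\<Prod>j\<in>J. \<integral>\<^sup>+x. h j x ^ m \<partial>M)"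
proof -
  define A where "A j = (\<integral>\<^sup>+x. h j x ^ m \<partial>M)" for j
  \<comment> \<open>A vanishing \<open>A j\<close> is treated first: in \<open>ennreal\<close> the
    product of 0 and top is 0, so the infinite case needs all factors nonzero.\<close>
  consider j where "j \<in> J" "A j = 0" | "\<forall>j\<in>J. A j \<noteq> 0" "\<exists>j\<in>J. A j = top"
    | "\<forall>j\<in>J. A j \<noteq> 0 \<and> A j \<noteq> top" by blast
  then have "(\<integral>\<^sup>+x. (\<Prod>j\<in>J. h j x) \<partial>M) ^ m \<le> (\<Prod>j\<in>J. A j)"
  proof cases
    case (1 j)
    then have "AE x in M. h j x ^ m = 0"
      using nn_integral_0_iff_AE[of "\<lambda>x. h j x ^ m" M] by (auto simp: A_def)
    then have "AE x in M. (\<Prod>j\<in>J. h j x) = 0"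
      by eventually_elim (use 1 J in auto)
    then have "(\<integral>\<^sup>+x. (\<Prod>j\<in>J. h j x) \<partial>M) = (\<integral>\<^sup>+x. 0 \<partial>M)" by (rule nn_integral_cong_AE)
    then show ?thesis using J by (simp add: zero_power)
  next
    case 2
    then have "(\<Prod>j\<in>J. A j) = top"
      using J(1) by (auto simp: ennreal_prod_eq_top)
    then show ?thesis by simp
  next
    case 3
    define c where "c j = root m (enn2real (A j))" for j
    have c: "0 < c j" "ennreal (c j) ^ m = A j" if "j \<in> J" for j
    proof -
      have *: "0 < enn2real (A j)" using 3 that by (simp add: enn2real_positive_iff less_top zero_less_iff_neq_zero)
      then show "0 < c j" using J by (simp add: c_def)
      show "ennreal (c j) ^ m = A j"
        using J 3 that * by (simp add: c_def ennreal_power less_top)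
    qed
    have cinv: "ennreal (c j) * ennreal (1 / c j) = 1" if "j \<in> J" for j
      using c(1)[OF that] by (simp flip: ennreal_mult)
    define k where "k j x = ennreal (1 / c j) * h j x" for j x
    have [measurable]: "k j \<in> borel_measurable M" if "j \<in> J" for j
      unfolding k_def using that by measurable
    have k_int: "(\<integral>\<^sup>+x. k j x ^ m \<partial>M) = 1" if "j \<in> J" for j
    proof -
      have "(\<integral>\<^sup>+x. k j x ^ m \<partial>M) = ennreal (1 / c j) ^ m * A j"
        unfolding k_def A_def power_mult_distrib using that by (intro nn_integral_cmult) measurable
      also have "\<dots> = (ennreal (c j) * ennreal (1 / c j)) ^ m"
        using c(2)[OF that] by (simp add: power_mult_distrib mult.commute)
      finally show ?thesis using cinv[OF that] by simp
    qed
    have "(\<integral>\<^sup>+x. (\<Prod>j\<in>J. k j x) \<partial>M) \<le> (\<integral>\<^sup>+x. ennreal (1 / m) * (\<Sum>j\<in>J. k j x ^ m) \<partial>M)"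
      by (intro nn_integral_mono prod_le_sum_powers_ennreal J)
    also have "\<dots> = ennreal (1 / m) * (\<Sum>j\<in>J. \<integral>\<^sup>+x. k j x ^ m \<partial>M)"
      by (subst nn_integral_cmult, measurable, subst nn_integral_sum) auto
    also have "\<dots> = 1" using J k_int by (simp flip: ennreal_of_nat_eq_real_of_nat ennreal_mult)
        (simp add: ennreal_of_nat_eq_real_of_nat flip: ennreal_mult)
    finally have le1: "(\<integral>\<^sup>+x. (\<Prod>j\<in>J. k j x) \<partial>M) \<le> 1" .
    have "h j x = ennreal (c j) * k j x" if "j \<in> J" for j x
      using cinv[OF that] by (simp add: k_def flip: mult.assoc)
    then have "(\<integral>\<^sup>+x. (\<Prod>j\<in>J. h j x) \<partial>M) = (\<integral>\<^sup>+x. (\<Prod>j\<in>J. ennreal (c j)) * (\<Prod>j\<in>J. k j x) \<partial>M)"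
      by (intro nn_integral_cong) (simp flip: prod.distrib)
    also have "\<dots> = (\<Prod>j\<in>J. ennreal (c j)) * (\<integral>\<^sup>+x. (\<Prod>j\<in>J. k j x) \<partial>M)"
      by (rule nn_integral_cmult) measurable
    also have "\<dots> \<le> (\<Prod>j\<in>J. ennreal (c j)) * 1" by (intro mult_left_mono le1) simp
    finally have "(\<integral>\<^sup>+x. (\<Prod>j\<in>J. h j x) \<partial>M) ^ m \<le> (\<Prod>j\<in>J. ennreal (c j)) ^ m"
      by (intro power_mono) auto
    also have "\<dots> = (\<Prod>j\<in>J. A j)" using c(2) by (simp add: prod_power_distrib)
    finally show ?thesis .
  qed
  then show ?thesis by (simp add: A_def)
qed

text \<open>Overwriting coordinate i instead of removing it keeps all functions on the same space,
  so that integrations along different coordinates can be iterated, and the result visibly does not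
  depend on \<open>x i\<close>.\<close>

definition int_along :: "'i \<Rightarrow> (('i \<Rightarrow> real) \<Rightarrow> ennreal) \<Rightarrow> ('i \<Rightarrow> real) \<Rightarrow> ennreal" where
  "int_along i f x = (\<integral>\<^sup>+t. f (x(i := t)) \<partial>lborel)"

definition iter_int :: "'i list \<Rightarrow> (('i \<Rightarrow> real) \<Rightarrow> ennreal) \<Rightarrow> ('i \<Rightarrow> real) \<Rightarrow> ennreal" where
  "iter_int ks f = foldr int_along ks f"

lemma iter_int_simps [simp]:
  "iter_int [] f = f"
  "iter_int (i # ks) f = int_along i (iter_int ks f)"
  "iter_int (ks @ js) f = iter_int ks (iter_int js f)"
  by (simp_all add: iter_int_def)

lemma int_along_measurable [measurable]:
  assumes [measurable]: "f \<in> borel_measurable (Pi\<^sub>M I (\<lambda>_. lborel))" and "i \<in> I"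
  shows "int_along i f \<in> borel_measurable (Pi\<^sub>M I (\<lambda>_. lborel))"
proof -
  have "(\<lambda>p. (fst p)(i := snd p)) \<in> Pi\<^sub>M I (\<lambda>_. lborel) \<Otimes>\<^sub>M lborel \<rightarrow>\<^sub>M Pi\<^sub>M I (\<lambda>_. lborel :: real measure)"
    by (rule measurable_fun_upd[where J = I]) (use \<open>i \<in> I\<close> in auto)
  then have "(\<lambda>(x, t). f (x(i := t))) \<in> borel_measurable (Pi\<^sub>M I (\<lambda>_. lborel) \<Otimes>\<^sub>M lborel)"
    unfolding case_prod_beta by (rule measurable_compose) fact
  then show ?thesis
    unfolding int_along_def[abs_def] by (rule lborel.borel_measurable_nn_integral)
qed

lemma iter_int_measurable:
  assumes "f \<in> borel_measurable (Pi\<^sub>M I (\<lambda>_. lborel))" "set ks \<subseteq> I"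
  shows "iter_int ks f \<in> borel_measurable (Pi\<^sub>M I (\<lambda>_. lborel))"
  using assms(2) by (induction ks) (auto intro!: int_along_measurable assms(1))

lemma fun_upd_measurable_line:
  assumes f: "f \<in> borel_measurable (Pi\<^sub>M I (\<lambda>_. lborel))" and "i \<in> I" "x \<in> space (Pi\<^sub>M I (\<lambda>_. lborel))"
  shows "(\<lambda>t. f (x(i := t))) \<in> borel_measurable (lborel :: real measure)"
proof -
  have "(\<lambda>t. x(i := t)) \<in> lborel \<rightarrow>\<^sub>M Pi\<^sub>M I (\<lambda>_. lborel :: real measure)"
    by (rule measurable_fun_upd[where J = I]) (use assms in auto)
  then show ?thesis by (rule measurable_compose) fact
qed

lemma iter_int_indep:
  assumes "i \<notin> set ks" "\<And>x t. f (x(i := t)) = f x"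
  shows "iter_int ks f (x(i := t)) = iter_int ks f x"
  using assms(1)
proof (induction ks arbitrary: x)
  case (Cons k ks)
  then have "k \<noteq> i" "i \<notin> set ks" by auto
  have "iter_int ks f (x(i := t, k := s)) = iter_int ks f (x(k := s))" for s
    unfolding fun_upd_twist[OF \<open>k \<noteq> i\<close>[symmetric]] by (rule Cons.IH[OF \<open>i \<notin> set ks\<close>])
  then show ?case unfolding iter_int_simps int_along_def by (simp only:)
qed (simp add: assms)

text \<open>Tonelli, one coordinate at a time: coordinates in the list are integrated, the others
  stay frozen at their values in x.\<close>

lemma iter_int_eq_nn_integral:
  assumes "distinct ks" "set ks \<subseteq> I" and x: "x \<in> space (Pi\<^sub>M I (\<lambda>_. lborel))"
    and f: "f \<in> borel_measurable (Pi\<^sub>M I (\<lambda>_. lborel))"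
  shows "iter_int ks f x = (\<integral>\<^sup>+y. f (\<lambda>i. if i \<in> set ks then y i else x i) \<partial>Pi\<^sub>M (set ks) (\<lambda>_. lborel))"
  using assms(1,2) x
proof (induction ks arbitrary: x)
  case Nil
  then show ?case by (simp add: PiM_empty nn_integral_count_space_finite)
next
  case (Cons i js)
  interpret product_sigma_finite "\<lambda>_::'a. lborel :: real measure" ..
  have "(\<lambda>y k. if k \<in> insert i (set js) then y k else x k)
      \<in> Pi\<^sub>M (insert i (set js)) (\<lambda>_. lborel) \<rightarrow>\<^sub>M Pi\<^sub>M I (\<lambda>_. lborel :: real measure)"
  proof (rule measurable_PiM_single')
    fix k assume "k \<in> I"
    then show "(\<lambda>y. if k \<in> insert i (set js) then y k else x k) \<in> Pi\<^sub>M (insert i (set js)) (\<lambda>_. lborel) \<rightarrow>\<^sub>M lborel"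
      by (cases "k \<in> insert i (set js)") (simp_all add: measurable_component_singleton)
  next
    show "(\<lambda>y k. if k \<in> insert i (set js) then y k else x k)
        \<in> space (Pi\<^sub>M (insert i (set js)) (\<lambda>_. lborel)) \<rightarrow> (\<Pi>\<^sub>E i\<in>I. space lborel)"
      using Cons.prems by (auto simp: space_PiM PiE_def extensional_def)
  qed
  from measurable_compose[OF this f]
  have meas: "(\<lambda>y. f (\<lambda>k. if k \<in> insert i (set js) then y k else x k))
      \<in> borel_measurable (Pi\<^sub>M (insert i (set js)) (\<lambda>_. lborel :: real measure))" .
  have "iter_int (i # js) f x = (\<integral>\<^sup>+t. (\<integral>\<^sup>+y. f (\<lambda>k. if k \<in> set js then y k else (x(i := t)) k)
      \<partial>Pi\<^sub>M (set js) (\<lambda>_. lborel)) \<partial>lborel)"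
    using Cons.prems by (simp add: int_along_def, intro nn_integral_cong Cons.IH)
      (auto simp: space_PiM PiE_def extensional_def)
  also have "\<dots> = (\<integral>\<^sup>+t. (\<integral>\<^sup>+y. f (\<lambda>k. if k \<in> insert i (set js) then (y(i := t)) k else x k)
      \<partial>Pi\<^sub>M (set js) (\<lambda>_. lborel)) \<partial>lborel)"
    using Cons.prems by (intro nn_integral_cong arg_cong[of _ _ f]) auto
  also have "\<dots> = (\<integral>\<^sup>+y. f (\<lambda>k. if k \<in> insert i (set js) then y k else x k)
      \<partial>Pi\<^sub>M (insert i (set js)) (\<lambda>_. lborel))"
    using Cons.prems by (subst product_nn_integral_insert_rev[OF _ _ meas]) auto
  finally show ?case by simp
qed

lemma iter_int_full:
  assumes "distinct ks" "set ks = I" and x: "x \<in> space (Pi\<^sub>M I (\<lambda>_. lborel))"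
    and f: "f \<in> borel_measurable (Pi\<^sub>M I (\<lambda>_. lborel))"
  shows "iter_int ks f x = (\<integral>\<^sup>+y. f y \<partial>Pi\<^sub>M I (\<lambda>_. lborel))"
proof -
  have "(\<lambda>i. if i \<in> I then y i else x i) = y" if "y \<in> space (Pi\<^sub>M I (\<lambda>_. lborel :: real measure))" for y
    using that x by (auto simp: space_PiM PiE_def extensional_def)
  then show ?thesis
    using iter_int_eq_nn_integral[OF assms(1) _ x f] assms(2) by (auto intro!: nn_integral_cong)
qed

text \<open>The induction behind Loomis-Whitney. Of the m + 1 factors, the one that belongs to the
  coordinate i being integrated does not depend on i and comes out of the integral; Hoelder handles
  the remaining m. This is why \<open>removeAll j\<close> occurs: factor j is never integrated along
  its own coordinate.\<close>

lemma iter_int_prod_le: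
  fixes F :: "'i \<Rightarrow> ('i \<Rightarrow> real) \<Rightarrow> ennreal"
  assumes I: "finite I" "card I = Suc m" "0 < m"
    and F: "\<And>j. j \<in> I \<Longrightarrow> F j \<in> borel_measurable (Pi\<^sub>M I (\<lambda>_. lborel))"
    and indep: "\<And>j x t. j \<in> I \<Longrightarrow> F j (x(j := t)) = F j x"
    and "distinct ks" "set ks \<subseteq> I" "x \<in> space (Pi\<^sub>M I (\<lambda>_. lborel))"
  shows "iter_int ks (\<lambda>x. \<Prod>j\<in>I. F j x) x
    \<le> (\<Prod>j\<in>I. eroot m (iter_int (removeAll j ks) (\<lambda>x. F j x ^ m) x))"
  using assms(6-8)
proof (induction ks arbitrary: x)
  case Nil
  then show ?case using I by (simp add: eroot_power')
next
  case (Cons i js)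
  define G where "G j = iter_int (removeAll j js) (\<lambda>x. F j x ^ m)" for j
  have i: "i \<in> I" "i \<notin> set js" "distinct js" "set js \<subseteq> I" using Cons.prems by auto
  have Gm: "G j \<in> borel_measurable (Pi\<^sub>M I (\<lambda>_. lborel))" if "j \<in> I" for j
    unfolding G_def using F[OF that] i by (intro iter_int_measurable borel_measurable_power) auto
  have Gl: "(\<lambda>t. eroot m (G j (x(i := t)))) \<in> borel_measurable lborel" if "j \<in> I" for j
    by (intro measurable_compose[OF fun_upd_measurable_line[OF Gm[OF that] i(1)] eroot_measurable] Cons.prems)
  have Gi: "G i (x(i := t)) = G i x" for t
    unfolding G_def using i(2) indep[OF i(1)] by (intro iter_int_indep) auto
  have cardI: "card (I - {i}) = m" "finite (I - {i})" using I i by auto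
  have step: "iter_int js (\<lambda>x. \<Prod>j\<in>I. F j x) (x(i := t)) \<le> (\<Prod>j\<in>I. eroot m (G j (x(i := t))))" for t
    unfolding G_def using Cons.prems i by (intro Cons.IH) (auto simp: space_PiM PiE_def extensional_def)
  have "iter_int (i # js) (\<lambda>x. \<Prod>j\<in>I. F j x) x
      \<le> (\<integral>\<^sup>+t. eroot m (G i x) * (\<Prod>j\<in>I-{i}. eroot m (G j (x(i := t)))) \<partial>lborel)"
    unfolding iter_int_simps int_along_def
    using step I i by (intro nn_integral_mono) (simp add: prod.remove[of I i] Gi)
  also have "\<dots> = eroot m (G i x) * (\<integral>\<^sup>+t. (\<Prod>j\<in>I-{i}. eroot m (G j (x(i := t)))) \<partial>lborel)"
    using Gl by (intro nn_integral_cmult borel_measurable_prod_ennreal) auto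
  also have "\<dots> \<le> eroot m (G i x) * (\<Prod>j\<in>I-{i}. eroot m (\<integral>\<^sup>+t. G j (x(i := t)) \<partial>lborel))"
  proof (intro mult_left_mono)
    have "(\<integral>\<^sup>+t. (\<Prod>j\<in>I-{i}. eroot m (G j (x(i := t)))) \<partial>lborel) ^ m
        \<le> (\<Prod>j\<in>I-{i}. \<integral>\<^sup>+t. eroot m (G j (x(i := t))) ^ m \<partial>lborel)"
      using Gl by (intro nn_integral_prod_Holder cardI I) auto
    also have "\<dots> = (\<Prod>j\<in>I-{i}. eroot m (\<integral>\<^sup>+t. G j (x(i := t)) \<partial>lborel)) ^ m"
      using I by (simp add: eroot_power prod_power_distrib)
    finally show "(\<integral>\<^sup>+t. (\<Prod>j\<in>I-{i}. eroot m (G j (x(i := t)))) \<partial>lborel)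
        \<le> (\<Prod>j\<in>I-{i}. eroot m (\<integral>\<^sup>+t. G j (x(i := t)) \<partial>lborel))"
      using I by (simp add: power_mono_iff_ennreal)
  qed simp
  also have "\<dots> = (\<Prod>j\<in>I. eroot m (iter_int (removeAll j (i # js)) (\<lambda>x. F j x ^ m) x))"
    using I(1) i(1,2) by (auto simp: prod.remove[of I i] G_def int_along_def
      intro!: arg_cong2[where f = "(*)"] prod.cong)
  finally show ?case .
qed

text \<open>In the usual form the j-th factor is a function of the other coordinates. Here it is
  produced from \<open>g j\<close> by integrating along j, so that its m-th power, integrated over
  the other coordinates, is the full integral of \<open>g j\<close>.\<close>

theorem Loomis_Whitney:
  fixes g :: "'i \<Rightarrow> ('i \<Rightarrow> real) \<Rightarrow> ennreal"
  assumes I: "finite I" "card I = Suc m" "0 < m"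
    and g: "\<And>j. j \<in> I \<Longrightarrow> g j \<in> borel_measurable (Pi\<^sub>M I (\<lambda>_. lborel))"
  shows "(\<integral>\<^sup>+x. (\<Prod>j\<in>I. eroot m (int_along j (g j) x)) \<partial>Pi\<^sub>M I (\<lambda>_. lborel)) ^ m
    \<le> (\<Prod>j\<in>I. \<integral>\<^sup>+x. g j x \<partial>Pi\<^sub>M I (\<lambda>_. lborel))"
proof -
  define F where "F j x = eroot m (int_along j (g j) x)" for j x
  obtain ks where ks: "distinct ks" "set ks = I" using finite_distinct_list[OF I(1)] by blast
  \<comment> \<open>Any base point will do, since all coordinates get integrated; the restriction to
    I puts it into the product space.\<close>
  define x where "x = (\<lambda>i\<in>I. 0 :: real)"
  have x: "x \<in> space (Pi\<^sub>M I (\<lambda>_. lborel))" by (simp add: x_def space_PiM)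
  have F: "F j \<in> borel_measurable (Pi\<^sub>M I (\<lambda>_. lborel))" if "j \<in> I" for j
    unfolding F_def by (intro measurable_compose[OF int_along_measurable eroot_measurable] g that)
  have indep: "F j (x(j := t)) = F j x" for j x t by (simp add: F_def int_along_def)
  have "(\<integral>\<^sup>+x. (\<Prod>j\<in>I. F j x) \<partial>Pi\<^sub>M I (\<lambda>_. lborel)) = iter_int ks (\<lambda>x. \<Prod>j\<in>I. F j x) x"
    using F by (intro iter_int_full[symmetric] ks x borel_measurable_prod_ennreal)
  also have "\<dots> \<le> (\<Prod>j\<in>I. eroot m (iter_int (removeAll j ks) (\<lambda>x. F j x ^ m) x))"
    using ks x F indep by (intro iter_int_prod_le I) auto
  also have "\<dots> = (\<Prod>j\<in>I. eroot m (\<integral>\<^sup>+x. g j x \<partial>Pi\<^sub>M I (\<lambda>_. lborel)))"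
  proof (intro prod.cong refl arg_cong[of _ _ "eroot m"])
    fix j assume "j \<in> I"
    \<comment> \<open>The missing coordinate j is restored by the integral inside
      \<open>F j\<close>, which becomes the innermost one.\<close>
    have "iter_int (removeAll j ks) (\<lambda>x. F j x ^ m) x = iter_int (removeAll j ks @ [j]) (g j) x"
      using I by (simp add: F_def eroot_power)
    also have "\<dots> = (\<integral>\<^sup>+x. g j x \<partial>Pi\<^sub>M I (\<lambda>_. lborel))"
      using ks \<open>j \<in> I\<close> by (intro iter_int_full x g) (auto simp: distinct_removeAll)
    finally show "iter_int (removeAll j ks) (\<lambda>x. F j x ^ m) x = (\<integral>\<^sup>+x. g j x \<partial>Pi\<^sub>M I (\<lambda>_. lborel))" .
  qed
  finally have "(\<integral>\<^sup>+x. (\<Prod>j\<in>I. F j x) \<partial>Pi\<^sub>M I (\<lambda>_. lborel)) ^ m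
      \<le> (\<Prod>j\<in>I. eroot m (\<integral>\<^sup>+x. g j x \<partial>Pi\<^sub>M I (\<lambda>_. lborel))) ^ m"
    by (intro power_mono) auto
  also have "\<dots> = (\<Prod>j\<in>I. \<integral>\<^sup>+x. g j x \<partial>Pi\<^sub>M I (\<lambda>_. lborel))"
    using I by (simp add: prod_power_distrib eroot_power)
  finally show ?thesis by (simp add: F_def)
qed

section \<open>The Sobolev embedding\<close>

lemma abs_powr_has_derivative:
  fixes p s :: real
  assumes "1 < p"
  shows "((\<lambda>s. \<bar>s\<bar> powr p) has_real_derivative p * (\<bar>s\<bar> powr (p - 2) * s)) (at s)"
proof -
  consider "s > 0" | "s < 0" | "s = 0" by linarith
  then show ?thesis
  proof cases
    case 1
    have "((\<lambda>s. s powr p) has_real_derivative p * s powr (p - 1)) (at s)"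
      by (rule has_real_derivative_powr[OF 1])
    moreover have "\<forall>\<^sub>F s in nhds s. s powr p = \<bar>s\<bar> powr p"
      using eventually_nhds_in_open[of "{0<..}" s] 1 by (auto elim!: eventually_mono)
    moreover have "s powr (p - 1) = \<bar>s\<bar> powr (p - 2) * s"
      using 1 powr_add[of s "p - 2" 1] by simp
    ultimately show ?thesis using DERIV_cong_ev[OF refl _ refl] by fastforce
  next
    case 2
    have "((\<lambda>s. (- s) powr p) has_real_derivative p * (- s) powr (p - 1) * (- 1)) (at s)"
      using 2 by (intro DERIV_chain'[OF _ has_real_derivative_powr] derivative_eq_intros) auto
    moreover have "\<forall>\<^sub>F s in nhds s. (- s) powr p = \<bar>s\<bar> powr p"
      using eventually_nhds_in_open[of "{..<0}" s] 2 by (auto elim!: eventually_mono)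
    moreover have "p * (- s) powr (p - 1) * (- 1) = p * (\<bar>s\<bar> powr (p - 2) * s)"
      using 2 powr_add[of "- s" "p - 2" 1] by simp
    ultimately show ?thesis using DERIV_cong_ev[OF refl _ refl] by fastforce
  next
    case 3
    \<comment> \<open>For p < 2 the factor |s|^(p-2) is unbounded near 0. The formula still holds at
      0, where its value is 0, because the difference quotient is at most |h|^(p-1).\<close>
    have "(\<lambda>h. \<bar>h\<bar> powr p / h) \<midarrow>0\<rightarrow> 0"
    proof (rule Lim_null_comparison)
      have "norm (\<bar>h\<bar> powr p / h) \<le> \<bar>h\<bar> powr (p - 1)" for h :: real
        using powr_add[of "\<bar>h\<bar>" "p - 1" 1] by (cases "h = 0") (auto simp: abs_mult)
      then show "\<forall>\<^sub>F h in at 0. norm (\<bar>h\<bar> powr p / h) \<le> \<bar>h\<bar> powr (p - 1)" by simp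
      have "((\<lambda>h::real. \<bar>h\<bar> powr (p - 1)) \<longlongrightarrow> \<bar>0\<bar> powr (p - 1)) (at 0)"
        using assms by (intro tendsto_intros) auto
      then show "((\<lambda>h::real. \<bar>h\<bar> powr (p - 1)) \<longlongrightarrow> 0) (at 0)" by simp
    qed
    then show ?thesis using 3 by (simp add: DERIV_def)
  qed
qed

lemma abs_powr_mult_eq: "\<bar>s\<bar> powr (p - 2) * s = sgn s * \<bar>s\<bar> powr (p - 1)" for s p :: real
  using powr_add[of "\<bar>s\<bar>" "p - 2" 1]
  by (cases "s = 0") (auto simp: sgn_if)

lemma isCont_abs_powr_mult:
  fixes p :: real
  assumes "1 < p"
  shows "isCont (\<lambda>s. \<bar>s\<bar> powr (p - 2) * s) s"
proof (cases "s = 0")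
  case True
  have "(\<lambda>s::real. \<bar>s\<bar> powr (p - 2) * s) \<midarrow>0\<rightarrow> 0"
  proof (rule Lim_null_comparison)
    show "\<forall>\<^sub>F s in at 0. norm (\<bar>s\<bar> powr (p - 2) * s) \<le> \<bar>s\<bar> powr (p - 1)"
      by (auto simp: abs_powr_mult_eq abs_mult sgn_if)
    have "((\<lambda>h::real. \<bar>h\<bar> powr (p - 1)) \<longlongrightarrow> \<bar>0\<bar> powr (p - 1)) (at 0)"
      using assms by (intro tendsto_intros) auto
    then show "((\<lambda>h::real. \<bar>h\<bar> powr (p - 1)) \<longlongrightarrow> 0) (at 0)" by simp
  qed
  then show ?thesis using True by (simp add: isCont_def)
next
  case False
  then show ?thesis by (intro continuous_intros) auto
qed

lemma abs_powr_mult_mono: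
  fixes p x y :: real
  assumes "1 < p" "x \<le> y"
  shows "\<bar>x\<bar> powr (p - 2) * x \<le> \<bar>y\<bar> powr (p - 2) * y"
proof -
  consider "0 \<le> x" | "x < 0" "0 < y" | "y \<le> 0" "x < 0" using assms by linarith
  then show ?thesis
  proof cases
    case 1
    then show ?thesis unfolding abs_powr_mult_eq using assms
      by (cases "x = 0") (auto simp: sgn_if intro!: powr_mono2)
  next
    case 2
    then have "\<bar>x\<bar> powr (p - 2) * x \<le> 0" "0 \<le> \<bar>y\<bar> powr (p - 2) * y"
      by (auto simp: mult_nonneg_nonpos)
    then show ?thesis by linarith
  next
    case 3
    then show ?thesis unfolding abs_powr_mult_eq using assms
      by (cases "y = 0") (auto simp: sgn_if intro!: powr_mono2)
  qed
qed

lemma convex_abs_powr: "1 < p \<Longrightarrow> convex_on UNIV (\<lambda>s::real. \<bar>s\<bar> powr p)"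
  by (rule convex_on_realI[where f' = "\<lambda>s. p * (\<bar>s\<bar> powr (p - 2) * s)"])
    (auto intro: abs_powr_has_derivative abs_powr_mult_mono)

text \<open>Applied later with the perturbed point as c, which bounds the increment of the power
  from above instead of from below.\<close>

lemma abs_powr_above_tangent:
  fixes p c x :: real
  assumes "1 < p"
  shows "p * (\<bar>c\<bar> powr (p - 2) * c) * (x - c) \<le> \<bar>x\<bar> powr p - \<bar>c\<bar> powr p"
  by (rule convex_on_imp_above_tangent[OF convex_abs_powr[OF assms]])
    (auto intro: abs_powr_has_derivative[OF assms])

section \<open>The Sobolev inequality for test functions\<close>

lemma smooth_on_has_derivative_line:
  assumes "smooth_on UNIV \<phi>"
  shows "((\<lambda>t. \<phi> (x + t *\<^sub>R axis i 1)) has_real_derivative partial i \<phi> (x + s *\<^sub>R axis i 1)) (at s)"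
proof -
  have "(\<lambda>t. \<phi> ((x + s *\<^sub>R axis i 1) + t *\<^sub>R axis i 1)) = (\<lambda>t. \<phi> (x + (t + s) *\<^sub>R axis i 1))"
    by (simp add: algebra_simps)
  then have "((\<lambda>t. \<phi> (x + (t + s) *\<^sub>R axis i 1)) has_real_derivative partial i \<phi> (x + s *\<^sub>R axis i 1)) (at 0)"
    using smooth_on_has_derivative[OF assms, of "x + s *\<^sub>R axis i 1" i] by simp
  then show ?thesis
    using DERIV_shift[of "\<lambda>t. \<phi> (x + t *\<^sub>R axis i 1)" "partial i \<phi> (x + s *\<^sub>R axis i 1)" 0 s] by simp
qed

text \<open>Fundamental theorem of calculus along a line that starts outside the support. The right
  side runs over the whole line and so does not depend on the b-coordinate of x; this is the form
  that \<open>int_along\<close> produces.\<close>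

lemma test_fun_le_line_integral:
  fixes \<phi> :: "real^'n::finite \<Rightarrow> real"
  assumes \<phi>: "test_fun \<Omega> \<phi>" and \<gamma>: "1 < \<gamma>" and b: "b \<in> Basis"
  shows "ennreal (\<bar>\<phi> x\<bar> powr \<gamma>) \<le>
    (\<integral>\<^sup>+t. ennreal (\<gamma> * \<bar>\<phi> (x + (t - x \<bullet> b) *\<^sub>R b)\<bar> powr (\<gamma> - 1) * norm (grad \<phi> (x + (t - x \<bullet> b) *\<^sub>R b))) \<partial>lborel)"
proof -
  obtain i where i: "b = axis i 1" using b by (auto simp: Basis_vec_def)
  let ?K = "closure {x. \<phi> x \<noteq> 0}"
  have "compact ?K" using \<phi> by (simp add: test_fun_def)
  then obtain R where R: "\<And>x. x \<in> ?K \<Longrightarrow> norm x \<le> R" by (meson bounded_iff compact_imp_bounded)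
  \<comment> \<open>Parametrised so that \<open>l t\<close> has b-coordinate t and the line passes
    through x at t = x \<bullet> b.\<close>
  define l where "l t = x + (t - x \<bullet> b) *\<^sub>R b" for t
  have lb: "l t \<bullet> b = t" for t using b by (simp add: l_def inner_add_left inner_Basis)
  have l_eq: "l t = (x - (x \<bullet> b) *\<^sub>R b) + t *\<^sub>R axis i 1" for t by (simp add: l_def i algebra_simps)
  have zero: "\<phi> (l t) = 0" if "\<bar>t\<bar> > R" for t
  proof (rule ccontr)
    assume "\<phi> (l t) \<noteq> 0"
    then have "norm (l t) \<le> R" using R closure_subset[of "{x. \<phi> x \<noteq> 0}"] by blast
    then show False using Basis_le_norm[OF b, of "l t"] lb that by simp
  qed
  define F where "F t = \<bar>\<phi> (l t)\<bar> powr \<gamma>" for t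
  define f where "f t = \<gamma> * (\<bar>\<phi> (l t)\<bar> powr (\<gamma> - 2) * \<phi> (l t)) * partial i \<phi> (l t)" for t
  have l_cont: "isCont l t" for t unfolding l_def by (intro continuous_intros)
  have cont: "isCont (\<lambda>t. \<psi> (l t)) t" if "test_fun \<Omega> \<psi>" for \<psi> t
    using test_fun_continuous[OF that, of UNIV] l_cont
    by (intro isCont_o2[OF l_cont]) (auto simp: continuous_on_eq_continuous_at)
  have F: "(F has_real_derivative f t) (at t)" for t
    unfolding F_def f_def
    by (rule DERIV_chain'[OF _ abs_powr_has_derivative[OF \<gamma>], THEN DERIV_cong])
      (use smooth_on_has_derivative_line[OF test_fun_smooth[OF \<phi>]] in \<open>auto simp: l_eq\<close>)
  have f: "isCont f t" for t
    unfolding f_def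
    by (intro isCont_mult continuous_const cont[OF test_fun_partial[OF \<phi>]]
        isCont_o2[OF cont[OF \<phi>] isCont_abs_powr_mult[OF \<gamma>]])
  \<comment> \<open>The start must lie outside the support and not beyond x, whence the minimum. If
    x itself lies below -R-1, then \<phi> x = 0 and the interval degenerates to a point.\<close>
  define c where "c = min (- R - 1) (x \<bullet> b)"
  have "F c = 0 \<or> c = x \<bullet> b \<and> \<phi> x = 0"
  proof (cases "x \<bullet> b < - R - 1")
    case True
    then show ?thesis using zero[of "x \<bullet> b"] by (auto simp: c_def l_def F_def)
  next
    case False
    then have "c = - R - 1" by (simp add: c_def)
    then show ?thesis using zero[of c] by (auto simp: F_def abs_if)
  qed
  then have Fc: "F c = 0" by (auto simp: F_def l_def)
  have FTC: "has_bochner_integral lborel (\<lambda>t. f t * indicator {c..x \<bullet> b} t) (F (x \<bullet> b) - F c)"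
    by (rule has_bochner_integral_FTC_Icc_real[OF _ F f]) (simp add: c_def)
  have "ennreal (\<bar>\<phi> x\<bar> powr \<gamma>) = ennreal (norm (integral\<^sup>L lborel (\<lambda>t. f t * indicator {c..x \<bullet> b} t)))"
    using has_bochner_integral_integral_eq[OF FTC] Fc by (simp add: F_def l_def)
  also have "\<dots> \<le> (\<integral>\<^sup>+t. ennreal (norm (f t * indicator {c..x \<bullet> b} t)) \<partial>lborel)"
    by (rule integral_norm_bound_ennreal) (use FTC in \<open>auto simp: has_bochner_integral_iff\<close>)
  also have "\<dots> \<le> (\<integral>\<^sup>+t. ennreal (\<gamma> * \<bar>\<phi> (l t)\<bar> powr (\<gamma> - 1) * norm (grad \<phi> (l t))) \<partial>lborel)"
  proof (intro nn_integral_mono ennreal_leI)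
    fix t
    have "norm (f t * indicator {c..x \<bullet> b} t) \<le> \<bar>f t\<bar>" by (simp add: abs_mult indicator_def)
    also have "\<dots> = \<gamma> * \<bar>\<phi> (l t)\<bar> powr (\<gamma> - 1) * \<bar>partial i \<phi> (l t)\<bar>"
      using \<gamma> unfolding f_def abs_powr_mult_eq by (simp add: abs_mult sgn_if)
    also have "\<dots> \<le> \<gamma> * \<bar>\<phi> (l t)\<bar> powr (\<gamma> - 1) * norm (grad \<phi> (l t))"
      using component_le_norm_cart[of "grad \<phi> (l t)" i] \<gamma> by (intro mult_left_mono) auto
    finally show "norm (f t * indicator {c..x \<bullet> b} t) \<le> \<gamma> * \<bar>\<phi> (l t)\<bar> powr (\<gamma> - 1) * norm (grad \<phi> (l t))" .
  qed
  finally show ?thesis by (simp add: l_def)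
qed

lemma nn_integral_lborel_coords:
  fixes h :: "'a::euclidean_space \<Rightarrow> ennreal"
  assumes [measurable]: "h \<in> borel_measurable borel"
  shows "(\<integral>\<^sup>+x. h x \<partial>lborel) = (\<integral>\<^sup>+y. h (\<Sum>b\<in>Basis. y b *\<^sub>R b) \<partial>Pi\<^sub>M Basis (\<lambda>_. lborel))"
proof -
  have "(\<integral>\<^sup>+x. h x \<partial>lborel) = (\<integral>\<^sup>+x. h x \<partial>distr (Pi\<^sub>M Basis (\<lambda>_. lborel)) borel (\<lambda>f. \<Sum>b\<in>Basis. f b *\<^sub>R b))"
    by (subst lborel_eq) (rule refl)
  also have "\<dots> = (\<integral>\<^sup>+y. h (\<Sum>b\<in>Basis. y b *\<^sub>R b) \<partial>Pi\<^sub>M Basis (\<lambda>_. lborel))"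
    by (rule nn_integral_distr) measurable
  finally show ?thesis .
qed

text \<open>Gagliardo's argument: every coordinate direction bounds \<open>\<bar>\<phi>\<bar> powr \<gamma>\<close> by a line integral, and the
  Loomis-Whitney inequality multiplies these bounds.\<close>

lemma test_fun_Gagliardo:
  fixes \<phi> :: "real^'n::finite \<Rightarrow> real" and \<gamma> :: real
  assumes \<phi>: "test_fun \<Omega> \<phi>" and \<gamma>: "1 < \<gamma>" and n: "CARD('n) = Suc m" "0 < m"
  shows "(\<integral>\<^sup>+x. ennreal (\<bar>\<phi> x\<bar> powr (\<gamma> * CARD('n) / m)) \<partial>lborel) ^ m
    \<le> (\<integral>\<^sup>+x. ennreal (\<gamma> * \<bar>\<phi> x\<bar> powr (\<gamma> - 1) * norm (grad \<phi> x)) \<partial>lborel) ^ CARD('n)"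
proof -
  let ?B = "Basis :: (real^'n) set"
  let ?P = "Pi\<^sub>M ?B (\<lambda>_. lborel :: real measure)"
  define S where "S y = (\<Sum>b\<in>?B. y b *\<^sub>R b)" for y
  define g where "g x = ennreal (\<gamma> * \<bar>\<phi> x\<bar> powr (\<gamma> - 1) * norm (grad \<phi> x))" for x
  note [measurable] = test_fun_borel[OF \<phi>] grad_test_fun_measurable[OF \<phi>]
  have [measurable]: "g \<in> borel_measurable borel" unfolding g_def by measurable
  have [measurable]: "S \<in> borel_measurable ?P" unfolding S_def by measurable
  have card: "card ?B = Suc m" using n by simp
  have Sb: "S y \<bullet> b = y b" if "b \<in> ?B" for y b
    using that by (simp add: S_def inner_sum_left inner_Basis if_distrib cong: if_cong)
  \<comment> \<open>Changing coordinate b of y moves \<open>S y\<close> along the line of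
    \<open>test_fun_le_line_integral\<close>, so that line integral is literally an
    \<open>int_along b\<close>.\<close>
  have S_upd: "S (y(b := t)) = S y + (t - S y \<bullet> b) *\<^sub>R b" if "b \<in> ?B" for y b t
  proof -
    have "S (y(b := t)) = t *\<^sub>R b + (\<Sum>c\<in>?B-{b}. y c *\<^sub>R c)"
      using that by (simp add: S_def sum.remove[of ?B b])
    moreover have "S y = y b *\<^sub>R b + (\<Sum>c\<in>?B-{b}. y c *\<^sub>R c)"
      using that by (simp add: S_def sum.remove[of ?B b])
    ultimately show ?thesis unfolding Sb[OF that] by (simp add: algebra_simps)
  qed
  have point: "ennreal (\<bar>\<phi> (S y)\<bar> powr (\<gamma> * CARD('n) / m)) \<le> (\<Prod>b\<in>?B. eroot m (int_along b (\<lambda>y. g (S y)) y))" for y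
  proof -
    have r: "eroot m (ennreal (r powr \<gamma>)) = ennreal (r powr (\<gamma> / m))" if "0 \<le> r" for r
    proof -
      have "ennreal (r powr \<gamma>) = ennreal (r powr (\<gamma> / m)) ^ m"
        using n powr_realpow'[of "r powr (\<gamma> / m)" m] by (simp add: ennreal_power powr_powr)
      then show ?thesis using n by (simp add: eroot_power')
    qed
    \<comment> \<open>There are n = m + 1 basis vectors, and each contributes the m-th root of the
      bound for |\<phi>|^\<gamma>; together they give the exponent \<gamma> n / m.\<close>
    have "ennreal (\<bar>\<phi> (S y)\<bar> powr (\<gamma> * CARD('n) / m)) = ennreal (\<bar>\<phi> (S y)\<bar> powr (\<gamma> / m)) ^ CARD('n)"
      using powr_realpow'[of "\<bar>\<phi> (S y)\<bar> powr (\<gamma> / m)" "CARD('n)"] by (simp add: ennreal_power powr_powr)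
    also have "\<dots> = (\<Prod>b\<in>?B. eroot m (ennreal (\<bar>\<phi> (S y)\<bar> powr \<gamma>)))"
      by (simp add: r)
    also have "\<dots> \<le> (\<Prod>b\<in>?B. eroot m (int_along b (\<lambda>y. g (S y)) y))"
    proof (intro prod_mono_ennreal eroot_mono n)
      fix b assume b: "b \<in> ?B"
      show "ennreal (\<bar>\<phi> (S y)\<bar> powr \<gamma>) \<le> int_along b (\<lambda>y. g (S y)) y"
        using test_fun_le_line_integral[OF \<phi> \<gamma> b, of "S y"] by (simp add: int_along_def S_upd[OF b] g_def)
    qed
    finally show ?thesis .
  qed
  have "(\<integral>\<^sup>+x. ennreal (\<bar>\<phi> x\<bar> powr (\<gamma> * CARD('n) / m)) \<partial>lborel) ^ m
      = (\<integral>\<^sup>+y. ennreal (\<bar>\<phi> (S y)\<bar> powr (\<gamma> * CARD('n) / m)) \<partial>?P) ^ m"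
    unfolding S_def by (subst nn_integral_lborel_coords) simp_all
  also have "\<dots> \<le> (\<integral>\<^sup>+y. (\<Prod>b\<in>?B. eroot m (int_along b (\<lambda>y. g (S y)) y)) \<partial>?P) ^ m"
    by (intro power_mono nn_integral_mono point) simp
  also have "\<dots> \<le> (\<Prod>b\<in>?B. \<integral>\<^sup>+y. g (S y) \<partial>?P)"
    by (rule Loomis_Whitney[OF finite_Basis card n(2)]) measurable
  also have "\<dots> = (\<integral>\<^sup>+x. g x \<partial>lborel) ^ CARD('n)"
    unfolding S_def by (subst nn_integral_lborel_coords) simp_all
  finally show ?thesis by (simp add: g_def)
qed

text \<open>\<gamma> is chosen so that \<gamma> n/(n-1) and 2(\<gamma>-1) both equal q. With A the
  integral of |\<phi>|^q, Gagliardo's estimate and Cauchy-Schwarz then involve only A and the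
  gradient norm D. The form 1 + (\<gamma> D)^(2n) avoids roots; what is wanted is a bound that is
  uniform along an approximating sequence.\<close>

lemma test_fun_Sobolev:
  fixes \<phi> :: "real^'n::finite \<Rightarrow> real"
  assumes \<phi>: "test_fun \<Omega> \<phi>" and n: "CARD('n) \<ge> 3"
    and q: "q = 2 * real CARD('n) / (real CARD('n) - 2)"
    and \<gamma>: "\<gamma> = 2 * (real CARD('n) - 1) / (real CARD('n) - 2)"
  shows "integral\<^sup>L lborel (\<lambda>x. \<bar>\<phi> x\<bar> powr q) \<le> 1 + (\<gamma> * l2n lborel (grad \<phi>)) ^ (2 * CARD('n))"
proof -
  define N where "N = CARD('n)"
  obtain m where m: "N = Suc m" using n by (cases N) (auto simp: N_def)
  have m2: "2 \<le> m" using m n by (simp add: N_def)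
  have \<gamma>1: "1 < \<gamma>" using n by (simp add: \<gamma> field_simps)
  have q_eq: "q = \<gamma> * real N / real m" using m2 m by (simp add: q \<gamma> N_def[symmetric] field_simps)
  have q_eq2: "q = 2 * (\<gamma> - 1)" using n by (simp add: q \<gamma> field_simps)
  have q0: "0 < q" using \<gamma>1 q_eq2 by simp
  define K where "K = closure {x. \<phi> x \<noteq> 0}"
  have K: "compact K" using \<phi> by (simp add: test_fun_def K_def)
  have \<phi>0: "\<phi> x = 0" if "x \<notin> K" for x
    using that closure_subset[of "{x. \<phi> x \<noteq> 0}"] unfolding K_def by blast
  have grad0: "grad \<phi> x = 0" if "x \<notin> K" for x
    using partial_eq_0_outside[OF that[unfolded K_def]] by (simp add: vec_eq_iff)
  note [measurable] = test_fun_borel[OF \<phi>] grad_test_fun_measurable[OF \<phi>]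
  have cont_grad: "continuous_on UNIV (grad \<phi>)"
    unfolding grad_def[abs_def]
    by (intro continuous_on_vec_lambda test_fun_continuous[OF test_fun_partial[OF \<phi>]])
  have cont_pow: "continuous_on UNIV (\<lambda>x. \<bar>\<phi> x\<bar> powr r)" if "0 < r" for r
    using that by (intro continuous_on_powr' continuous_intros test_fun_continuous[OF \<phi>]) auto
  have int_q: "integrable lborel (\<lambda>x. \<bar>\<phi> x\<bar> powr q)"
    by (intro integrable_continuous_compact_support[OF cont_pow K]) (simp_all add: \<phi>0 q0)
  define A where "A = integral\<^sup>L lborel (\<lambda>x. \<bar>\<phi> x\<bar> powr q)"
  define D where "D = l2n lborel (grad \<phi>)"
  have A0: "0 \<le> A" by (simp add: A_def)
  have sq_grad: "sqint lborel (grad \<phi>)"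
    unfolding sqint_def
    by (intro conjI integrable_continuous_compact_support[OF _ K] continuous_intros cont_grad) (simp_all add: grad0)
  have pow_sq: "(norm (\<bar>\<phi> x\<bar> powr (\<gamma> - 1)))\<^sup>2 = \<bar>\<phi> x\<bar> powr q" for x
    using powr_add[of "\<bar>\<phi> x\<bar>" "\<gamma> - 1" "\<gamma> - 1"] by (simp add: q_eq2 power2_eq_square)
  have sq_pow: "sqint lborel (\<lambda>x. \<bar>\<phi> x\<bar> powr (\<gamma> - 1))"
    unfolding sqint_def pow_sq using int_q by simp
  have l2_pow: "l2n lborel (\<lambda>x. \<bar>\<phi> x\<bar> powr (\<gamma> - 1)) = sqrt A"
    unfolding l2n_def pow_sq A_def ..
  have sq_norm: "sqint lborel (\<lambda>x. norm (grad \<phi> x))" "l2n lborel (\<lambda>x. norm (grad \<phi> x)) = D"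
    using sq_grad by (simp_all add: sqint_def l2n_def D_def)
  have int_g: "integrable lborel (\<lambda>x. \<bar>\<phi> x\<bar> powr (\<gamma> - 1) * norm (grad \<phi> x))"
    using sqint_inner_integrable[OF sq_pow sq_norm(1)] by simp
  have g_le: "integral\<^sup>L lborel (\<lambda>x. \<bar>\<phi> x\<bar> powr (\<gamma> - 1) * norm (grad \<phi> x)) \<le> sqrt A * D"
    using l2_Cauchy_Schwarz[OF sq_pow sq_norm(1)] by (simp add: l2_pow sq_norm(2))
  have "ennreal (A ^ m) = (\<integral>\<^sup>+x. ennreal (\<bar>\<phi> x\<bar> powr q) \<partial>lborel) ^ m"
    using A0 int_q by (simp add: A_def nn_integral_eq_integral ennreal_power)
  also have "\<dots> \<le> (\<integral>\<^sup>+x. ennreal (\<gamma> * \<bar>\<phi> x\<bar> powr (\<gamma> - 1) * norm (grad \<phi> x)) \<partial>lborel) ^ N"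
    using test_fun_Gagliardo[OF \<phi> \<gamma>1, of m] m m2 by (simp add: q_eq N_def)
  also have "(\<integral>\<^sup>+x. ennreal (\<gamma> * \<bar>\<phi> x\<bar> powr (\<gamma> - 1) * norm (grad \<phi> x)) \<partial>lborel)
      = ennreal (\<gamma> * integral\<^sup>L lborel (\<lambda>x. \<bar>\<phi> x\<bar> powr (\<gamma> - 1) * norm (grad \<phi> x)))"
    using \<gamma>1 int_g by (subst nn_integral_eq_integral) (auto simp: mult.assoc)
  also have "\<dots> \<le> ennreal (\<gamma> * (sqrt A * D))"
    using \<gamma>1 g_le by (intro ennreal_leI mult_left_mono) auto
  finally have "ennreal (A ^ m) \<le> ennreal (\<gamma> * (sqrt A * D)) ^ N" by (simp add: power_mono)
  also have "\<dots> = ennreal ((\<gamma> * (sqrt A * D)) ^ N)"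
    using \<gamma>1 A0 by (intro ennreal_power) (simp add: D_def)
  finally have "A ^ m \<le> (\<gamma> * (sqrt A * D)) ^ N"
    using \<gamma>1 A0 by (simp add: D_def)
  \<comment> \<open>Squaring removes the square root of A left by Cauchy-Schwarz.\<close>
  then have "(A ^ m)\<^sup>2 \<le> ((\<gamma> * (sqrt A * D)) ^ N)\<^sup>2" using A0 by (intro power_mono) auto
  also have "((\<gamma> * (sqrt A * D)) ^ N)\<^sup>2 = (\<gamma> * D) ^ (2 * N) * A ^ N"
  proof -
    have "(\<gamma> * (sqrt A * D))\<^sup>2 = (\<gamma> * D)\<^sup>2 * (sqrt A)\<^sup>2"
      by (simp only: power_mult_distrib mult_ac)
    then have "(\<gamma> * (sqrt A * D))\<^sup>2 = (\<gamma> * D)\<^sup>2 * A" using A0 by simp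
    then have "((\<gamma> * (sqrt A * D))\<^sup>2) ^ N = ((\<gamma> * D)\<^sup>2) ^ N * A ^ N"
      by (simp only: power_mult_distrib)
    then show ?thesis by (simp only: power_mult[symmetric] mult.commute)
  qed
  finally have main: "A ^ (2 * m) \<le> (\<gamma> * D) ^ (2 * N) * A ^ N"
    by (simp only: power_mult[symmetric] mult.commute)
  have "A \<le> 1 + (\<gamma> * D) ^ (2 * N)"
  proof (cases "A \<le> 1")
    case True
    have "0 \<le> (\<gamma> * D) ^ (2 * N)" using \<gamma>1 by (simp add: D_def)
    then show ?thesis using True by linarith
  next
    case False
    then have "0 < A ^ N" by simp
    \<comment> \<open>After cancelling A^N the power A^(m-1) = A^(n-2) remains; n \<ge> 3 makes its
      exponent at least 1, so it dominates A when A > 1.\<close>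
    have "2 * m = (m - 1) + N" using m m2 by simp
    then have "A ^ (2 * m) = A ^ (m - 1) * A ^ N" by (simp only: power_add)
    with main have "A ^ (m - 1) * A ^ N \<le> (\<gamma> * D) ^ (2 * N) * A ^ N" by simp
    then have "A ^ (m - 1) \<le> (\<gamma> * D) ^ (2 * N)" using \<open>0 < A ^ N\<close> by simp
    moreover have "A \<le> A ^ (m - 1)" using False m2 by (intro self_le_power) auto
    ultimately show ?thesis by linarith
  qed
  then show ?thesis by (simp add: A_def D_def N_def)
qed

context bounded_open_set begin

text \<open>Test functions approximating u have gradients bounded in L2, so the Sobolev bound is
  uniform along them and Fatou's lemma passes it on to u. Exponents below the critical q are covered
  by |u|^p \<le> 1 + |u|^q on a set of finite measure.\<close>

lemma H10_Sobolev_integrable: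
  assumes n: "CARD('n) \<ge> 3" and u: "H10 \<Omega> u" and p: "0 < p" "p \<le> 2 * real CARD('n) / (real CARD('n) - 2)"
  shows "integrable M (\<lambda>x. \<bar>u x\<bar> powr p)"
proof -
  define q where "q = 2 * real CARD('n) / (real CARD('n) - 2)"
  define \<gamma> where "\<gamma> = 2 * (real CARD('n) - 1) / (real CARD('n) - 2)"
  have \<gamma>0: "0 \<le> \<gamma>" using n by (simp add: \<gamma>_def)
  have q0: "0 < q" using p by (simp add: q_def)
  note [measurable] = sqint_measurable[OF H10_sqint[OF u]]
  from wgrad_H10[OF u] obtain \<phi> where \<phi>: "\<And>k::nat. test_fun \<Omega> (\<phi> k)"
    "(\<lambda>k. l2n M (\<lambda>x. \<phi> k x - u x)) \<longlonglongrightarrow> 0"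
    "(\<lambda>k. l2n M (\<lambda>x. grad (\<phi> k) x - wgrad \<Omega> u x)) \<longlonglongrightarrow> 0" by (rule H10_with_gradE) blast
  have "convergent (\<lambda>k. l2n M (grad (\<phi> k)))"
    using l2n_tendsto[OF sqint_grad_test[OF \<phi>(1)] wgrad_sqint[OF u] \<phi>(3)] by (auto simp: convergent_def)
  then obtain D where D: "\<And>k. l2n M (grad (\<phi> k)) \<le> D"
    using convergent_imp_Bseq Bseq_def by (metis abs_le_D1 real_norm_def)
  obtain r where r: "strict_mono r" "AE x in M. (\<lambda>k. \<phi> (r k) x) \<longlonglongrightarrow> u x"
    by (rule l2_AE_subseq[OF sqint_test[OF \<phi>(1)] H10_sqint[OF u] \<phi>(2)]) blast
  have out: "\<phi> k x = 0" "grad (\<phi> k) x = 0" if "x \<notin> \<Omega>" for k x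
  proof -
    have "x \<notin> closure {x. \<phi> k x \<noteq> 0}" using \<phi>(1)[of k] that by (auto simp: test_fun_def)
    then show "\<phi> k x = 0" "grad (\<phi> k) x = 0"
      using closure_subset[of "{x. \<phi> k x \<noteq> 0}"] partial_eq_0_outside[of x "\<phi> k"] by (auto simp: vec_eq_iff)
  qed
  note [measurable] = test_fun_borel[OF \<phi>(1)] grad_test_fun_measurable[OF \<phi>(1)]
  have int: "integrable M (\<lambda>x. \<bar>\<phi> k x\<bar> powr q)"
    and bound: "integral\<^sup>L M (\<lambda>x. \<bar>\<phi> k x\<bar> powr q) \<le> 1 + (\<gamma> * D) ^ (2 * CARD('n))" for k
  proof -
    define K where "K = closure {x. \<phi> k x \<noteq> 0}"
    have K: "compact K" using \<phi>(1)[of k] by (simp add: test_fun_def K_def)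
    have \<phi>0: "\<phi> k x = 0" if "x \<notin> K" for x
      using that closure_subset[of "{x. \<phi> k x \<noteq> 0}"] unfolding K_def by blast
    have "continuous_on UNIV (\<lambda>x. \<bar>\<phi> k x\<bar> powr q)"
      using q0 by (intro continuous_on_powr' continuous_intros test_fun_continuous[OF \<phi>(1)]) auto
    then have "integrable lborel (\<lambda>x. \<bar>\<phi> k x\<bar> powr q)"
      by (rule integrable_continuous_compact_support[OF _ K])
        (simp add: \<phi>0)
    then show "integrable M (\<lambda>x. \<bar>\<phi> k x\<bar> powr q)"
      using out by (subst integral_lebesgue_on_eq_lborel(1)[OF open_\<Omega>]) auto
    have "integral\<^sup>L M (\<lambda>x. (norm (grad (\<phi> k) x))\<^sup>2) = integral\<^sup>L lborel (\<lambda>x. (norm (grad (\<phi> k) x))\<^sup>2)"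
      using out by (intro integral_lebesgue_on_eq_lborel(2)[OF open_\<Omega>]) auto
    then have D': "l2n lborel (grad (\<phi> k)) \<le> D" using D[of k] by (simp add: l2n_def)
    have "integral\<^sup>L M (\<lambda>x. \<bar>\<phi> k x\<bar> powr q) = integral\<^sup>L lborel (\<lambda>x. \<bar>\<phi> k x\<bar> powr q)"
      using out by (intro integral_lebesgue_on_eq_lborel(2)[OF open_\<Omega>]) auto
    also have "\<dots> \<le> 1 + (\<gamma> * l2n lborel (grad (\<phi> k))) ^ (2 * CARD('n))"
      by (rule test_fun_Sobolev[OF \<phi>(1) n q_def \<gamma>_def])
    also have "\<dots> \<le> 1 + (\<gamma> * D) ^ (2 * CARD('n))"
      using D' \<gamma>0 by (intro add_left_mono power_mono mult_left_mono) auto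
    finally show "integral\<^sup>L M (\<lambda>x. \<bar>\<phi> k x\<bar> powr q) \<le> 1 + (\<gamma> * D) ^ (2 * CARD('n))" .
  qed
  have "integrable M (\<lambda>x. \<bar>u x\<bar> powr q)"
  proof (rule fatou_real(1))
    show "AE x in M. (\<lambda>k. \<bar>\<phi> (r k) x\<bar> powr q) \<longlonglongrightarrow> \<bar>u x\<bar> powr q"
      using r(2) by eventually_elim (intro tendsto_intros tendsto_powr', use q0 in auto)
    show "\<forall>\<^sub>F k in sequentially. integral\<^sup>L M (\<lambda>x. \<bar>\<phi> (r k) x\<bar> powr q) \<le> 1 + (\<gamma> * D) ^ (2 * CARD('n))"
      using bound by simp
  qed (use int in auto)
  then have "integrable M (\<lambda>x. 1 + \<bar>u x\<bar> powr q)"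
    using finite_measure.integrable_const[OF finite_M] by (intro Bochner_Integration.integrable_add)
  then show ?thesis
  proof (rule Bochner_Integration.integrable_bound)
    have "\<bar>u x\<bar> powr p \<le> 1 + \<bar>u x\<bar> powr q" for x
    proof (cases "\<bar>u x\<bar> \<le> 1")
      case True
      then have "\<bar>u x\<bar> powr p \<le> 1" using powr_mono2[of p "\<bar>u x\<bar>" 1] p by simp
      then show ?thesis by (simp add: add_increasing2)
    next
      case False
      then have "\<bar>u x\<bar> powr p \<le> \<bar>u x\<bar> powr q" using p by (intro powr_mono) (auto simp: q_def)
      then show ?thesis by simp
    qed
    then show "AE x in M. norm (\<bar>u x\<bar> powr p) \<le> norm (1 + \<bar>u x\<bar> powr q)" by (simp add: add_nonneg_nonneg)
  qed measurable
qed

end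

section \<open>An abstract self-dual variational principle\<close>

text \<open>\<open>B u w\<close> stands for the pairing of \<Gamma> u with w and \<open>N\<close>
  for the energy norm, here only a seminorm. \<open>\<Psi>_convex\<close> is strong convexity with
  constant 1, and this constant is what makes the solution map nonexpansive.
  \<open>\<Psi>_lsc\<close> assumes that the values converge, as they do along a minimizing
  sequence.\<close>

locale self_dual_setting =
  fixes H :: "('a \<Rightarrow> real) set" and N :: "('a \<Rightarrow> real) \<Rightarrow> real"
    and \<Psi> :: "('a \<Rightarrow> real) \<Rightarrow> real" and B :: "('a \<Rightarrow> real) \<Rightarrow> ('a \<Rightarrow> real) \<Rightarrow> real" and C :: real
  assumes H_ne: "H \<noteq> {}"
    and H_lin: "u \<in> H \<Longrightarrow> w \<in> H \<Longrightarrow> (\<lambda>x. s * u x + t * w x) \<in> H"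
    and N_nonneg: "u \<in> H \<Longrightarrow> 0 \<le> N u"
    and N_lin: "u \<in> H \<Longrightarrow> w \<in> H \<Longrightarrow> N (\<lambda>x. s * u x + t * w x) \<le> \<bar>s\<bar> * N u + \<bar>t\<bar> * N w"
    and H_complete: "(\<And>k. U k \<in> H) \<Longrightarrow>
      (\<And>e. e > 0 \<Longrightarrow> \<exists>K::nat. \<forall>j\<ge>K. \<forall>k\<ge>K. N (\<lambda>x. U j x - U k x) < e) \<Longrightarrow>
      \<exists>u\<in>H. (\<lambda>k. N (\<lambda>x. U k x - u x)) \<longlonglongrightarrow> 0"
    and \<Psi>_convex: "u \<in> H \<Longrightarrow> w \<in> H \<Longrightarrow> 0 \<le> t \<Longrightarrow> t \<le> 1 \<Longrightarrow>
      \<Psi> (\<lambda>x. (1 - t) * u x + t * w x) + t * (1 - t) / 2 * (N (\<lambda>x. w x - u x))\<^sup>2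
        \<le> (1 - t) * \<Psi> u + t * \<Psi> w"
    and \<Psi>_lsc: "(\<And>k::nat. U k \<in> H) \<Longrightarrow> u \<in> H \<Longrightarrow> (\<lambda>k. N (\<lambda>x. U k x - u x)) \<longlonglongrightarrow> 0 \<Longrightarrow>
      (\<lambda>k. \<Psi> (U k)) \<longlonglongrightarrow> L \<Longrightarrow> \<Psi> u \<le> L"
    and \<Psi>_below: "\<exists>c d. \<forall>u\<in>H. (N u)\<^sup>2 / 2 - c * N u - d \<le> \<Psi> u"
    and B_lin_left: "u \<in> H \<Longrightarrow> w \<in> H \<Longrightarrow> v \<in> H \<Longrightarrow>
      B (\<lambda>x. s * u x + t * w x) v = s * B u v + t * B w v"
    and B_lin_right: "u \<in> H \<Longrightarrow> w \<in> H \<Longrightarrow> v \<in> H \<Longrightarrow>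
      B v (\<lambda>x. s * u x + t * w x) = s * B v u + t * B v w"
    and B_bound: "u \<in> H \<Longrightarrow> w \<in> H \<Longrightarrow> \<bar>B u w\<bar> \<le> C * N u * N w"
    and C_pos: "C > 0"
    and B_skew: "u \<in> H \<Longrightarrow> B u u = 0"
begin

text \<open>Bounded linear functionals on \<open>H\<close>, the abstract counterpart of
  H^{-1}.\<close>

definition blf :: "(('a \<Rightarrow> real) \<Rightarrow> real) \<Rightarrow> bool" where
  "blf g \<longleftrightarrow> (\<forall>u\<in>H. \<forall>w\<in>H. \<forall>s t. g (\<lambda>x. s * u x + t * w x) = s * g u + t * g w) \<and>
     (\<exists>C. \<forall>u\<in>H. \<bar>g u\<bar> \<le> C * N u)"

text \<open>Expresses that g + t \<Gamma> u is a subgradient of \<Psi> at u.\<close>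

definition sol :: "real \<Rightarrow> (('a \<Rightarrow> real) \<Rightarrow> real) \<Rightarrow> ('a \<Rightarrow> real) \<Rightarrow> bool" where
  "sol t g u \<longleftrightarrow> u \<in> H \<and>
     (\<forall>w\<in>H. \<Psi> u + g (\<lambda>x. w x - u x) + t * B u (\<lambda>x. w x - u x) \<le> \<Psi> w)"

lemma H_diff: "u \<in> H \<Longrightarrow> w \<in> H \<Longrightarrow> (\<lambda>x. u x - w x) \<in> H"
  using H_lin[of u w 1 "-1"] by simp

lemma N_triangle:
  assumes "u \<in> H" "w \<in> H" "v \<in> H"
  shows "N (\<lambda>x. u x - v x) \<le> N (\<lambda>x. u x - w x) + N (\<lambda>x. w x - v x)"
  using N_lin[OF H_diff[of u w] H_diff[of w v], of 1 1] assms by simp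

lemma N_commute:
  assumes "u \<in> H" "w \<in> H"
  shows "N (\<lambda>x. u x - w x) = N (\<lambda>x. w x - u x)"
proof -
  have le: "N (\<lambda>x. u x - w x) \<le> N (\<lambda>x. w x - u x)" if "u \<in> H" "w \<in> H" for u w
    using N_lin[OF H_diff[of w u] H_diff[of w u], of "-1" 0] that by simp
  show ?thesis using le[OF assms] le[OF assms(2,1)] by simp
qed

lemma blf_diff: "blf g \<Longrightarrow> u \<in> H \<Longrightarrow> w \<in> H \<Longrightarrow> g (\<lambda>x. u x - w x) = g u - g w"
  unfolding blf_def by (elim conjE) (drule bspec[of _ _ u], simp, drule bspec[of _ _ w], simp,
    drule spec[of _ 1], drule spec[of _ "-1"], simp)

lemma B_diff_left: "u \<in> H \<Longrightarrow> w \<in> H \<Longrightarrow> v \<in> H \<Longrightarrow> B (\<lambda>x. u x - w x) v = B u v - B w v"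
  using B_lin_left[of u w v 1 "-1"] by simp

lemma B_diff_right: "u \<in> H \<Longrightarrow> w \<in> H \<Longrightarrow> v \<in> H \<Longrightarrow> B v (\<lambda>x. u x - w x) = B v u - B v w"
  using B_lin_right[of u w v 1 "-1"] by simp

text \<open>Lets a skew term with frozen first argument count as part of the right-hand
  side.\<close>

lemma blf_add_B:
  assumes g: "blf g" and v: "v \<in> H"
  shows "blf (\<lambda>w. g w + s * B v w)"
proof -
  obtain D where D: "\<forall>u\<in>H. \<bar>g u\<bar> \<le> D * N u" using g unfolding blf_def by blast
  have "\<bar>g u + s * B v u\<bar> \<le> (D + \<bar>s\<bar> * C * N v) * N u" if "u \<in> H" for u
  proof -
    have "\<bar>g u + s * B v u\<bar> \<le> \<bar>g u\<bar> + \<bar>s\<bar> * \<bar>B v u\<bar>"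
      by (metis abs_mult abs_triangle_ineq)
    also have "\<dots> \<le> D * N u + \<bar>s\<bar> * (C * N v * N u)"
      using D that B_bound[OF v that] by (intro add_mono mult_left_mono) auto
    finally show ?thesis by (simp add: algebra_simps)
  qed
  then have "\<exists>C. \<forall>u\<in>H. \<bar>g u + s * B v u\<bar> \<le> C * N u" by blast
  moreover have "g (\<lambda>x. a * u x + b * w x) = a * g u + b * g w" if "u \<in> H" "w \<in> H" for u w a b
    using g that unfolding blf_def by blast
  ultimately show ?thesis
    using B_lin_right[OF _ _ v] unfolding blf_def
    by (simp add: algebra_simps)
qed

text \<open>At the midpoint of two almost minimal points strong convexity leaves a gap of N^2/8,
  which must be paid by their excess over the infimum; hence minimizing sequences are
  Cauchy.\<close>

lemma minimizer_exists:
  assumes g: "blf g"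
  shows "\<exists>u\<in>H. \<forall>w\<in>H. \<Psi> u - g u \<le> \<Psi> w - g w"
proof -
  obtain D where D: "\<And>u. u \<in> H \<Longrightarrow> \<bar>g u\<bar> \<le> D * N u" using g unfolding blf_def by blast
  have glin: "g (\<lambda>x. s * u x + t * w x) = s * g u + t * g w" if "u \<in> H" "w \<in> H" for u w s t
    using g that unfolding blf_def by blast
  obtain c d where cd: "\<And>u. u \<in> H \<Longrightarrow> (N u)\<^sup>2 / 2 - c * N u - d \<le> \<Psi> u" using \<Psi>_below by blast
  define F where "F u = \<Psi> u - g u" for u
  \<comment> \<open>Completing the square in \<open>N u\<close>: the bound D of the functional
    simply adds to the constant c of \<open>\<Psi>_below\<close>.\<close>
  have "- ((c + D)\<^sup>2 / 2) - d \<le> F u" if "u \<in> H" for u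
  proof -
    have "0 \<le> (N u - (c + D))\<^sup>2 / 2" by simp
    also have "\<dots> = (N u)\<^sup>2 / 2 - c * N u - d + (c + D)\<^sup>2 / 2 + d - D * N u"
      by (simp add: power2_eq_square field_simps)
    also have "\<dots> \<le> \<Psi> u + (c + D)\<^sup>2 / 2 + d - g u" using cd[OF that] D[OF that] by linarith
    finally show ?thesis unfolding F_def by linarith
  qed
  then have bdd: "bdd_below (F ` H)" by (intro bdd_belowI2)
  define m where "m = Inf (F ` H)"
  have m_le: "m \<le> F u" if "u \<in> H" for u
    unfolding m_def using bdd that by (intro cInf_lower) auto
  have "\<exists>u\<in>H. F u < m + 1 / (real k + 1)" for k :: nat
  proof -
    have "Inf (F ` H) < m + 1 / (real k + 1)" unfolding m_def by simp
    then show ?thesis using cInf_less_iff[of "F ` H"] H_ne bdd by auto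
  qed
  then obtain U where U: "\<And>k. U k \<in> H" "\<And>k. F (U k) < m + 1 / (real k + 1)" by metis
  have N_le: "(N (\<lambda>x. U j x - U k x))\<^sup>2 \<le> 4 * (1 / (real j + 1) + 1 / (real k + 1))" for j k
  proof -
    let ?v = "\<lambda>x. (1 - 1/2) * U k x + (1/2) * U j x"
    have "?v \<in> H" by (intro H_lin U)
    then have "m \<le> \<Psi> ?v - (g (U k) / 2 + g (U j) / 2)"
      using m_le[of ?v] glin[OF U(1)[of k] U(1)[of j], of "1 - 1/2" "1/2"] by (simp add: F_def)
    moreover have "\<Psi> ?v + (1/8) * (N (\<lambda>x. U j x - U k x))\<^sup>2 \<le> (1/2) * \<Psi> (U k) + (1/2) * \<Psi> (U j)"
      using \<Psi>_convex[OF U(1)[of k] U(1)[of j], of "1/2"] by simp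
    ultimately show ?thesis using U(2)[of j] U(2)[of k] unfolding F_def
      by (simp add: algebra_simps)
  qed
  have "\<exists>K::nat. \<forall>j\<ge>K. \<forall>k\<ge>K. N (\<lambda>x. U j x - U k x) < e" if "e > 0" for e
  proof -
    \<comment> \<open>The right side of \<open>N_le\<close> is at most 8 / (K + 1) for indices
      beyond K.\<close>
    obtain K :: nat where K: "8 / e\<^sup>2 < real K" using reals_Archimedean2 by blast
    have "N (\<lambda>x. U j x - U k x) < e" if "j \<ge> K" "k \<ge> K" for j k
    proof -
      have "1 / (real j + 1) \<le> 1 / (real K + 1)" "1 / (real k + 1) \<le> 1 / (real K + 1)"
        using that by (auto intro!: divide_left_mono)
      then have "(N (\<lambda>x. U j x - U k x))\<^sup>2 \<le> 4 * (1 / (real K + 1) + 1 / (real K + 1))"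
        by (intro order_trans[OF N_le[of j k]] mult_left_mono add_mono) simp_all
      moreover have "4 * (1 / (real K + 1) + 1 / (real K + 1)) < e\<^sup>2"
      proof -
        have "8 < real K * e\<^sup>2" using K \<open>e > 0\<close> by (simp add: divide_less_eq)
        also have "\<dots> \<le> (real K + 1) * e\<^sup>2" by (intro mult_right_mono) auto
        finally show ?thesis by (simp add: divide_less_eq mult.commute)
      qed
      ultimately show ?thesis using \<open>e > 0\<close> by (intro power2_less_imp_less[of _ e]) linarith+
    qed
    then show ?thesis by blast
  qed
  from H_complete[OF U(1) this] obtain u where u: "u \<in> H" "(\<lambda>k. N (\<lambda>x. U k x - u x)) \<longlonglongrightarrow> 0"
    by blast
  have "(\<lambda>k. g (\<lambda>x. U k x - u x)) \<longlonglongrightarrow> 0"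
  proof (rule Lim_null_comparison)
    show "\<forall>\<^sub>F k in sequentially. norm (g (\<lambda>x. U k x - u x)) \<le> D * N (\<lambda>x. U k x - u x)"
      using D H_diff[OF U(1) u(1)] by simp
    show "(\<lambda>k. D * N (\<lambda>x. U k x - u x)) \<longlonglongrightarrow> 0" using tendsto_mult_right_zero[OF u(2)] by simp
  qed
  then have "(\<lambda>k. g (U k) - g u) \<longlonglongrightarrow> 0" using blf_diff[OF g U(1) u(1)] by simp
  then have glim: "(\<lambda>k. g (U k)) \<longlonglongrightarrow> g u" by (simp add: LIM_zero_iff)
  have "(\<lambda>k. F (U k)) \<longlonglongrightarrow> m"
  proof (rule tendsto_sandwich[OF _ _ tendsto_const])
    show "\<forall>\<^sub>F k in sequentially. m \<le> F (U k)" using m_le U(1) by simp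
    show "\<forall>\<^sub>F k in sequentially. F (U k) \<le> m + 1 / (real k + 1)" using U(2) by (simp add: less_imp_le)
    have "(\<lambda>k. m + 1 / (real k + 1)) \<longlonglongrightarrow> m + 0"
      using LIMSEQ_inverse_real_of_nat by (intro tendsto_add tendsto_const) (simp add: inverse_eq_divide add.commute)
    then show "(\<lambda>k. m + 1 / (real k + 1)) \<longlonglongrightarrow> m" by simp
  qed
  from tendsto_add[OF this glim] have "(\<lambda>k. \<Psi> (U k)) \<longlonglongrightarrow> m + g u" by (simp add: F_def)
  then have "\<Psi> u \<le> m + g u" using \<Psi>_lsc[OF U(1) u] by blast
  then show ?thesis using u(1) m_le unfolding F_def by (intro bexI[of _ u]) force+
qed

text \<open>A minimizer gains the quadratic term for free: compare with the points (1-t) u + t w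
  near u, divide by t, and let t tend to 0.\<close>

lemma minimizer_strong:
  assumes g: "blf g" and u: "u \<in> H" and w: "w \<in> H"
    and min: "\<And>v. v \<in> H \<Longrightarrow> \<Psi> u + g (\<lambda>x. v x - u x) \<le> \<Psi> v"
  shows "\<Psi> u + g (\<lambda>x. w x - u x) + (N (\<lambda>x. w x - u x))\<^sup>2 / 2 \<le> \<Psi> w"
proof -
  have glin: "g (\<lambda>x. s * u x + t * w x) = s * g u + t * g w" for s t
    using g u w unfolding blf_def by blast
  let ?N = "(N (\<lambda>x. w x - u x))\<^sup>2"
  have *: "\<Psi> u + g w - g u + (1 - t) / 2 * ?N \<le> \<Psi> w" if t: "0 < t" "t < 1" for t
  proof -
    let ?v = "\<lambda>x. (1 - t) * u x + t * w x"
    have v: "?v \<in> H" by (intro H_lin u w)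
    have "\<Psi> u + (g ?v - g u) \<le> \<Psi> ?v" using min[OF v] blf_diff[OF g v u] by simp
    with \<Psi>_convex[OF u w, of t] t
    have "t * (\<Psi> u + g w - g u + (1 - t) / 2 * ?N) \<le> t * \<Psi> w"
      unfolding glin by (simp add: algebra_simps)
    then show ?thesis using t by simp
  qed
  have "((\<lambda>t. \<Psi> u + g w - g u + (1 - t) / 2 * ?N) \<longlongrightarrow> \<Psi> u + g w - g u + (1 - 0) / 2 * ?N) (at_right 0)"
    by (intro tendsto_intros) auto
  moreover have "\<forall>\<^sub>F t in at_right (0::real). \<Psi> u + g w - g u + (1 - t) / 2 * ?N \<le> \<Psi> w"
    using * eventually_at_right_less[of 0] eventually_at_right_real[of 0 1]
    by (auto elim!: eventually_mono)
  ultimately have "\<Psi> u + g w - g u + (1 - 0) / 2 * ?N \<le> \<Psi> w"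
    by (intro tendsto_upperbound) auto
  then show ?thesis using blf_diff[OF g w u] by simp
qed

text \<open>Each of u, u' is compared with the other through the strengthened minimality, its skew
  term being frozen at the solution. In the sum the skew terms cancel because B vanishes on the
  diagonal, so the estimate does not see t; the two halves of the quadratic term add up to the full
  square.\<close>

lemma sol_stable:
  assumes g: "blf g" "blf g'" and u: "sol t g u" "sol t g' u'"
  shows "(N (\<lambda>x. u x - u' x))\<^sup>2 \<le> g (\<lambda>x. u x - u' x) - g' (\<lambda>x. u x - u' x)"
proof -
  have uH: "u \<in> H" "u' \<in> H" using u unfolding sol_def by auto
  have 1: "\<Psi> u + (g (\<lambda>x. u' x - u x) + t * B u (\<lambda>x. u' x - u x)) + (N (\<lambda>x. u' x - u x))\<^sup>2 / 2 \<le> \<Psi> u'"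
    by (rule minimizer_strong[OF blf_add_B[OF g(1) uH(1)] uH]) (use u in \<open>auto simp: sol_def add.assoc\<close>)
  have 2: "\<Psi> u' + (g' (\<lambda>x. u x - u' x) + t * B u' (\<lambda>x. u x - u' x)) + (N (\<lambda>x. u x - u' x))\<^sup>2 / 2 \<le> \<Psi> u"
    by (rule minimizer_strong[OF blf_add_B[OF g(2) uH(2)] uH(2,1)]) (use u in \<open>auto simp: sol_def add.assoc\<close>)
  have "B (\<lambda>x. u x - u' x) (\<lambda>x. u x - u' x) = 0" using B_skew H_diff uH by blast
  then have skew: "B u u - B u u' = B u' u - B u' u'"
    using uH by (simp add: B_diff_left B_diff_right H_diff)
  have "B u' (\<lambda>x. u x - u' x) + B u (\<lambda>x. u' x - u x) = 0"
    using skew uH by (simp add: B_diff_right)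
  then have 3: "t * B u' (\<lambda>x. u x - u' x) + t * B u (\<lambda>x. u' x - u x) = 0"
    by (simp flip: distrib_left)
  have "g (\<lambda>x. u' x - u x) = - g (\<lambda>x. u x - u' x)"
    using blf_diff[OF g(1)] uH by simp
  then show ?thesis using 1 2 3 N_commute[OF uH] by simp
qed

text \<open>Solutions depend on the right-hand side in a nonexpansive way, whatever the strength \<open>t\<close>
  of the skew part. Hence the strength can be increased by \<open>s < 1 / C\<close> by a contraction argument.\<close>

lemma sol_step:
  assumes ex: "\<And>g. blf g \<Longrightarrow> \<exists>u. sol t g u" and s: "0 \<le> s" "s * C < 1" and g: "blf g"
  shows "\<exists>u. sol (t + s) g u"
proof -
  \<comment> \<open>The additional skew part is lagged: it acts on the previous iterate v, so a
    fixed point of \<open>R\<close> solves the problem of strength t + s.\<close>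
  define G where "G v = (\<lambda>w. g w + s * B v w)" for v
  have G: "blf (G v)" if "v \<in> H" for v unfolding G_def by (rule blf_add_B[OF g that])
  define R where "R v = (SOME u. sol t (G v) u)" for v
  have R: "sol t (G v) (R v)" if "v \<in> H" for v
    unfolding R_def using ex[OF G[OF that]] by (rule someI_ex)
  have RH: "R v \<in> H" if "v \<in> H" for v using R[OF that] by (simp add: sol_def)
  define q where "q = s * C"
  have q: "0 \<le> q" "q < 1" using s C_pos by (auto simp: q_def)
  have contr: "N (\<lambda>x. R v x - R w x) \<le> q * N (\<lambda>x. v x - w x)" if v: "v \<in> H" and w: "w \<in> H" for v w
  proof -
    let ?d = "\<lambda>x. R v x - R w x"
    have d: "?d \<in> H" by (intro H_diff RH v w)
    have "(N ?d)\<^sup>2 \<le> G v ?d - G w ?d" by (rule sol_stable[OF G[OF v] G[OF w] R[OF v] R[OF w]])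
    also have "\<dots> = s * B (\<lambda>x. v x - w x) ?d"
      unfolding G_def B_diff_left[OF v w d] by (simp add: algebra_simps)
    also have "\<dots> \<le> s * (C * N (\<lambda>x. v x - w x) * N ?d)"
      using B_bound[OF H_diff[OF v w] d] s(1) by (intro mult_left_mono) auto
    finally have "N ?d * N ?d \<le> q * N (\<lambda>x. v x - w x) * N ?d"
      by (simp add: q_def power2_eq_square algebra_simps)
    then show ?thesis using N_nonneg[OF d] N_nonneg[OF H_diff[OF v w]] q
      by (cases "N ?d = 0") (auto simp: mult_le_cancel_right)
  qed
  obtain v0 where v0: "v0 \<in> H" using H_ne by blast
  define V where "V k = (R ^^ k) v0" for k
  have V: "V k \<in> H" for k unfolding V_def by (induction k) (auto simp: v0 RH)
  have VS: "V (Suc k) = R (V k)" for k by (simp add: V_def)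
  define D where "D = N (\<lambda>x. V 1 x - V 0 x)"
  have D0: "0 \<le> D" unfolding D_def by (intro N_nonneg H_diff V)
  have step: "N (\<lambda>x. V (Suc k) x - V k x) \<le> q ^ k * D" for k
  proof (induction k)
    case (Suc k)
    have "N (\<lambda>x. V (Suc (Suc k)) x - V (Suc k) x) \<le> q * N (\<lambda>x. V (Suc k) x - V k x)"
      using contr[OF V V, of "Suc k" k] VS by simp
    also have "\<dots> \<le> q * (q ^ k * D)" using Suc q(1) by (rule mult_left_mono)
    finally show ?case by simp
  qed (simp add: D_def)
  have tail: "N (\<lambda>x. V (k + j) x - V k x) \<le> q ^ k * (D / (1 - q))" for k j
  proof -
    have "N (\<lambda>x. V (k + j) x - V k x) \<le> (\<Sum>i<j. q ^ (k + i) * D)"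
    proof (induction j)
      case 0
      show ?case using N_lin[OF V V, of 0 k 0 k] by simp
    next
      case (Suc j)
      then show ?case using N_triangle[OF V V V, of "Suc (k + j)" k "k + j"] step[of "k + j"] by simp
    qed
    also have "\<dots> = q ^ k * D * (\<Sum>i<j. q ^ i)"
      by (simp add: sum_distrib_left power_add algebra_simps)
    also have "\<dots> \<le> q ^ k * D * (1 / (1 - q))"
    proof (intro mult_left_mono)
      have "(\<Sum>i<j. q ^ i) \<le> suminf (\<lambda>i. q ^ i)"
        using q by (intro sum_le_suminf summable_geometric) auto
      then show "(\<Sum>i<j. q ^ i) \<le> 1 / (1 - q)" using q by (simp add: suminf_geometric)
    qed (use q D0 in auto)
    finally show ?thesis by simp
  qed
  have "\<exists>K::nat. \<forall>j\<ge>K. \<forall>k\<ge>K. N (\<lambda>x. V j x - V k x) < e" if e: "e > 0" for e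
  proof -
    have "(\<lambda>k. q ^ k * (D / (1 - q))) \<longlonglongrightarrow> 0 * (D / (1 - q))"
      using q by (intro tendsto_mult tendsto_const LIMSEQ_power_zero) auto
    then have "(\<lambda>k. q ^ k * (D / (1 - q))) \<longlonglongrightarrow> 0" by simp
    then have "\<forall>\<^sub>F k in sequentially. q ^ k * (D / (1 - q)) < e / 2"
      using e by (intro order_tendstoD(2)) auto
    then obtain K where K: "q ^ K * (D / (1 - q)) < e / 2" by (auto simp: eventually_sequentially)
    have "N (\<lambda>x. V j x - V k x) < e" if "j \<ge> K" "k \<ge> K" for j k
    proof -
      have "N (\<lambda>x. V j x - V K x) < e / 2" "N (\<lambda>x. V k x - V K x) < e / 2"
        using le_less_trans[OF tail[of K "j - K"] K] le_less_trans[OF tail[of K "k - K"] K] that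
        by simp_all
      then show ?thesis
        using N_triangle[OF V V V, of j k K] N_commute[OF V V, of k K] by simp
    qed
    then show ?thesis by blast
  qed
  from H_complete[OF V this] obtain v where v: "v \<in> H" "(\<lambda>k. N (\<lambda>x. V k x - v x)) \<longlonglongrightarrow> 0"
    by blast
  define u where "u = R v"
  have uH: "u \<in> H" unfolding u_def by (rule RH[OF v(1)])
  have "N (\<lambda>x. u x - v x) \<le> q * N (\<lambda>x. V k x - v x) + N (\<lambda>x. V (Suc k) x - v x)" for k
    using N_triangle[OF uH V v(1), of "Suc k"] contr[OF v(1) V, of k] N_commute[OF V v(1), of k]
    by (simp add: u_def VS)
  moreover have "(\<lambda>k. q * N (\<lambda>x. V k x - v x) + N (\<lambda>x. V (Suc k) x - v x)) \<longlonglongrightarrow> q * 0 + 0"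
    using v(2) LIMSEQ_Suc[OF v(2)] by (intro tendsto_intros)
  ultimately have "N (\<lambda>x. u x - v x) \<le> q * 0 + 0" by (intro LIMSEQ_le_const) auto
  \<comment> \<open>\<open>N\<close> is only a seminorm, so u and v need not coincide; their
    vanishing distance still lets \<open>B v\<close> be replaced by \<open>B u\<close>.\<close>
  then have N0: "N (\<lambda>x. u x - v x) = 0" using N_nonneg[OF H_diff[OF uH v(1)]] by simp
  have Buv: "B v w = B u w" if "w \<in> H" for w
    using B_bound[OF H_diff[OF uH v(1)] that] B_diff_left[OF uH v(1) that] N0 by simp
  have "sol (t + s) g u"
    using R[OF v(1)] Buv H_diff[OF _ uH] unfolding sol_def u_def[symmetric] G_def
    by (auto simp: algebra_simps)
  then show ?thesis by blast
qed

theorem self_dual_solution: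
  obtains u where "u \<in> H" "\<And>w. w \<in> H \<Longrightarrow> \<Psi> u + B u w \<le> \<Psi> w"
proof -
  have zero: "\<exists>u. sol 0 g u" if g: "blf g" for g
  proof -
    obtain u where u: "u \<in> H" "\<forall>w\<in>H. \<Psi> u - g u \<le> \<Psi> w - g w"
      using minimizer_exists[OF g] by blast
    then have "sol 0 g u" unfolding sol_def using blf_diff[OF g] by (fastforce simp: algebra_simps)
    then show ?thesis by blast
  qed
  \<comment> \<open>Steps of length 1/n satisfy the smallness condition s C < 1 because n exceeds C,
    and n of them reach 1.\<close>
  obtain n :: nat where n: "C < real n" using reals_Archimedean2 by blast
  then have n0: "real n > 0" using C_pos by linarith
  have *: "\<exists>u. sol (real k * (1 / real n)) g u" if "blf g" for g and k :: nat
    using that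
  proof (induction k arbitrary: g)
    case 0
    then show ?case using zero by simp
  next
    case (Suc k)
    have "\<exists>u. sol (real k * (1 / real n) + 1 / real n) g u"
      by (rule sol_step[OF Suc.IH _ _ Suc.prems]) (use n n0 in auto)
    then show ?case by (simp add: add_divide_distrib add.commute)
  qed
  have "blf (\<lambda>_. 0)" unfolding blf_def by (auto intro!: exI[of _ 0])
  from *[OF this, of n] obtain u where u: "sol 1 (\<lambda>_. 0) u" using n0 by auto
  then have uH: "u \<in> H" by (simp add: sol_def)
  show thesis
  proof
    show "u \<in> H" by fact
    \<comment> \<open>Since B u u = 0, the term B u (w - u) of \<open>sol\<close> is just B u
      w.\<close>
    show "\<Psi> u + B u w \<le> \<Psi> w" if "w \<in> H" for w
      using u that B_diff_right[OF that uH uH] B_skew[OF uH] by (auto simp: sol_def)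
  qed
qed

end

section \<open>The semilinear problem\<close>

locale semilinear_problem = bounded_open_set \<Omega> for \<Omega> :: "(real^'n::finite) set" +
  fixes a :: "'n \<Rightarrow> real^'n \<Rightarrow> real" and f :: "real^'n \<Rightarrow> real" and p :: real
  assumes smooth_a: "\<And>i. smooth_on_closure \<Omega> (a i)"
    and div_nonneg: "\<And>x. x \<in> \<Omega> \<Longrightarrow> 0 \<le> div_field a x"
    and sqint_f: "sqint (lebesgue_on \<Omega>) f"
    and p_gt_1: "1 < p" and p_le: "p \<le> 2 * real CARD('n) / (real CARD('n) - 2)"
    and card_ge_3: "CARD('n) \<ge> 3"
begin

section \<open>The coefficients and the skew-adjoint drift operator\<close>

lemma coefficient_continuous:
  "continuous_on (closure \<Omega>) (a i)" "continuous_on (closure \<Omega>) (partial j (a i))"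
  and coefficient_has_derivative:
  "x \<in> closure \<Omega> \<Longrightarrow> ((\<lambda>t. a i (x + t *\<^sub>R axis i 1)) has_real_derivative partial i (a i) x) (at 0)"
proof -
  obtain U where U: "open U" "closure \<Omega> \<subseteq> U" "smooth_on U (a i)"
    using smooth_a[of i] by (auto simp: smooth_on_closure_def)
  show "continuous_on (closure \<Omega>) (a i)" "continuous_on (closure \<Omega>) (partial j (a i))"
    using smooth_on_continuous[OF U(3)] smooth_on_continuous[OF smooth_on_partial[OF U(3)]] U(2)
    by (auto intro: continuous_on_subset)
  show "((\<lambda>t. a i (x + t *\<^sub>R axis i 1)) has_real_derivative partial i (a i) x) (at 0)"
    if "x \<in> closure \<Omega>"
    using smooth_on_has_derivative[OF U(3)] U(2) that by blast
qed

lemma div_continuous: "continuous_on (closure \<Omega>) (div_field a)"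
  unfolding div_field_def[abs_def] by (intro continuous_intros coefficient_continuous)

definition avec :: "real^'n \<Rightarrow> real^'n" where "avec x = (\<chi> i. a i x)"

lemma avec_continuous: "continuous_on (closure \<Omega>) avec"
  unfolding avec_def[abs_def] by (intro continuous_on_vec_lambda coefficient_continuous)

lemma bounded_on_closure:
  fixes h :: "real^'n \<Rightarrow> 'b::real_normed_vector"
  assumes "continuous_on (closure \<Omega>) h"
  obtains C where "0 < C" "\<And>x. x \<in> \<Omega> \<Longrightarrow> norm (h x) \<le> C"
proof -
  have "compact (closure \<Omega>)" using bounded_\<Omega> by simp
  from compact_imp_bounded[OF compact_continuous_image[OF assms this]]
  obtain C where C: "0 < C" "\<And>x. x \<in> closure \<Omega> \<Longrightarrow> norm (h x) \<le> C" unfolding bounded_pos by blast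
  show thesis using C closure_subset by (intro that[of C]) blast+
qed

lemma measurable_continuous_closure:
  fixes h :: "real^'n \<Rightarrow> 'b::euclidean_space"
  assumes "continuous_on (closure \<Omega>) h"
  shows "h \<in> borel_measurable M"
  using continuous_on_subset[OF assms closure_subset] open_\<Omega>
  by (intro continuous_imp_measurable_on_sets_lebesgue) auto

lemma avec_measurable [measurable]: "avec \<in> borel_measurable M"
  by (rule measurable_continuous_closure[OF avec_continuous])

lemma div_measurable [measurable]: "div_field a \<in> borel_measurable M"
  by (rule measurable_continuous_closure[OF div_continuous])

lemma sqint_div:
  assumes "sqint M u" shows "sqint M (\<lambda>x. div_field a x * u x)"
proof -
  note [measurable] = assms[THEN sqint_measurable]
  obtain C where C: "0 < C" "\<And>x. x \<in> \<Omega> \<Longrightarrow> norm (div_field a x) \<le> C"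
    by (rule bounded_on_closure[OF div_continuous]) blast
  show ?thesis
    by (rule sqint_dominated[OF assms assms, where a = C and b = 0])
      (use C(2) in \<open>auto simp: abs_mult intro!: mult_right_mono\<close>)
qed

text \<open>This is \<Gamma>. The gradient is a separate argument, so that one formula serves test
  functions with \<open>grad\<close> and elements of \<open>H10\<close> with any of their weak
  gradients.\<close>

definition drift :: "(real^'n \<Rightarrow> real) \<Rightarrow> (real^'n \<Rightarrow> real^'n) \<Rightarrow> real^'n \<Rightarrow> real" where
  "drift u G x = (\<Sum>i\<in>UNIV. a i x * G x $ i) + (1/2) * div_field a x * u x"

lemma drift_eq: "drift u G x = avec x \<bullet> G x + (1/2) * (div_field a x * u x)"
  by (simp add: drift_def avec_def inner_vec_def)

lemma drift_bound:
  obtains K L where "0 < K" "0 < L"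
    "\<And>u G. sqint M u \<Longrightarrow> sqint M G \<Longrightarrow> sqint M (drift u G) \<and> l2n M (drift u G) \<le> K * l2n M G + L * l2n M u"
proof -
  obtain K where K: "0 < K" "\<And>x. x \<in> \<Omega> \<Longrightarrow> norm (avec x) \<le> K"
    by (rule bounded_on_closure[OF avec_continuous]) blast
  obtain L where L: "0 < L" "\<And>x. x \<in> \<Omega> \<Longrightarrow> norm (div_field a x) \<le> L"
    by (rule bounded_on_closure[OF div_continuous]) blast
  have "sqint M (drift u G) \<and> l2n M (drift u G) \<le> K * l2n M G + L * l2n M u"
    if u: "sqint M u" and G: "sqint M G" for u G
  proof -
    note [measurable] = u[THEN sqint_measurable] G[THEN sqint_measurable]
    have aG_le: "norm (avec x \<bullet> G x) \<le> K * norm (G x)" if "x \<in> \<Omega>" for x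
      using Cauchy_Schwarz_ineq2[of "avec x" "G x"] mult_right_mono[OF K(2)[OF that] norm_ge_zero[of "G x"]]
      by simp
    have aG: "sqint M (\<lambda>x. avec x \<bullet> G x)"
      by (rule sqint_dominated[OF G G, where a = K and b = 0]) (use aG_le in auto)
    have du: "sqint M (\<lambda>x. div_field a x * u x)" by (rule sqint_div[OF u])
    have 1: "l2n M (\<lambda>x. avec x \<bullet> G x) \<le> K * l2n M G"
      by (rule l2n_mono[OF aG G]) (use aG_le K in auto)
    have 2: "l2n M (\<lambda>x. div_field a x * u x) \<le> L * l2n M u"
      by (rule l2n_mono[OF du u]) (use L in \<open>auto simp: abs_mult intro!: mult_right_mono\<close>)
    have eq: "drift u G = (\<lambda>x. 1 *\<^sub>R (avec x \<bullet> G x) + (1/2) *\<^sub>R (div_field a x * u x))"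
      by (simp add: drift_eq fun_eq_iff)
    have "l2n M (\<lambda>x. div_field a x * u x) / 2 \<le> L * l2n M u"
      using 2 l2n_nonneg[of M "\<lambda>x. div_field a x * u x"] by linarith
    then show ?thesis
      unfolding eq using sqint_lincomb[OF aG du, of 1 "1/2"] l2n_lincomb[OF aG du, of 1 "1/2"] 1 by auto
  qed
  then show thesis using K(1) L(1) by (intro that[of K L]) auto
qed

lemma sqint_drift: "sqint M u \<Longrightarrow> sqint M G \<Longrightarrow> sqint M (drift u G)"
  using drift_bound by metis

lemma drift_diff: "drift u G x - drift w K x = drift (\<lambda>x. u x - w x) (\<lambda>x. G x - K x) x"
  by (simp add: drift_eq inner_diff_right algebra_simps)

text \<open>The derivatives of a_i \<phi>^2 in direction i add up to div(a) \<phi>^2 + 2 \<phi> a .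
  grad \<phi>, which is twice the integrand, and each of them integrates to 0. The half of div(a) in
  the drift is there to make this exact.\<close>

lemma test_fun_drift_skew:
  assumes \<phi>: "test_fun \<Omega> \<phi>"
  shows "integral\<^sup>L M (\<lambda>x. drift \<phi> (grad \<phi>) x * \<phi> x) = 0"
proof -
  define h' where "h' i x = partial i (a i) x * (\<phi> x)\<^sup>2 + a i x * (2 * \<phi> x * partial i \<phi> x)" for i x
  define K where "K = closure {x. \<phi> x \<noteq> 0}"
  have K: "compact K" "K \<subseteq> \<Omega>" using \<phi> by (simp_all add: test_fun_def K_def)
  have \<phi>0: "\<phi> x = 0" if "x \<notin> K" for x
    using that closure_subset[of "{x. \<phi> x \<noteq> 0}"] unfolding K_def by blast
  note ca = coefficient_continuous[THEN continuous_on_subset[OF _ closure_subset]]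
  have cont_h': "continuous_on \<Omega> (h' i)" for i
    unfolding h'_def[abs_def]
    by (intro continuous_intros ca test_fun_continuous[OF \<phi>] test_fun_continuous[OF test_fun_partial[OF \<phi>]])
  have zero: "integral\<^sup>L M (h' i) = 0" for i
  proof (rule integral_directional_derivative[OF open_\<Omega> K _ cont_h'])
    show "continuous_on \<Omega> (\<lambda>x. a i x * (\<phi> x)\<^sup>2)"
      by (intro continuous_intros ca test_fun_continuous[OF \<phi>])
    show "((\<lambda>t. a i (x + t *\<^sub>R axis i 1) * (\<phi> (x + t *\<^sub>R axis i 1))\<^sup>2) has_real_derivative h' i x) (at 0)"
      if "x \<in> \<Omega>" for x
    proof -
      have "x \<in> closure \<Omega>" using that closure_subset by blast
      show ?thesis
        unfolding h'_def
        by (rule derivative_eq_intros coefficient_has_derivative[OF \<open>x \<in> closure \<Omega>\<close>] smooth_on_has_derivative[OF test_fun_smooth[OF \<phi>]] refl | simp)+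
    qed
    show "a i x * (\<phi> x)\<^sup>2 = 0 \<and> h' i x = 0" if "x \<notin> K" for x
      using \<phi>0[OF that] by (simp add: h'_def)
  qed
  have int: "integrable M (h' i)" for i
  proof -
    obtain C where C: "\<And>x. x \<in> K \<Longrightarrow> norm (h' i x) \<le> C"
      using compact_imp_bounded[OF compact_continuous_image[OF continuous_on_subset[OF cont_h'[of i] K(2)] K(1)]]
      by (auto simp: bounded_iff)
    show ?thesis
    proof (rule finite_measure.integrable_const_bound[OF finite_M])
      have "norm (h' i x) \<le> max C 0" for x
        using C[of x] \<phi>0[of x] by (cases "x \<in> K") (auto simp: h'_def)
      then show "AE x in M. norm (h' i x) \<le> max C 0" by simp
      show "h' i \<in> borel_measurable M"
        using cont_h' open_\<Omega> by (intro continuous_imp_measurable_on_sets_lebesgue) auto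
    qed
  qed
  have eq: "drift \<phi> (grad \<phi>) x * \<phi> x = (1/2) * (\<Sum>i\<in>UNIV. h' i x)" for x
    by (simp add: drift_def div_field_def h'_def sum.distrib sum_distrib_left sum_distrib_right
        power2_eq_square algebra_simps)
  show ?thesis unfolding eq using int zero by (simp add: Bochner_Integration.integral_sum)
qed

lemma drift_skew:
  assumes u: "H10_with_grad \<Omega> u G"
  shows "integral\<^sup>L M (\<lambda>x. drift u G x * u x) = 0"
proof -
  from u obtain \<phi> where \<phi>: "\<And>k::nat. test_fun \<Omega> (\<phi> k)" "(\<lambda>k. l2n M (\<lambda>x. \<phi> k x - u x)) \<longlonglongrightarrow> 0"
    "(\<lambda>k. l2n M (\<lambda>x. grad (\<phi> k) x - G x)) \<longlonglongrightarrow> 0" by (rule H10_with_gradE) blast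
  note sq = H10_with_grad_sqint[OF u]
  obtain K L where KL: "0 < K" "0 < L"
    "\<And>u G. sqint M u \<Longrightarrow> sqint M G \<Longrightarrow> sqint M (drift u G) \<and> l2n M (drift u G) \<le> K * l2n M G + L * l2n M u"
    by (rule drift_bound) blast
  have "(\<lambda>k. l2n M (\<lambda>x. drift (\<phi> k) (grad (\<phi> k)) x - drift u G x)) \<longlonglongrightarrow> 0"
  proof (rule Lim_null_comparison)
    show "\<forall>\<^sub>F k in sequentially. norm (l2n M (\<lambda>x. drift (\<phi> k) (grad (\<phi> k)) x - drift u G x))
        \<le> K * l2n M (\<lambda>x. grad (\<phi> k) x - G x) + L * l2n M (\<lambda>x. \<phi> k x - u x)"
      unfolding drift_diff
      using KL(3)[OF sqint_diff[OF sqint_test[OF \<phi>(1)] sq(1)] sqint_diff[OF sqint_grad_test[OF \<phi>(1)] sq(2)]]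
      by simp
    show "(\<lambda>k. K * l2n M (\<lambda>x. grad (\<phi> k) x - G x) + L * l2n M (\<lambda>x. \<phi> k x - u x)) \<longlonglongrightarrow> 0"
      using tendsto_add[OF tendsto_mult_right_zero[OF \<phi>(3)] tendsto_mult_right_zero[OF \<phi>(2)]] by simp
  qed
  from l2_inner_tendsto[OF sqint_drift[OF sqint_test[OF \<phi>(1)] sqint_grad_test[OF \<phi>(1)]] sqint_drift[OF sq] this
      sqint_test[OF \<phi>(1)] sq(1) \<phi>(2)]
  show ?thesis by (simp add: test_fun_drift_skew[OF \<phi>(1)] LIMSEQ_const_iff)
qed

definition B :: "(real^'n \<Rightarrow> real) \<Rightarrow> (real^'n \<Rightarrow> real) \<Rightarrow> real" where
  "B u w = integral\<^sup>L M (\<lambda>x. drift u (wgrad \<Omega> u) x * w x)"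

lemma drift_mult_integrable: "H10 \<Omega> u \<Longrightarrow> sqint M w \<Longrightarrow> integrable M (\<lambda>x. drift u (wgrad \<Omega> u) x * w x)"
  using sqint_inner_integrable[OF sqint_drift[OF H10_sqint wgrad_sqint]] by simp

lemma B_skew: "H10 \<Omega> u \<Longrightarrow> B u u = 0"
  unfolding B_def by (rule drift_skew[OF wgrad_H10])

lemma B_lin_right:
  assumes "H10 \<Omega> u" "H10 \<Omega> w" "H10 \<Omega> v"
  shows "B v (\<lambda>x. s * u x + t * w x) = s * B v u + t * B v w"
proof -
  have "(\<lambda>x. drift v (wgrad \<Omega> v) x * (s * u x + t * w x)) =
      (\<lambda>x. s * (drift v (wgrad \<Omega> v) x * u x) + t * (drift v (wgrad \<Omega> v) x * w x))"
    by (simp add: algebra_simps fun_eq_iff)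
  then show ?thesis unfolding B_def using drift_mult_integrable[OF assms(3) H10_sqint] assms(1,2) by simp
qed

text \<open>Linearity in the first argument appears only after integration, as \<open>wgrad\<close>
  is linear merely almost everywhere.\<close>

lemma B_lin_left:
  assumes u: "H10 \<Omega> u" and w: "H10 \<Omega> w" and v: "H10 \<Omega> v"
  shows "B (\<lambda>x. s * u x + t * w x) v = s * B u v + t * B w v"
proof -
  let ?z = "\<lambda>x. s * u x + t * w x"
  have z: "H10 \<Omega> ?z" by (rule H10_lincomb[OF u w])
  have "B ?z v = integral\<^sup>L M (\<lambda>x. s * (drift u (wgrad \<Omega> u) x * v x) + t * (drift w (wgrad \<Omega> w) x * v x))"
    unfolding B_def
  proof (rule integral_cong_AE)
    show "AE x in M. drift ?z (wgrad \<Omega> ?z) x * v x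
        = s * (drift u (wgrad \<Omega> u) x * v x) + t * (drift w (wgrad \<Omega> w) x * v x)"
      using wgrad_lincomb[OF u w, of s t]
    proof eventually_elim
      case (elim x)
      then show ?case by (simp add: drift_eq inner_add_right algebra_simps)
    qed
  qed (use drift_mult_integrable[OF _ H10_sqint[OF v]] z u w in auto)
  then show ?thesis unfolding B_def using drift_mult_integrable[OF _ H10_sqint[OF v]] u w by simp
qed

text \<open>Cauchy-Schwarz in L2, with Poincare turning both L2 norms into energy norms; K and L
  bound the field and its divergence.\<close>

lemma B_bounded:
  obtains C where "0 < C" "\<And>u w. H10 \<Omega> u \<Longrightarrow> H10 \<Omega> w \<Longrightarrow> \<bar>B u w\<bar> \<le> C * energy_norm u * energy_norm w"
proof -
  obtain P where P: "0 < P" "\<And>u G. H10_with_grad \<Omega> u G \<Longrightarrow> l2n M u \<le> P * l2n M G"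
    by (rule Poincare) blast
  obtain K L where KL: "0 < K" "0 < L"
    "\<And>u G. sqint M u \<Longrightarrow> sqint M G \<Longrightarrow> sqint M (drift u G) \<and> l2n M (drift u G) \<le> K * l2n M G + L * l2n M u"
    by (rule drift_bound) blast
  have "\<bar>B u w\<bar> \<le> ((K + L * P) * P) * energy_norm u * energy_norm w" if u: "H10 \<Omega> u" and w: "H10 \<Omega> w" for u w
  proof -
    note squ = H10_sqint[OF u] wgrad_sqint[OF u]
    have "\<bar>B u w\<bar> \<le> l2n M (drift u (wgrad \<Omega> u)) * l2n M w"
      unfolding B_def using l2_Cauchy_Schwarz[OF sqint_drift[OF squ] H10_sqint[OF w]] by simp
    also have "\<dots> \<le> (K * energy_norm u + L * (P * energy_norm u)) * (P * energy_norm w)"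
    proof (intro mult_mono)
      have "L * l2n M u \<le> L * (P * energy_norm u)"
        using P(2)[OF wgrad_H10[OF u]] KL(2) unfolding energy_norm_def by (intro mult_left_mono) auto
      then show "l2n M (drift u (wgrad \<Omega> u)) \<le> K * energy_norm u + L * (P * energy_norm u)"
        using KL(3)[OF squ] unfolding energy_norm_def by linarith
      show "l2n M w \<le> P * energy_norm w" using P(2)[OF wgrad_H10[OF w]] by (simp add: energy_norm_def)
    qed (use KL P in \<open>auto simp: energy_norm_def\<close>)
    finally show ?thesis by (simp add: algebra_simps)
  qed
  then show thesis using KL P by (intro that[of "(K + L * P) * P"]) (auto intro!: mult_pos_pos add_pos_pos)
qed

section \<open>Convexity, semicontinuity and coercivity of Psi\<close>

lemma powr_integrable: "H10 \<Omega> u \<Longrightarrow> integrable M (\<lambda>x. \<bar>u x\<bar> powr p)"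
  using p_gt_1 p_le card_ge_3 by (intro H10_Sobolev_integrable) auto

lemma f_mult_integrable: "sqint M u \<Longrightarrow> integrable M (\<lambda>x. f x * u x)"
  using sqint_inner_integrable[OF sqint_f] by simp

lemma div_mult_integrable: "sqint M u \<Longrightarrow> sqint M w \<Longrightarrow> integrable M (\<lambda>x. div_field a x * (u x * w x))"
  using sqint_inner_integrable[OF sqint_div] by (simp add: mult.assoc)

lemma div_square_integrable: "sqint M u \<Longrightarrow> integrable M (\<lambda>x. div_field a x * (u x)\<^sup>2)"
  using div_mult_integrable by (simp add: power2_eq_square)

lemma Psi_eq: "Psi \<Omega> a f p u = (1/2) * (energy_norm u)\<^sup>2 + (1/p) * integral\<^sup>L M (\<lambda>x. \<bar>u x\<bar> powr p)
   + integral\<^sup>L M (\<lambda>x. f x * u x) + (1/4) * integral\<^sup>L M (\<lambda>x. div_field a x * (u x)\<^sup>2)"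
  by (simp add: Psi_def energy_norm_def l2n_power2)

lemma energy_norm_lincomb_power2:
  assumes u: "H10 \<Omega> u" and w: "H10 \<Omega> w"
  shows "(energy_norm (\<lambda>x. s * u x + t * w x))\<^sup>2 = s\<^sup>2 * (energy_norm u)\<^sup>2
    + 2 * s * t * integral\<^sup>L M (\<lambda>x. wgrad \<Omega> u x \<bullet> wgrad \<Omega> w x) + t\<^sup>2 * (energy_norm w)\<^sup>2"
proof -
  have "energy_norm (\<lambda>x. s * u x + t * w x) = l2n M (\<lambda>x. s *\<^sub>R wgrad \<Omega> u x + t *\<^sub>R wgrad \<Omega> w x)"
    unfolding energy_norm_def
    by (intro l2n_cong_AE wgrad_sqint H10_lincomb sqint_lincomb wgrad_lincomb assms)
  then show ?thesis
    using integral_norm_lincomb_power2[OF wgrad_sqint[OF u] wgrad_sqint[OF w], of s t]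
    by (simp add: l2n_power2 energy_norm_def)
qed

text \<open>The Dirichlet term satisfies the inequality with equality and so supplies the whole
  quadratic gap. The linear term is neutral; the power and divergence terms are convex, the latter
  because div a is nonnegative.\<close>

lemma Psi_convex:
  assumes u: "H10 \<Omega> u" and w: "H10 \<Omega> w" and t: "0 \<le> t" "t \<le> 1"
  shows "Psi \<Omega> a f p (\<lambda>x. (1 - t) * u x + t * w x) + t * (1 - t) / 2 * (energy_norm (\<lambda>x. w x - u x))\<^sup>2
    \<le> (1 - t) * Psi \<Omega> a f p u + t * Psi \<Omega> a f p w"
proof -
  let ?z = "\<lambda>x. (1 - t) * u x + t * w x"
  note sq = H10_sqint[OF u] H10_sqint[OF w]
  have z: "H10 \<Omega> ?z" by (rule H10_lincomb[OF u w])
  define c where "c = integral\<^sup>L M (\<lambda>x. wgrad \<Omega> u x \<bullet> wgrad \<Omega> w x)"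
  have diff: "(energy_norm (\<lambda>x. w x - u x))\<^sup>2 = (energy_norm u)\<^sup>2 - 2 * c + (energy_norm w)\<^sup>2"
    using energy_norm_lincomb_power2[OF u w, of "-1" 1] by (simp add: c_def)
  have energy: "(1/2) * (energy_norm ?z)\<^sup>2 + t * (1 - t) / 2 * (energy_norm (\<lambda>x. w x - u x))\<^sup>2
      = (1 - t) * ((1/2) * (energy_norm u)\<^sup>2) + t * ((1/2) * (energy_norm w)\<^sup>2)"
    unfolding energy_norm_lincomb_power2[OF u w, of "1 - t" t] c_def[symmetric] diff
    by (simp add: power2_eq_square field_simps)
  have "integral\<^sup>L M (\<lambda>x. \<bar>?z x\<bar> powr p) \<le> integral\<^sup>L M (\<lambda>x. (1 - t) * \<bar>u x\<bar> powr p + t * \<bar>w x\<bar> powr p)"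
  proof (rule integral_mono)
    show "\<bar>?z x\<bar> powr p \<le> (1 - t) * \<bar>u x\<bar> powr p + t * \<bar>w x\<bar> powr p" for x
      using convex_onD[OF convex_abs_powr[OF p_gt_1] t, of "u x" "w x"] by simp
  qed (use powr_integrable z u w in auto)
  then have pow: "integral\<^sup>L M (\<lambda>x. \<bar>?z x\<bar> powr p)
      \<le> (1 - t) * integral\<^sup>L M (\<lambda>x. \<bar>u x\<bar> powr p) + t * integral\<^sup>L M (\<lambda>x. \<bar>w x\<bar> powr p)"
    using powr_integrable u w by simp
  have "integral\<^sup>L M (\<lambda>x. f x * ?z x) = integral\<^sup>L M (\<lambda>x. (1 - t) * (f x * u x) + t * (f x * w x))"
    by (rule Bochner_Integration.integral_cong) (simp_all add: algebra_simps)
  then have lin: "integral\<^sup>L M (\<lambda>x. f x * ?z x)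
      = (1 - t) * integral\<^sup>L M (\<lambda>x. f x * u x) + t * integral\<^sup>L M (\<lambda>x. f x * w x)"
    using f_mult_integrable sq by simp
  have "integral\<^sup>L M (\<lambda>x. div_field a x * (?z x)\<^sup>2)
      \<le> integral\<^sup>L M (\<lambda>x. (1 - t) * (div_field a x * (u x)\<^sup>2) + t * (div_field a x * (w x)\<^sup>2))"
  proof (rule integral_mono)
    fix x assume "x \<in> space M"
    then have d: "0 \<le> div_field a x" using div_nonneg by simp
    \<comment> \<open>This product is the exact convexity gap of the square.\<close>
    have "0 \<le> t * (1 - t) * (u x - w x)\<^sup>2" using t by simp
    then have "(?z x)\<^sup>2 \<le> (1 - t) * (u x)\<^sup>2 + t * (w x)\<^sup>2"
      by (simp add: power2_eq_square algebra_simps)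
    from mult_left_mono[OF this d]
    show "div_field a x * (?z x)\<^sup>2 \<le> (1 - t) * (div_field a x * (u x)\<^sup>2) + t * (div_field a x * (w x)\<^sup>2)"
      by (simp add: algebra_simps)
  qed (use div_square_integrable H10_sqint[OF z] sq in auto)
  then have dv: "integral\<^sup>L M (\<lambda>x. div_field a x * (?z x)\<^sup>2)
      \<le> (1 - t) * integral\<^sup>L M (\<lambda>x. div_field a x * (u x)\<^sup>2) + t * integral\<^sup>L M (\<lambda>x. div_field a x * (w x)\<^sup>2)"
    using div_square_integrable sq by simp
  have "(1/p) * integral\<^sup>L M (\<lambda>x. \<bar>?z x\<bar> powr p)
      \<le> (1/p) * ((1 - t) * integral\<^sup>L M (\<lambda>x. \<bar>u x\<bar> powr p) + t * integral\<^sup>L M (\<lambda>x. \<bar>w x\<bar> powr p))"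
    using pow p_gt_1 by (intro mult_left_mono) auto
  then show ?thesis
    using energy lin dv unfolding Psi_eq distrib_left[of "1/p"] distrib_left[of t] distrib_left[of "1 - t"]
    by (simp add: mult.left_commute)
qed

text \<open>All terms other than the power converge along \<open>U\<close>. As the values of Psi
  converge by assumption, the power integrals converge too, and Fatou's lemma along an a.e.
  convergent subsequence compares their limit with the integral for u.\<close>

lemma Psi_lsc:
  assumes U: "\<And>k::nat. H10 \<Omega> (U k)" and u: "H10 \<Omega> u"
    and lim: "(\<lambda>k. energy_norm (\<lambda>x. U k x - u x)) \<longlonglongrightarrow> 0" and L: "(\<lambda>k. Psi \<Omega> a f p (U k)) \<longlonglongrightarrow> L"
  shows "Psi \<Omega> a f p u \<le> L"
proof -
  obtain P where P: "0 < P" "\<And>u G. H10_with_grad \<Omega> u G \<Longrightarrow> l2n M u \<le> P * l2n M G"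
    by (rule Poincare) blast
  have "(\<lambda>k. l2n M (\<lambda>x. wgrad \<Omega> (U k) x - wgrad \<Omega> u x)) \<longlonglongrightarrow> 0"
    using lim unfolding energy_norm_diff[OF U u] .
  then have energy: "(\<lambda>k. energy_norm (U k)) \<longlonglongrightarrow> energy_norm u"
    unfolding energy_norm_def by (rule l2n_tendsto[OF wgrad_sqint[OF U] wgrad_sqint[OF u]])
  have l2: "(\<lambda>k. l2n M (\<lambda>x. U k x - u x)) \<longlonglongrightarrow> 0"
  proof (rule Lim_null_comparison)
    show "\<forall>\<^sub>F k in sequentially. norm (l2n M (\<lambda>x. U k x - u x)) \<le> P * energy_norm (\<lambda>x. U k x - u x)"
      unfolding energy_norm_def using P(2)[OF wgrad_H10[OF H10_diff[OF U u]]] by simp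
    show "(\<lambda>k. P * energy_norm (\<lambda>x. U k x - u x)) \<longlonglongrightarrow> 0" by (rule tendsto_mult_right_zero[OF lim])
  qed
  note sqU = H10_sqint[OF U] and squ = H10_sqint[OF u]
  have flim: "(\<lambda>k. integral\<^sup>L M (\<lambda>x. f x * U k x)) \<longlonglongrightarrow> integral\<^sup>L M (\<lambda>x. f x * u x)"
    using l2_inner_tendsto[OF sqint_f sqint_f _ sqU squ l2] by (simp add: l2n_def)
  obtain C where C: "0 < C" "\<And>x. x \<in> \<Omega> \<Longrightarrow> norm (div_field a x) \<le> C"
    by (rule bounded_on_closure[OF div_continuous]) blast
  have "(\<lambda>k. l2n M (\<lambda>x. div_field a x * U k x - div_field a x * u x)) \<longlonglongrightarrow> 0"
  proof (rule Lim_null_comparison)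
    have "l2n M (\<lambda>x. div_field a x * U k x - div_field a x * u x) \<le> C * l2n M (\<lambda>x. U k x - u x)" for k
      by (rule l2n_mono[OF sqint_diff[OF sqint_div[OF sqU] sqint_div[OF squ]] sqint_diff[OF sqU squ]])
        (use C in \<open>auto simp: abs_mult intro!: mult_right_mono simp flip: right_diff_distrib\<close>)
    then show "\<forall>\<^sub>F k in sequentially. norm (l2n M (\<lambda>x. div_field a x * U k x - div_field a x * u x))
        \<le> C * l2n M (\<lambda>x. U k x - u x)" by simp
    show "(\<lambda>k. C * l2n M (\<lambda>x. U k x - u x)) \<longlonglongrightarrow> 0" by (rule tendsto_mult_right_zero[OF l2])
  qed
  from l2_inner_tendsto[OF sqint_div[OF sqU] sqint_div[OF squ] this sqU squ l2]
  have dlim: "(\<lambda>k. integral\<^sup>L M (\<lambda>x. div_field a x * (U k x)\<^sup>2)) \<longlonglongrightarrow> integral\<^sup>L M (\<lambda>x. div_field a x * (u x)\<^sup>2)"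
    by (simp add: power2_eq_square mult.assoc)
  define rest where "rest v = (1/2) * (energy_norm v)\<^sup>2 + integral\<^sup>L M (\<lambda>x. f x * v x)
    + (1/4) * integral\<^sup>L M (\<lambda>x. div_field a x * (v x)\<^sup>2)" for v
  have rest: "(\<lambda>k. rest (U k)) \<longlonglongrightarrow> rest u"
    unfolding rest_def by (intro tendsto_intros energy flim dlim)
  have Psi_rest: "integral\<^sup>L M (\<lambda>x. \<bar>v x\<bar> powr p) = p * (Psi \<Omega> a f p v - rest v)" for v
    using p_gt_1 by (simp add: Psi_eq rest_def)
  have plim: "(\<lambda>k. integral\<^sup>L M (\<lambda>x. \<bar>U k x\<bar> powr p)) \<longlonglongrightarrow> p * (L - rest u)"
    unfolding Psi_rest by (intro tendsto_intros L rest)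
  obtain r where r: "strict_mono r" "AE x in M. (\<lambda>k. U (r k) x) \<longlonglongrightarrow> u x"
    by (rule l2_AE_subseq[OF sqU squ l2]) blast
  \<comment> \<open>The slack e turns convergence of the integrals into an eventual bound, as
    \<open>fatou_real\<close> requires.\<close>
  have "integral\<^sup>L M (\<lambda>x. \<bar>u x\<bar> powr p) \<le> p * (L - rest u) + e" if "e > 0" for e
  proof (rule fatou_real(2))
    show "AE x in M. (\<lambda>k. \<bar>U (r k) x\<bar> powr p) \<longlonglongrightarrow> \<bar>u x\<bar> powr p"
      using r(2) by eventually_elim (intro tendsto_intros tendsto_powr', use p_gt_1 in auto)
    have "\<forall>\<^sub>F k in sequentially. integral\<^sup>L M (\<lambda>x. \<bar>U (r k) x\<bar> powr p) < p * (L - rest u) + e"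
      using LIMSEQ_subseq_LIMSEQ[OF plim r(1)] that by (intro order_tendstoD(2)) (auto simp: o_def)
    then show "\<forall>\<^sub>F k in sequentially. integral\<^sup>L M (\<lambda>x. \<bar>U (r k) x\<bar> powr p) \<le> p * (L - rest u) + e"
      by eventually_elim simp
  qed (use powr_integrable U u in auto)
  then have "integral\<^sup>L M (\<lambda>x. \<bar>u x\<bar> powr p) \<le> p * (L - rest u)" by (rule field_le_epsilon)
  then show ?thesis using p_gt_1 by (simp add: Psi_rest)
qed

text \<open>The power and divergence terms are nonnegative and are dropped; Cauchy-Schwarz and
  Poincare control the linear term, giving c = \<open>l2n M f * P\<close> and d = 0.\<close>

lemma Psi_below: "\<exists>c d. \<forall>u\<in>{u. H10 \<Omega> u}. (energy_norm u)\<^sup>2 / 2 - c * energy_norm u - d \<le> Psi \<Omega> a f p u"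
proof -
  obtain P where P: "0 < P" "\<And>u G. H10_with_grad \<Omega> u G \<Longrightarrow> l2n M u \<le> P * l2n M G"
    by (rule Poincare) blast
  have "(energy_norm u)\<^sup>2 / 2 - l2n M f * P * energy_norm u - 0 \<le> Psi \<Omega> a f p u" if u: "H10 \<Omega> u" for u
  proof -
    have "\<bar>integral\<^sup>L M (\<lambda>x. f x * u x)\<bar> \<le> l2n M f * l2n M u"
      using l2_Cauchy_Schwarz[OF sqint_f H10_sqint[OF u]] by simp
    also have "\<dots> \<le> l2n M f * (P * energy_norm u)"
      using P(2)[OF wgrad_H10[OF u]] by (intro mult_left_mono) (auto simp: energy_norm_def)
    finally have "- (l2n M f * P * energy_norm u) \<le> integral\<^sup>L M (\<lambda>x. f x * u x)" by (simp add: mult.assoc)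
    moreover have "0 \<le> (1/p) * integral\<^sup>L M (\<lambda>x. \<bar>u x\<bar> powr p)" using p_gt_1 by simp
    moreover have "0 \<le> integral\<^sup>L M (\<lambda>x. div_field a x * (u x)\<^sup>2)"
      by (intro integral_nonneg_AE AE_I2) (simp add: div_nonneg)
    ultimately show ?thesis unfolding Psi_eq by linarith
  qed
  then show ?thesis by blast
qed

text \<open>Testing the variational inequality with \<open>u + t \<phi>\<close> and letting \<open>t\<close> tend to \<open>0\<close>; the power term is
  handled from above by its tangent at \<open>u + t \<phi>\<close>.\<close>

lemma variational_inequality_test:
  assumes u: "H10 \<Omega> u" and var: "\<And>w. H10 \<Omega> w \<Longrightarrow> Psi \<Omega> a f p u + B u w \<le> Psi \<Omega> a f p w"
    and \<phi>: "test_fun \<Omega> \<phi>"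
  shows "B u \<phi> \<le> integral\<^sup>L M (\<lambda>x. wgrad \<Omega> u x \<bullet> grad \<phi> x) + integral\<^sup>L M (\<lambda>x. (\<bar>u x\<bar> powr (p - 2) * u x) * \<phi> x)
      + integral\<^sup>L M (\<lambda>x. f x * \<phi> x) + (1/2) * integral\<^sup>L M (\<lambda>x. div_field a x * (u x * \<phi> x))"
    "integrable M (\<lambda>x. (\<bar>u x\<bar> powr (p - 2) * u x) * \<phi> x)"
proof -
  define \<beta> where "\<beta> s = \<bar>s\<bar> powr (p - 2) * s" for s
  have \<phi>H: "H10 \<Omega> \<phi>" using test_fun_H10[OF \<phi>] by (auto simp: H10_def)
  note squ = H10_sqint[OF u] and sq\<phi> = H10_sqint[OF \<phi>H]
  note [measurable] = sqint_measurable[OF squ] sqint_measurable[OF sq\<phi>]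
  have [measurable]: "\<beta> \<in> borel_measurable borel" unfolding \<beta>_def[abs_def] by measurable
  obtain C where C: "0 \<le> C" "\<And>x. \<bar>\<phi> x\<bar> \<le> C" using test_fun_bounded[OF \<phi>] by blast
  define T where "T k = 1 / real (Suc k)" for k
  have T: "0 < T k" "T k \<le> 1" for k by (auto simp: T_def)
  have T_lim: "T \<longlonglongrightarrow> 0" using LIMSEQ_inverse_real_of_nat by (simp add: T_def[abs_def] inverse_eq_divide)
  \<comment> \<open>A majorant for all t in [0, 1] at once: with s = u + t \<phi> one has |s|^(p-1)
    \<le> 1 + |s|^p and |s| \<le> 2 max(|u|, C), where C bounds |\<phi>|.\<close>
  define W where "W x = C * (1 + 2 powr p * (\<bar>u x\<bar> powr p + C powr p))" for x
  have W_int: "integrable M W"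
    unfolding W_def using powr_integrable[OF u] finite_measure.integrable_const[OF finite_M]
    by (intro integrable_mult_right Bochner_Integration.integrable_add)
  have dom: "norm (\<beta> (u x + t * \<phi> x) * \<phi> x) \<le> W x" if t: "0 \<le> t" "t \<le> 1" for t x
  proof -
    let ?s = "u x + t * \<phi> x"
    have "\<bar>t * \<phi> x\<bar> \<le> C" using C(2)[of x] t mult_mono[of t 1 "\<bar>\<phi> x\<bar>" C] by (simp add: abs_mult)
    then have s_le: "\<bar>?s\<bar> \<le> 2 * max \<bar>u x\<bar> C" by linarith
    have "\<bar>?s\<bar> powr (p - 1) \<le> 1 + \<bar>?s\<bar> powr p"
    proof (cases "\<bar>?s\<bar> \<le> 1")
      case True
      then have "\<bar>?s\<bar> powr (p - 1) \<le> 1" using powr_mono2[of "p - 1" "\<bar>?s\<bar>" 1] p_gt_1 by simp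
      then show ?thesis by (simp add: add_increasing2)
    next
      case False
      then have "\<bar>?s\<bar> powr (p - 1) \<le> \<bar>?s\<bar> powr p" by (intro powr_mono) auto
      then show ?thesis by simp
    qed
    also have "\<bar>?s\<bar> powr p \<le> (2 * max \<bar>u x\<bar> C) powr p" using s_le p_gt_1 by (intro powr_mono2) auto
    also have "\<dots> = 2 powr p * (max \<bar>u x\<bar> C) powr p" by (intro powr_mult)
    also have "(max \<bar>u x\<bar> C) powr p \<le> \<bar>u x\<bar> powr p + C powr p" by (simp add: max_def)
    finally have "\<bar>?s\<bar> powr (p - 1) \<le> 1 + 2 powr p * (\<bar>u x\<bar> powr p + C powr p)" by simp
    then have "\<bar>?s\<bar> powr (p - 1) * \<bar>\<phi> x\<bar> \<le> (1 + 2 powr p * (\<bar>u x\<bar> powr p + C powr p)) * C"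
      using C by (intro mult_mono) (auto simp: add_nonneg_nonneg)
    moreover have "norm (\<beta> ?s * \<phi> x) \<le> \<bar>?s\<bar> powr (p - 1) * \<bar>\<phi> x\<bar>"
      unfolding \<beta>_def abs_powr_mult_eq by (simp add: abs_mult sgn_if)
    ultimately show ?thesis by (simp add: W_def mult.commute)
  qed
  have \<beta>_int: "integrable M (\<lambda>x. \<beta> (u x + t * \<phi> x) * \<phi> x)" if "0 \<le> t" "t \<le> 1" for t
    by (rule Bochner_Integration.integrable_bound[OF W_int])
      (use dom[OF that] in \<open>auto intro: order_trans[OF _ abs_ge_self]\<close>)
  then show "integrable M (\<lambda>x. (\<bar>u x\<bar> powr (p - 2) * u x) * \<phi> x)"
    using \<beta>_int[of 0] by (simp add: \<beta>_def)
  have \<beta>_lim: "(\<lambda>k. integral\<^sup>L M (\<lambda>x. \<beta> (u x + T k * \<phi> x) * \<phi> x)) \<longlonglongrightarrow> integral\<^sup>L M (\<lambda>x. \<beta> (u x) * \<phi> x)"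
  proof (rule integral_dominated_convergence[OF _ _ W_int])
    show "AE x in M. (\<lambda>k. \<beta> (u x + T k * \<phi> x) * \<phi> x) \<longlonglongrightarrow> \<beta> (u x) * \<phi> x"
    proof (rule AE_I2)
      fix x
      have "(\<lambda>k. u x + T k * \<phi> x) \<longlonglongrightarrow> u x + 0 * \<phi> x" by (intro tendsto_intros T_lim)
      then have "(\<lambda>k. u x + T k * \<phi> x) \<longlonglongrightarrow> u x" by simp
      from isCont_tendsto_compose[OF isCont_abs_powr_mult[OF p_gt_1] this]
      show "(\<lambda>k. \<beta> (u x + T k * \<phi> x) * \<phi> x) \<longlonglongrightarrow> \<beta> (u x) * \<phi> x"
        unfolding \<beta>_def by (rule tendsto_mult) (rule tendsto_const)
    qed
    show "AE x in M. norm (\<beta> (u x + T k * \<phi> x) * \<phi> x) \<le> W x" for k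
      using dom[of "T k"] T[of k] by (intro AE_I2) simp
  qed measurable
  define c where "c = integral\<^sup>L M (\<lambda>x. wgrad \<Omega> u x \<bullet> wgrad \<Omega> \<phi> x)"
  define F where "F = integral\<^sup>L M (\<lambda>x. f x * \<phi> x)"
  define d where "d = integral\<^sup>L M (\<lambda>x. div_field a x * (u x * \<phi> x))"
  define e where "e = integral\<^sup>L M (\<lambda>x. div_field a x * (\<phi> x)\<^sup>2)"
  have le: "B u \<phi> \<le> c + t / 2 * (energy_norm \<phi>)\<^sup>2 + integral\<^sup>L M (\<lambda>x. \<beta> (u x + t * \<phi> x) * \<phi> x) + F
      + d / 2 + t / 4 * e" if t: "0 < t" "t \<le> 1" for t
  proof -
    let ?w = "\<lambda>x. u x + t * \<phi> x"
    have w: "H10 \<Omega> ?w" using H10_lincomb[OF u \<phi>H, of 1 t] by simp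
    \<comment> \<open>Skewness removes the term B u u, so that what is left is of first order in t
      and can be divided by t.\<close>
    have "B u ?w = t * B u \<phi>"
      using B_lin_right[OF u \<phi>H u, of 1 t] B_skew[OF u] by simp
    with var[OF w] have 0: "Psi \<Omega> a f p u + t * B u \<phi> \<le> Psi \<Omega> a f p ?w" by simp
    have 1: "(energy_norm ?w)\<^sup>2 = (energy_norm u)\<^sup>2 + 2 * t * c + t\<^sup>2 * (energy_norm \<phi>)\<^sup>2"
      using energy_norm_lincomb_power2[OF u \<phi>H, of 1 t] by (simp add: c_def)
    have "integral\<^sup>L M (\<lambda>x. \<bar>?w x\<bar> powr p) \<le> integral\<^sup>L M (\<lambda>x. \<bar>u x\<bar> powr p + p * t * (\<beta> (?w x) * \<phi> x))"
    proof (rule integral_mono)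
      show "\<bar>?w x\<bar> powr p \<le> \<bar>u x\<bar> powr p + p * t * (\<beta> (?w x) * \<phi> x)" for x
        using abs_powr_above_tangent[OF p_gt_1, of "?w x" "u x"] by (simp add: \<beta>_def algebra_simps)
    qed (use powr_integrable[OF w] powr_integrable[OF u] \<beta>_int[of t] t in auto)
    then have "integral\<^sup>L M (\<lambda>x. \<bar>?w x\<bar> powr p)
        \<le> integral\<^sup>L M (\<lambda>x. \<bar>u x\<bar> powr p) + p * t * integral\<^sup>L M (\<lambda>x. \<beta> (?w x) * \<phi> x)"
      using powr_integrable[OF u] \<beta>_int[of t] t by simp
    then have 2: "(1/p) * integral\<^sup>L M (\<lambda>x. \<bar>?w x\<bar> powr p)
        \<le> (1/p) * integral\<^sup>L M (\<lambda>x. \<bar>u x\<bar> powr p) + t * integral\<^sup>L M (\<lambda>x. \<beta> (?w x) * \<phi> x)"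
      using p_gt_1 by (simp add: field_simps)
    have 3: "integral\<^sup>L M (\<lambda>x. f x * ?w x) = integral\<^sup>L M (\<lambda>x. f x * u x) + t * F"
    proof -
      have "(\<lambda>x. f x * ?w x) = (\<lambda>x. f x * u x + t * (f x * \<phi> x))" by (simp add: algebra_simps fun_eq_iff)
      then show ?thesis using f_mult_integrable[OF squ] f_mult_integrable[OF sq\<phi>] by (simp add: F_def)
    qed
    have 4: "integral\<^sup>L M (\<lambda>x. div_field a x * (?w x)\<^sup>2)
        = integral\<^sup>L M (\<lambda>x. div_field a x * (u x)\<^sup>2) + 2 * t * d + t\<^sup>2 * e"
    proof -
      have "(\<lambda>x. div_field a x * (?w x)\<^sup>2) = (\<lambda>x. div_field a x * (u x)\<^sup>2
          + 2 * t * (div_field a x * (u x * \<phi> x)) + t\<^sup>2 * (div_field a x * (\<phi> x)\<^sup>2))"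
        by (simp add: power2_eq_square algebra_simps fun_eq_iff)
      then show ?thesis
        using div_square_integrable[OF squ] div_square_integrable[OF sq\<phi>] div_mult_integrable[OF squ sq\<phi>]
        by (simp add: d_def e_def)
    qed
    have "t * B u \<phi> \<le> t * (c + t / 2 * (energy_norm \<phi>)\<^sup>2 + integral\<^sup>L M (\<lambda>x. \<beta> (?w x) * \<phi> x) + F
      + d / 2 + t / 4 * e)"
      using 0 2 unfolding Psi_eq 1 3 4 by (simp add: power2_eq_square algebra_simps)
    then show ?thesis using t by simp
  qed
  have "B u \<phi> \<le> c + 0 / 2 * (energy_norm \<phi>)\<^sup>2 + integral\<^sup>L M (\<lambda>x. \<beta> (u x) * \<phi> x) + F + d / 2 + 0 / 4 * e"
  proof (rule LIMSEQ_le_const)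
    show "(\<lambda>k. c + T k / 2 * (energy_norm \<phi>)\<^sup>2 + integral\<^sup>L M (\<lambda>x. \<beta> (u x + T k * \<phi> x) * \<phi> x) + F + d / 2 + T k / 4 * e)
        \<longlonglongrightarrow> c + 0 / 2 * (energy_norm \<phi>)\<^sup>2 + integral\<^sup>L M (\<lambda>x. \<beta> (u x) * \<phi> x) + F + d / 2 + 0 / 4 * e"
      by (intro tendsto_intros T_lim \<beta>_lim) auto
    show "\<exists>N. \<forall>k\<ge>N. B u \<phi> \<le> c + T k / 2 * (energy_norm \<phi>)\<^sup>2
        + integral\<^sup>L M (\<lambda>x. \<beta> (u x + T k * \<phi> x) * \<phi> x) + F + d / 2 + T k / 4 * e"
      using le[OF T] by blast
  qed
  moreover have "c = integral\<^sup>L M (\<lambda>x. wgrad \<Omega> u x \<bullet> grad \<phi> x)"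
    unfolding c_def
  proof (rule integral_cong_AE)
    show "AE x in M. wgrad \<Omega> u x \<bullet> wgrad \<Omega> \<phi> x = wgrad \<Omega> u x \<bullet> grad \<phi> x"
      using wgrad_unique[OF test_fun_H10[OF \<phi>]] by eventually_elim simp
  qed (use sqint_inner_integrable[OF wgrad_sqint[OF u]] wgrad_sqint[OF \<phi>H] sqint_grad_test[OF \<phi>] in auto)
  ultimately show "B u \<phi> \<le> integral\<^sup>L M (\<lambda>x. wgrad \<Omega> u x \<bullet> grad \<phi> x) + integral\<^sup>L M (\<lambda>x. (\<bar>u x\<bar> powr (p - 2) * u x) * \<phi> x)
      + integral\<^sup>L M (\<lambda>x. f x * \<phi> x) + (1/2) * integral\<^sup>L M (\<lambda>x. div_field a x * (u x * \<phi> x))"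
    by (simp add: \<beta>_def F_def d_def)
qed

text \<open>Testing with \<phi> and with -\<phi> turns the inequality into an equation. Half the
  integral of div(a) u \<phi> then stands on both sides, once from the drift and once as the
  derivative of the divergence term in Psi, and cancels.\<close>

lemma variational_inequality_weak_solution:
  assumes u: "H10 \<Omega> u" and var: "\<And>w. H10 \<Omega> w \<Longrightarrow> Psi \<Omega> a f p u + B u w \<le> Psi \<Omega> a f p w"
  shows "weak_solution \<Omega> a f p u"
  unfolding weak_solution_def
proof (intro conjI u allI impI)
  fix \<phi> assume \<phi>: "test_fun \<Omega> \<phi>"
  have \<phi>H: "H10 \<Omega> \<phi>" using test_fun_H10[OF \<phi>] by (auto simp: H10_def)
  note squ = H10_sqint[OF u] and sq\<phi> = H10_sqint[OF \<phi>H]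
  have m\<phi>: "test_fun \<Omega> (\<lambda>x. - \<phi> x)" "grad (\<lambda>x. - \<phi> x) x = - grad \<phi> x" for x
    using test_fun_lincomb[OF \<phi> \<phi>, of "-1" 0] by simp_all
  let ?R = "integral\<^sup>L M (\<lambda>x. wgrad \<Omega> u x \<bullet> grad \<phi> x) + integral\<^sup>L M (\<lambda>x. (\<bar>u x\<bar> powr (p - 2) * u x) * \<phi> x)
      + integral\<^sup>L M (\<lambda>x. f x * \<phi> x) + (1/2) * integral\<^sup>L M (\<lambda>x. div_field a x * (u x * \<phi> x))"
  have "B u (\<lambda>x. - \<phi> x) \<le> - ?R"
    using variational_inequality_test(1)[OF u var m\<phi>(1)] unfolding m\<phi>(2) by simp
  moreover have "B u (\<lambda>x. - \<phi> x) = - B u \<phi>" by (simp add: B_def)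
  ultimately have BR: "B u \<phi> = ?R" using variational_inequality_test(1)[OF u var \<phi>] by simp
  have aint: "integrable M (\<lambda>x. (\<Sum>i\<in>UNIV. a i x * wgrad \<Omega> u x $ i) * \<phi> x)"
    and Beq: "B u \<phi> = integral\<^sup>L M (\<lambda>x. (\<Sum>i\<in>UNIV. a i x * wgrad \<Omega> u x $ i) * \<phi> x)
      + (1/2) * integral\<^sup>L M (\<lambda>x. div_field a x * (u x * \<phi> x))"
  proof -
    have eq: "(\<lambda>x. (\<Sum>i\<in>UNIV. a i x * wgrad \<Omega> u x $ i) * \<phi> x) =
        (\<lambda>x. drift u (wgrad \<Omega> u) x * \<phi> x - (1/2) * (div_field a x * (u x * \<phi> x)))"
      by (simp add: drift_def algebra_simps fun_eq_iff)
    show "integrable M (\<lambda>x. (\<Sum>i\<in>UNIV. a i x * wgrad \<Omega> u x $ i) * \<phi> x)"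
      unfolding eq using drift_mult_integrable[OF u sq\<phi>] div_mult_integrable[OF squ sq\<phi>] by simp
    show "B u \<phi> = integral\<^sup>L M (\<lambda>x. (\<Sum>i\<in>UNIV. a i x * wgrad \<Omega> u x $ i) * \<phi> x)
      + (1/2) * integral\<^sup>L M (\<lambda>x. div_field a x * (u x * \<phi> x))"
      unfolding eq using drift_mult_integrable[OF u sq\<phi>] div_mult_integrable[OF squ sq\<phi>] by (simp add: B_def)
  qed
  have "integral\<^sup>L M (\<lambda>x. (\<bar>u x\<bar> powr (p - 2) * u x + f x) * \<phi> x)
      = integral\<^sup>L M (\<lambda>x. (\<bar>u x\<bar> powr (p - 2) * u x) * \<phi> x) + integral\<^sup>L M (\<lambda>x. f x * \<phi> x)"
    unfolding distrib_right
    by (rule Bochner_Integration.integral_add[OF variational_inequality_test(2)[OF u var \<phi>] f_mult_integrable[OF sq\<phi>]])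
  then show "- integral\<^sup>L M (\<lambda>x. wgrad \<Omega> u x \<bullet> grad \<phi> x)
        + integral\<^sup>L M (\<lambda>x. (\<Sum>i\<in>UNIV. a i x * wgrad \<Omega> u x $ i) * \<phi> x)
        = integral\<^sup>L M (\<lambda>x. (\<bar>u x\<bar> powr (p - 2) * u x + f x) * \<phi> x)"
    using BR Beq by simp
qed

lemma variational_solution_exists:
  obtains u where "H10 \<Omega> u" "\<And>w. H10 \<Omega> w \<Longrightarrow> Psi \<Omega> a f p u + B u w \<le> Psi \<Omega> a f p w"
proof -
  obtain C where C: "0 < C" "\<And>u w. H10 \<Omega> u \<Longrightarrow> H10 \<Omega> w \<Longrightarrow> \<bar>B u w\<bar> \<le> C * energy_norm u * energy_norm w"
    by (rule B_bounded) blast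
  interpret self_dual_setting "{u. H10 \<Omega> u}" energy_norm "Psi \<Omega> a f p" B C
  proof
    have "test_fun \<Omega> (\<lambda>_. 0)"
    proof -
      have "Ck_on k UNIV (\<lambda>_::real^'n. 0::real)" for k
      proof (induction k)
        case (Suc k)
        have "partial i (\<lambda>_. 0) = (\<lambda>_. 0)" for i :: 'n by (simp add: partial_def fun_eq_iff)
        then show ?case using Suc by simp
      qed simp
      then show ?thesis by (simp add: test_fun_def smooth_on_def)
    qed
    then show "{u. H10 \<Omega> u} \<noteq> {}" using test_fun_H10 by (auto simp: H10_def)
    show "\<exists>c d. \<forall>u\<in>{u. H10 \<Omega> u}. (energy_norm u)\<^sup>2 / 2 - c * energy_norm u - d \<le> Psi \<Omega> a f p u"
      by (rule Psi_below)
    show "\<exists>u\<in>{u. H10 \<Omega> u}. (\<lambda>k. energy_norm (\<lambda>x. U k x - u x)) \<longlonglongrightarrow> 0"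
      if "\<And>k. U k \<in> {u. H10 \<Omega> u}"
        "\<And>e. e > 0 \<Longrightarrow> \<exists>K::nat. \<forall>j\<ge>K. \<forall>k\<ge>K. energy_norm (\<lambda>x. U j x - U k x) < e" for U
      using H10_complete[of U] that by auto
    show "Psi \<Omega> a f p u \<le> L"
      if "\<And>k::nat. U k \<in> {u. H10 \<Omega> u}" "u \<in> {u. H10 \<Omega> u}" "(\<lambda>k. energy_norm (\<lambda>x. U k x - u x)) \<longlonglongrightarrow> 0"
        "(\<lambda>k. Psi \<Omega> a f p (U k)) \<longlonglongrightarrow> L" for U u L
      using Psi_lsc[OF _ _ that(3,4)] that(1,2) by simp
  qed (use C B_skew B_lin_left B_lin_right Psi_convex energy_norm_lincomb H10_lincomb in
      \<open>simp_all add: energy_norm_def\<close>)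
  obtain u where "u \<in> {u. H10 \<Omega> u}" "\<And>w. w \<in> {u. H10 \<Omega> u} \<Longrightarrow> Psi \<Omega> a f p u + B u w \<le> Psi \<Omega> a f p w"
    by (rule self_dual_solution) blast
  then show thesis by (intro that[of u]) auto
qed

section \<open>The functional I\<close>

lemma I_fun_eq: "I_fun \<Omega> a f p u = ereal (Psi \<Omega> a f p u) + (SUP w\<in>{w. H10 \<Omega> w}. ereal (B u w - Psi \<Omega> a f p w))"
  by (simp add: I_fun_def Psi_star_def B_def drift_def)

text \<open>The competitor w = u in the supremum gives -Psi(u), as B u u = 0.\<close>

lemma I_fun_nonneg:
  assumes "H10 \<Omega> u" shows "0 \<le> I_fun \<Omega> a f p u"
proof -
  have "ereal (B u u - Psi \<Omega> a f p u) \<le> (SUP w\<in>{w. H10 \<Omega> w}. ereal (B u w - Psi \<Omega> a f p w))"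
    using assms by (intro SUP_upper) auto
  from add_left_mono[OF this, of "ereal (Psi \<Omega> a f p u)"] show ?thesis
    using B_skew[OF assms] by (simp add: I_fun_eq zero_ereal_def)
qed

text \<open>The variational inequality says precisely that no competitor in the supremum exceeds
  -Psi(u).\<close>

lemma variational_inequality_I_fun:
  assumes u: "H10 \<Omega> u" and var: "\<And>w. H10 \<Omega> w \<Longrightarrow> Psi \<Omega> a f p u + B u w \<le> Psi \<Omega> a f p w"
  shows "I_fun \<Omega> a f p u = 0"
proof (rule antisym[OF _ I_fun_nonneg[OF u]])
  have "(SUP w\<in>{w. H10 \<Omega> w}. ereal (B u w - Psi \<Omega> a f p w)) \<le> ereal (- Psi \<Omega> a f p u)"
    using var by (intro SUP_least) (force simp: algebra_simps)
  from add_left_mono[OF this, of "ereal (Psi \<Omega> a f p u)"] show "I_fun \<Omega> a f p u \<le> 0"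
    by (simp add: I_fun_eq zero_ereal_def)
qed

end

theorem theorem4p6:
  fixes \<Omega> :: "(real^'n) set"
    and a :: "'n \<Rightarrow> real^'n \<Rightarrow> real"
    and f :: "real^'n \<Rightarrow> real"
    and p :: real
  assumes "CARD('n) \<ge> 3"
    and "smooth_bounded_domain \<Omega>"
    and "\<forall>i. smooth_on_closure \<Omega> (a i)"
    and "\<forall>x\<in>\<Omega>. div_field a x \<ge> 0"
    and "L2 \<Omega> f"
    and "1 < p" and "p \<le> 2 * real CARD('n) / (real CARD('n) - 2)"
  shows "\<exists>ub. H10 \<Omega> ub \<and> I_fun \<Omega> a f p ub = (INF u\<in>{u. H10 \<Omega> u}. I_fun \<Omega> a f p u)
             \<and> I_fun \<Omega> a f p ub = 0 \<and> weak_solution \<Omega> a f p ub"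
proof -
  interpret semilinear_problem \<Omega> a f p
    using assms by unfold_locales (auto simp: smooth_bounded_domain_def L2_def sqint_def)
  obtain u where u: "H10 \<Omega> u" "\<And>w. H10 \<Omega> w \<Longrightarrow> Psi \<Omega> a f p u + B u w \<le> Psi \<Omega> a f p w"
    by (rule variational_solution_exists) blast
  have I0: "I_fun \<Omega> a f p u = 0" by (rule variational_inequality_I_fun[OF u])
  have "(INF u\<in>{u. H10 \<Omega> u}. I_fun \<Omega> a f p u) = 0"
  proof (rule antisym)
    show "(INF u\<in>{u. H10 \<Omega> u}. I_fun \<Omega> a f p u) \<le> 0"
      using u(1) I0 by (intro INF_lower2[of u]) auto
    show "0 \<le> (INF u\<in>{u. H10 \<Omega> u}. I_fun \<Omega> a f p u)"
      using I_fun_nonneg by (intro INF_greatest) auto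
  qed
  with u I0 show ?thesis by (intro exI[of _ u]) (simp add: variational_inequality_weak_solution)
qed

end
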